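(* There exist an absolute constant $C>0$ and, for each $\varepsilon$, a constant $C_1=C_1(\varepsilon)>0$ depending only on $\varepsilon$ such that the following holds. Let $0<\delta<\frac23$, and let $M,A\in\mathbb{N}$ satisfy $M\ge 2^{4/\delta}$ and $A=M^\delta$. Then for every $0<\varepsilon<\frac{\delta}{2}$ there exists $\mathbb{G}\subset\mathbb{A}^\infty$ with $$\mu^\infty\left(\mathbb{A}^\infty\setminus\mathbb{G}\right)\le C_1e^{-\frac{M^\varepsilon}{C}}$$ such that each Cantor set $\mathcal{C}$ arising from an element of $\mathbb{G}$ satisfies $$\left\|\mathbf{1}_{\mathcal{C}(h)}\mathcal{F}_h\mathbf{1}_{\mathcal{C}(h)}\right\|_{L^2(\mathbb{R})\to L^2(\mathbb{R})}\le Ch^{\frac12-\frac34\delta-\varepsilon}\quad\text{for all }0<h<M^{-8}.$$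
   Context: Random Cantor sets. For $M,A\in\mathbb{N}$ with $A=M^\delta$, $0<\delta<1$, let $\mathbb{A}(M,A)=\{\mathcal{A}\subset\{0,\dots,M-1\}:\mathrm{Card}(\mathcal{A})=A\}$, equipped with the uniform (normalized counting) probability measure. Define inductively $B_1=\frac1M\mathcal{A}$ with $\mathcal{A}\in\mathbb{A}(M,A)$, and for $j\ge2$, $$B_j=\bigcup_{b\in B_{j-1}}\left\{b+\frac{a}{M^j}:a\in\mathcal{A}(b)\right\},$$ where $\mathcal{A}(b)\in\mathbb{A}(M,A)$, $b\in B_{j-1}$, are independent and uniformly distributed on $\mathbb{A}(M,A)$. Thus $\mathrm{Card}(B_j)=A^j$. Set $$\mathcal{C}_j=\bigcup_{b\in B_j}\left[b,b+\frac{1}{M^j}\right],\qquad \mathcal{C}=\bigcap_{j=1}^\infty\mathcal{C}_j\subset[0,1].$$ Probability space. The choices made at the $j$-th iteration form the space $\mathbb{A}(M,A)^{A^{j-1}}$ (one alphabet for each of the $A^{j-1}$ elements of $B_{j-1}$, enumerated in increasing order; one alphabet if $j=1$) with the uniform probability measure $\mu_j$. Set $\mathbb{A}^\infty=\prod_{j=1}^\infty\mathbb{A}(M,A)^{A^{j-1}}$ with the product probability measure $\mu^\infty=\prod_{j=1}^\infty\mu_j$. Each element of $\mathbb{A}^\infty$ determines a Cantor set $\mathcal{C}$: its first component is the alphabet $\mathcal{A}$ giving $B_1=\frac1M\mathcal{A}$; for $j\ge2$, the $k$-th alphabet in its $j$-th component is taken as $\mathcal{A}(b)$ for the $k$-th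 smallest element $b$ of $B_{j-1}$, giving $B_j=\bigcup_{b\in B_{j-1}}\{b+\frac{a}{M^j}:a\in\mathcal{A}(b)\}$; and $\mathcal{C}=\bigcap_{j=1}^\infty\bigcup_{b\in B_j}[b,b+\frac{1}{M^j}]$. Notation. $\mathcal{C}(h)=\{x\in\mathbb{R}:\mathrm{dist}(x,\mathcal{C})\le h\}$ is the $h$-neighborhood of $\mathcal{C}$. $\mathbf{1}_X$ denotes the indicator function of $X$, also regarded as a multiplication operator. The semiclassical Fourier transform is $\mathcal{F}_hu(\xi)=\frac{1}{\sqrt{2\pi h}}\int_{\mathbb{R}}e^{-\frac{ix\xi}{h}}u(x)\,dx$ for $u\in C_0^\infty(\mathbb{R})$, extended to a unitary operator on $L^2(\mathbb{R})$. *)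

theory Defs
  imports "HOL-Probability.Probability"
begin

section \<open>Random Cantor sets\<close>

definition alphabets :: "nat \<Rightarrow> nat \<Rightarrow> nat set set" where
  "alphabets M A = {a. a \<subseteq> {0..<M} \<and> card a = A}"

text \<open>The choices at iteration \<open>j\<close>: one alphabet for each \<open>k < A ^ (j - 1)\<close>; the enumeration of the
  points of the previous generation starts from \<open>k = 0\<close>.\<close>

definition choices :: "nat \<Rightarrow> nat \<Rightarrow> nat \<Rightarrow> (nat \<Rightarrow> nat set) set" where
  "choices M A j = (\<Pi>\<^sub>E k\<in>{..<A ^ (j - 1)}. alphabets M A)"

definition choice_space :: "nat \<Rightarrow> nat \<Rightarrow> (nat \<Rightarrow> nat \<Rightarrow> nat set) measure" where
  "choice_space M A = (\<Pi>\<^sub>M j\<in>{1..}. uniform_count_measure (choices M A j))"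

text \<open>With the convention \<open>B\<^sub>0 = {0}\<close>, the set \<open>B\<^sub>1\<close> is an instance of the general recursion (see the lemma below).
  For a finite set \<open>B\<close>, \<open>sorted_list_of_set B ! k\<close> is its \<open>k\<close>-th smallest element (from \<open>k = 0\<close>).\<close>

primrec cantor_points :: "nat \<Rightarrow> (nat \<Rightarrow> nat \<Rightarrow> nat set) \<Rightarrow> nat \<Rightarrow> real set" where
  "cantor_points M \<omega> 0 = {0}"
| "cantor_points M \<omega> (Suc j) =
     (\<Union>k<card (cantor_points M \<omega> j).
        {sorted_list_of_set (cantor_points M \<omega> j) ! k + real a / real M ^ Suc j | a. a \<in> \<omega> (Suc j) k})"

lemma cantor_points_1: "cantor_points M \<omega> 1 = {real a / real M | a. a \<in> \<omega> 1 0}"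
  by (simp add: lessThan_Suc)

definition cantor_set :: "nat \<Rightarrow> (nat \<Rightarrow> nat \<Rightarrow> nat set) \<Rightarrow> real set" where
  "cantor_set M \<omega> = (\<Inter>j\<in>{1..}. \<Union>b\<in>cantor_points M \<omega> j. {b..b + 1 / real M ^ j})"

definition neighborhood :: "real set \<Rightarrow> real \<Rightarrow> real set" where
  "neighborhood X h = {x. infdist x X \<le> h}"


section \<open>The semiclassical Fourier transform on $L^2$\<close>

definition L2_norm :: "(real \<Rightarrow> complex) \<Rightarrow> ennreal" where
  "L2_norm u = (let I = (\<integral>\<^sup>+ x. ennreal ((cmod (u x))\<^sup>2) \<partial>lborel)
                in if I = \<infinity> then \<infinity> else ennreal (sqrt (enn2real I)))"

text \<open>Elements of $L^2$ are represented by functions, not by classes modulo null sets.\<close>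

definition L2 :: "(real \<Rightarrow> complex) set" where
  "L2 = {u \<in> borel_measurable borel. L2_norm u < \<infinity>}"

definition test_function :: "(real \<Rightarrow> complex) \<Rightarrow> bool" where
  "test_function \<phi> \<longleftrightarrow>
     (\<forall>n x. ((\<lambda>f y. vector_derivative f (at y)) ^^ n) \<phi> differentiable (at x)) \<and>
     compact (closure {x. \<phi> x \<noteq> 0})"

definition fourier_integral :: "real \<Rightarrow> (real \<Rightarrow> complex) \<Rightarrow> real \<Rightarrow> complex" where
  "fourier_integral h u \<xi> =
     complex_of_real (1 / sqrt (2 * pi * h)) *
     (\<integral>x. exp (- (\<i> * complex_of_real (x * \<xi> / h))) * u x \<partial>lborel)"

text \<open>\<open>is_fourier h u v\<close> means that \<open>v\<close> is a version of $\mathcal{F}_h u$, for the continuous extension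
  $\mathcal{F}_h$ of the integral formula from $C_0^\infty$ to $L^2$. It is a relation because
  $\mathcal{F}_h u$ is determined only up to null sets. By Plancherel and the density of
  $C_0^\infty$, such a \<open>v\<close> exists for every \<open>u\<close> in $L^2$ and is unique almost everywhere.\<close>

definition is_fourier :: "real \<Rightarrow> (real \<Rightarrow> complex) \<Rightarrow> (real \<Rightarrow> complex) \<Rightarrow> bool" where
  "is_fourier h u v \<longleftrightarrow> u \<in> L2 \<and> v \<in> L2 \<and>
     (\<exists>\<phi> :: nat \<Rightarrow> real \<Rightarrow> complex. (\<forall>n. test_function (\<phi> n)) \<and>
        (\<lambda>n. L2_norm (\<lambda>x. \<phi> n x - u x)) \<longlonglongrightarrow> 0 \<and>
        (\<lambda>n. L2_norm (\<lambda>\<xi>. fourier_integral h (\<phi> n) \<xi> - v \<xi>)) \<longlonglongrightarrow> 0)"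

definition cutoff :: "real set \<Rightarrow> (real \<Rightarrow> complex) \<Rightarrow> real \<Rightarrow> complex" where
  "cutoff X u = (\<lambda>x. indicator X x * u x)"

text \<open>The operator $\mathbf{1}_X \mathcal{F}_h \mathbf{1}_X$, again as a relation between representatives.\<close>

definition cutoff_fourier :: "real set \<Rightarrow> real \<Rightarrow> (real \<Rightarrow> complex) \<Rightarrow> (real \<Rightarrow> complex) \<Rightarrow> bool" where
  "cutoff_fourier X h u v \<longleftrightarrow> (\<exists>w. is_fourier h (cutoff X u) w \<and> v = cutoff X w)"

definition L2_opnorm :: "((real \<Rightarrow> complex) \<Rightarrow> (real \<Rightarrow> complex) \<Rightarrow> bool) \<Rightarrow> ennreal" where
  "L2_opnorm T = Sup {L2_norm v | u v. u \<in> L2 \<and> L2_norm u \<le> 1 \<and> T u v}"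

end

(*
  Cover the h-neighborhood of the Cantor set, M^-n <= h < M^-(n-1), by the intervals [b - h, b + 2h], b in B_n.
  The phases exp(-i (b + s) (b' + t) / h) differ from exp(-i b b' / h) by unimodular factors depending on b or
  on b' only, so the squared operator norm is at most 9h/(2 pi) ||E||^2 for the matrix E = (exp(-i b b' / h)).

  Decompose E according to the generation at which b and b' separate: it suffices to bound the block of E with
  rows below one cell c and columns outside c. The column points are independent of the alphabets below c.
  Refine the rows generation by generation. The Gram matrix of the block, with the undecided digits averaged, is
  at each step a sum of independent positive matrices, whose norms are controlled by the Dirichlet kernel and the
  number of points in a cell; a matrix Chernoff bound shows that it exceeds a constant times its conditional
  mean plus the size of a single summand only with exponentially small probability. This gives
  ||E||^2 <= A^(n+3) up to factors absorbed by M^(n epsilon), and A^(n+3) <= A^(3(n-1)/2) because n >= 9, that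
  is h < M^-8. For M^epsilon below a threshold depending on epsilon the probability bound is trivial.
*)

theory Submission
  imports Defs
begin

text \<open>A diagonal block has the same alphabets in its rows and columns, so its Gram matrix is
  not a sum of independent terms. Once x and y lie in different cells, the columns stay fixed while
  the rows are refined, and the new alphabets contribute independent summands, one per cell. The
  Chernoff bound uses even trace moments and exchangeable pairs. Operator bounds are inequalities
  between traces, so no eigenvalues or matrix exponentials occur. The good event must serve all h at
  once. For fixed n, h enters only through \<theta> = 1 / (h M^n) in [1/M, 1], so a net in \<theta>
  suffices. The union over net, cells and generations has at most M^(6n) members. The three surplus
  factors A in A^(n+3) have separate origins: \<theta> may be as small as 1/M, which coarsens the
  Dirichlet kernel by one generation; a single random summand contains A digits; and each cell has A
  children, whose strips overlap in their columns. A squared norm of order A^n would give the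
  exponent 1/2 - \<delta>/2, and the gap to 1/2 - 3\<delta>/4 leaves room for this loss.\<close>

section \<open>Families of square matrices\<close>

text \<open>All finite index sets \<open>V\<close> are treated at once, so that square matrices of every size form a single ring type.\<close>

typedef fmat = "{f :: nat set \<Rightarrow> nat \<Rightarrow> nat \<Rightarrow> complex.
    \<forall>V i j. \<not> (finite V \<and> i \<in> V \<and> j \<in> V) \<longrightarrow> f V i j = 0}"
  morphisms entry Abs_fmat
  by (rule exI[of _ "\<lambda>_ _ _. 0"]) simp

setup_lifting type_definition_fmat

lemma fmat_eqI: "(\<And>V i j. finite V \<Longrightarrow> i \<in> V \<Longrightarrow> j \<in> V \<Longrightarrow> entry a V i j = entry b V i j) \<Longrightarrow> a = b"
proof (transfer, intro ext)
  fix f g :: "nat set \<Rightarrow> nat \<Rightarrow> nat \<Rightarrow> complex" and V :: "nat set" and i j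
  assume f: "\<forall>V i j. \<not> (finite V \<and> i \<in> V \<and> j \<in> V) \<longrightarrow> f V i j = 0"
    and g: "\<forall>V i j. \<not> (finite V \<and> i \<in> V \<and> j \<in> V) \<longrightarrow> g V i j = 0"
    and eq: "\<And>V i j. finite V \<Longrightarrow> i \<in> V \<Longrightarrow> j \<in> V \<Longrightarrow> f V i j = g V i j"
  show "f V i j = g V i j"
    using f[rule_format, of V i j] g[rule_format, of V i j] eq[of V i j] by metis
qed

instantiation fmat :: real_algebra_1
begin

lift_definition zero_fmat :: fmat is "\<lambda>_ _ _. 0" by simp
lift_definition one_fmat :: fmat is "\<lambda>V i j. if finite V \<and> i \<in> V \<and> i = j then 1 else 0" by auto
lift_definition plus_fmat :: "fmat \<Rightarrow> fmat \<Rightarrow> fmat" is "\<lambda>f g V i j. f V i j + g V i j" by simp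
lift_definition minus_fmat :: "fmat \<Rightarrow> fmat \<Rightarrow> fmat" is "\<lambda>f g V i j. f V i j - g V i j" by simp
lift_definition uminus_fmat :: "fmat \<Rightarrow> fmat" is "\<lambda>f V i j. - f V i j" by simp
lift_definition scaleR_fmat :: "real \<Rightarrow> fmat \<Rightarrow> fmat" is "\<lambda>c f V i j. c *\<^sub>R f V i j" by simp
lift_definition times_fmat :: "fmat \<Rightarrow> fmat \<Rightarrow> fmat" is "\<lambda>f g V i j. \<Sum>k\<in>V. f V i k * g V k j"
  by (auto intro!: sum.neutral)

instance
proof
  fix a b c :: fmat and r s :: real
  show "a + b + c = a + (b + c)" by transfer (simp add: add.assoc)
  show "a + b = b + a" by transfer (simp add: add.commute)
  show "0 + a = a" by transfer simp
  show "- a + a = 0" by transfer simp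
  show "a - b = a + - b" by transfer simp
  show "a * b * c = a * (b * c)"
    by (rule fmat_eqI, transfer)
      (simp add: sum_distrib_left sum_distrib_right mult.assoc, rule sum.swap)
  show "(a + b) * c = a * c + b * c" by transfer (simp add: distrib_right sum.distrib)
  show "a * (b + c) = a * b + a * c" by transfer (simp add: distrib_left sum.distrib)
  show "1 * a = a"
  proof (rule fmat_eqI, transfer)
    fix f :: "nat set \<Rightarrow> nat \<Rightarrow> nat \<Rightarrow> complex" and V :: "nat set" and i j
    assume *: "finite V" "i \<in> V" "j \<in> V"
    have "(\<Sum>k\<in>V. (if finite V \<and> i \<in> V \<and> i = k then 1 else 0) * f V k j)
        = (\<Sum>k\<in>V. if k = i then f V k j else 0)"
      using * by (intro sum.cong) auto
    then show "(\<Sum>k\<in>V. (if finite V \<and> i \<in> V \<and> i = k then 1 else 0) * f V k j) = f V i j"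
      using * by simp
  qed
  show "a * 1 = a"
  proof (rule fmat_eqI, transfer)
    fix f :: "nat set \<Rightarrow> nat \<Rightarrow> nat \<Rightarrow> complex" and V :: "nat set" and i j
    assume *: "finite V" "i \<in> V" "j \<in> V"
    have "(\<Sum>k\<in>V. f V i k * (if finite V \<and> k \<in> V \<and> k = j then 1 else 0))
        = (\<Sum>k\<in>V. if k = j then f V i k else 0)"
      using * by (intro sum.cong) auto
    then show "(\<Sum>k\<in>V. f V i k * (if finite V \<and> k \<in> V \<and> k = j then 1 else 0)) = f V i j"
      using * by simp
  qed
  show "(0::fmat) \<noteq> 1"
    by transfer (auto simp: fun_eq_iff intro!: exI[of _ "{0}"])
  show "r *\<^sub>R (a + b) = r *\<^sub>R a + r *\<^sub>R b" by transfer (simp add: scaleR_add_right)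
  show "(r + s) *\<^sub>R a = r *\<^sub>R a + s *\<^sub>R a" by transfer (simp add: scaleR_add_left)
  show "r *\<^sub>R s *\<^sub>R a = (r * s) *\<^sub>R a" by transfer simp
  show "1 *\<^sub>R a = a" by transfer simp
  show "r *\<^sub>R a * b = r *\<^sub>R (a * b)" by transfer (simp add: scaleR_sum_right)
  show "a * r *\<^sub>R b = r *\<^sub>R (a * b)" by transfer (simp add: scaleR_sum_right)
qed

end

lift_definition adj :: "fmat \<Rightarrow> fmat" is "\<lambda>f V i j. cnj (f V j i)" by (metis complex_cnj_zero)

text \<open>Taking the real part makes \<open>tr V (adj a * b)\<close> a real inner product; the
  arguments about powers below are Hilbert-Schmidt geometry.\<close>

definition tr :: "nat set \<Rightarrow> fmat \<Rightarrow> real" where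
  "tr V a = Re (\<Sum>i\<in>V. entry a V i i)"

lemma entry_simps [simp]:
  "entry (a + b) V i j = entry a V i j + entry b V i j" "entry (a - b) V i j = entry a V i j - entry b V i j"
  "entry (- a) V i j = - entry a V i j" "entry (r *\<^sub>R a) V i j = r *\<^sub>R entry a V i j"
  "entry 0 V i j = 0" "entry (adj a) V i j = cnj (entry a V j i)"
  by (simp_all add: plus_fmat.rep_eq minus_fmat.rep_eq uminus_fmat.rep_eq scaleR_fmat.rep_eq
      zero_fmat.rep_eq adj.rep_eq)

lemma entry_one: "entry 1 V i j = (if finite V \<and> i \<in> V \<and> i = j then 1 else 0)"
  by (simp add: one_fmat.rep_eq)

lemma entry_mult: "entry (a * b) V i j = (\<Sum>k\<in>V. entry a V i k * entry b V k j)"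
  by (simp add: times_fmat.rep_eq)

lemma adj_simps [simp]:
  "adj (adj a) = a" "adj (a + b) = adj a + adj b" "adj (a - b) = adj a - adj b"
  "adj (r *\<^sub>R a) = r *\<^sub>R adj a" "adj 0 = 0" "adj 1 = 1"
  by (rule fmat_eqI; simp add: entry_one)+

lemma adj_mult [simp]: "adj (a * b) = adj b * adj a"
  by (rule fmat_eqI) (simp add: entry_mult mult.commute)

lemma adj_sum [simp]: "adj (sum f I) = (\<Sum>i\<in>I. adj (f i))"
  by (induction I rule: infinite_finite_induct) auto

lemma adj_power [simp]: "adj (a ^ k) = adj a ^ k"
  by (induction k) (simp_all only: power_0 adj_simps power_Suc adj_mult power_Suc2[symmetric])

lemma tr_simps [simp]:
  "tr V (a + b) = tr V a + tr V b" "tr V (a - b) = tr V a - tr V b"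
  "tr V (- a) = - tr V a" "tr V (r *\<^sub>R a) = r * tr V a" "tr V 0 = 0"
  unfolding tr_def by (simp_all add: sum.distrib sum_subtractf sum_negf sum_distrib_left)

lemma tr_sum [simp]: "tr V (sum f I) = (\<Sum>i\<in>I. tr V (f i))"
  by (induction I rule: infinite_finite_induct) auto

lemma tr_adj [simp]: "tr V (adj a) = tr V a"
  unfolding tr_def by simp

lemma tr_commute: "tr V (a * b) = tr V (b * a)"
  unfolding tr_def entry_mult by (subst sum.swap) (simp only: mult.commute)

lemma tr_one: "finite V \<Longrightarrow> tr V 1 = real (card V)"
  unfolding tr_def by (simp add: entry_one)

lemma tr_adj_mult: "tr V (adj a * b) = Re (\<Sum>i\<in>V. \<Sum>k\<in>V. cnj (entry a V k i) * entry b V k i)"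
  unfolding tr_def by (simp add: entry_mult)

lemma tr_square: "tr V (adj a * a) = (\<Sum>i\<in>V. \<Sum>k\<in>V. (cmod (entry a V k i))\<^sup>2)"
  unfolding tr_adj_mult cmod_power2 by (simp add: power2_eq_square)

lemma tr_square_nonneg: "tr V (adj a * a) \<ge> 0"
  unfolding tr_square by (intro sum_nonneg) auto

lemma tr_amgm: "2 * tr V (adj a * b) \<le> tr V (adj a * a) + tr V (adj b * b)"
proof -
  have "tr V (adj b * a) = tr V (adj a * b)"
    using tr_adj[of V "adj a * b"] by simp
  then show ?thesis
    using tr_square_nonneg[of V "a - b"] by (simp add: algebra_simps)
qed

text \<open>Submultiplicativity of the Hilbert-Schmidt norm, by Cauchy-Schwarz in each entry of the
  product.\<close>

lemma tr_square_mult_le: "tr V (adj (a * b) * (a * b)) \<le> tr V (adj a * a) * tr V (adj b * b)"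
proof -
  have "(cmod (entry (a * b) V k i))\<^sup>2 \<le> (\<Sum>l\<in>V. (cmod (entry a V k l))\<^sup>2) * (\<Sum>l\<in>V. (cmod (entry b V l i))\<^sup>2)" for i k
  proof -
    have "entry (a * b) V k i = (\<Sum>l\<in>V. entry a V k l * entry b V l i)"
      by (rule entry_mult)
    then have "cmod (entry (a * b) V k i) \<le> (\<Sum>l\<in>V. cmod (entry a V k l) * cmod (entry b V l i))"
      by (simp add: norm_mult[symmetric] norm_sum)
    then have "(cmod (entry (a * b) V k i))\<^sup>2 \<le> (\<Sum>l\<in>V. cmod (entry a V k l) * cmod (entry b V l i))\<^sup>2"
      by (simp add: power_mono)
    also have "\<dots> \<le> (\<Sum>l\<in>V. (cmod (entry a V k l))\<^sup>2) * (\<Sum>l\<in>V. (cmod (entry b V l i))\<^sup>2)"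
      by (rule Cauchy_Schwarz_ineq_sum)
    finally show ?thesis .
  qed
  then have "tr V (adj (a * b) * (a * b)) \<le> (\<Sum>i\<in>V. \<Sum>k\<in>V. (\<Sum>l\<in>V. (cmod (entry a V k l))\<^sup>2) * (\<Sum>l\<in>V. (cmod (entry b V l i))\<^sup>2))"
    unfolding tr_square by (intro sum_mono)
  also have "\<dots> = (\<Sum>k\<in>V. \<Sum>l\<in>V. (cmod (entry a V k l))\<^sup>2) * (\<Sum>i\<in>V. \<Sum>l\<in>V. (cmod (entry b V l i))\<^sup>2)"
    by (subst sum_product) (rule sum.swap)
  also have "\<dots> = tr V (adj a * a) * tr V (adj b * b)"
    unfolding tr_square by (subst sum.swap) simp
  finally show ?thesis .
qed

section \<open>A matrix Chernoff bound\<close>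

text \<open>A discrete maximum principle. It stands in for spectral calculus: traces along a family
  of powers are midpoint convex in the exponent, so the two ends control everything between
  them.\<close>

lemma discrete_convex_le_max:
  fixes f :: "nat \<Rightarrow> real"
  assumes "\<And>a. 0 < a \<Longrightarrow> a < r \<Longrightarrow> 2 * f a \<le> f (a - 1) + f (a + 1)" and "a \<le> r"
  shows "f a \<le> max (f 0) (f r)"
proof -
  define m where "m = Max (f ` {..r})"
  have le: "f b \<le> m" if "b \<le> r" for b
    unfolding m_def using that by (intro Max_ge) auto
  have "m \<in> f ` {..r}"
    unfolding m_def by (intro Max_in) auto
  then have ex: "\<exists>b. b \<le> r \<and> f b = m" by auto
  \<comment> \<open>At the leftmost maximiser the left neighbour is strictly smaller, which
    contradicts midpoint convexity unless the maximiser is an end point.\<close>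
  define b where "b = (LEAST b. b \<le> r \<and> f b = m)"
  have b: "b \<le> r" "f b = m"
    using LeastI_ex[OF ex] by (auto simp: b_def)
  have "b = 0 \<or> b = r"
  proof (rule ccontr)
    assume "\<not> (b = 0 \<or> b = r)"
    with b have *: "0 < b" "b < r" by auto
    then have "f (b - 1) \<noteq> m"
      using not_less_Least[of "b - 1" "\<lambda>b. b \<le> r \<and> f b = m"] by (auto simp: b_def[symmetric])
    moreover have "f (b - 1) \<le> m" using le[of "b - 1"] * by simp
    ultimately have "f (b - 1) < m" by simp
    moreover have "f (b + 1) \<le> m" using le[of "b + 1"] * by auto
    ultimately show False using assms(1)[OF *] b by simp
  qed
  then show ?thesis using le[OF assms(2)] b by auto
qed

text \<open>Cyclicity turns mixed traces into inner products of the matrices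
  \<open>X ^ a * H * Y ^ b\<close>. Applied to these, \<open>tr_amgm\<close> gives convexity in the
  exponents although \<open>X\<close> and \<open>Y\<close> need not commute.\<close>

lemma tr_sandwich:
  assumes "adj H = H" "adj X = X" "adj Y = Y"
  shows "tr V (adj (X ^ a * H * Y ^ b) * (X ^ a' * H * Y ^ b')) = tr V (H * X ^ (a + a') * H * Y ^ (b' + b))"
proof -
  have "tr V (adj (X ^ a * H * Y ^ b) * (X ^ a' * H * Y ^ b')) = tr V (Y ^ b * (H * X ^ (a + a') * H * Y ^ b'))"
    by (simp add: assms power_add mult.assoc)
  also have "\<dots> = tr V (H * X ^ (a + a') * H * Y ^ (b' + b))"
    by (subst tr_commute) (simp add: power_add mult.assoc)
  finally show ?thesis .
qed

text \<open>The map \<open>i \<mapsto> tr (H X\<^sup>i H Y\<^bsup>2r-i\<^esup>)\<close> is midpoint convex on even \<open>i\<close>, and its odd values are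
  at most the mean of their neighbours.\<close>

lemma tr_mixed_powers_le:
  assumes h: "adj H = H" "adj X = X" "adj Y = Y" and i: "i \<le> 2 * r"
  shows "tr V (H * X ^ i * H * Y ^ (2 * r - i)) \<le> tr V (H * H * X ^ (2 * r)) + tr V (H * H * Y ^ (2 * r))"
proof -
  define g where "g i l = tr V (H * X ^ i * H * Y ^ l)" for i l
  have am: "2 * g (a + a') (b' + b) \<le> g (a + a) (b + b) + g (a' + a') (b' + b')" for a a' b b'
    using tr_amgm[of V "X ^ a * H * Y ^ b" "X ^ a' * H * Y ^ b'"]
    unfolding tr_sandwich[OF h] g_def .
  have nn: "0 \<le> g (a + a) (b + b)" for a b
    using tr_square_nonneg[of V "X ^ a * H * Y ^ b"] unfolding tr_sandwich[OF h] g_def .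
  have ends: "g (2 * r) 0 = tr V (H * H * X ^ (2 * r))" "g 0 (2 * r) = tr V (H * H * Y ^ (2 * r))"
    unfolding g_def using tr_commute[of V "H * X ^ (2 * r)" H] by (simp_all add: mult.assoc)
  have even: "g (2 * a) (2 * (r - a)) \<le> max (g 0 (2 * r)) (g (2 * r) 0)" if "a \<le> r" for a
  proof -
    have "g (2 * a) (2 * (r - a)) \<le> max (g (2 * 0) (2 * (r - 0))) (g (2 * r) (2 * (r - r)))"
    proof (rule discrete_convex_le_max[of r "\<lambda>a. g (2 * a) (2 * (r - a))", OF _ that])
      fix a assume a: "0 < a" "a < r"
      obtain c where c: "a = c + 1" using a(1) by (cases a) auto
      obtain d where d: "r = a + d + 1" using a(2) by (auto simp: less_iff_Suc_add)
      have "2 * a = c + (c + 2)" "2 * (r - a) = d + (d + 2)" "2 * (a - 1) = c + c"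
        "2 * (r - (a - 1)) = (d + 2) + (d + 2)" "2 * (a + 1) = (c + 2) + (c + 2)" "2 * (r - (a + 1)) = d + d"
        using c d by auto
      then show "2 * g (2 * a) (2 * (r - a)) \<le> g (2 * (a - 1)) (2 * (r - (a - 1))) + g (2 * (a + 1)) (2 * (r - (a + 1)))"
        using am[of c "c + 2" d "d + 2"] by (simp only:)
    qed
    then show ?thesis by simp
  qed
  have nn': "0 \<le> g 0 (2 * r)" "0 \<le> g (2 * r) 0"
    using nn[of 0 r] nn[of r 0] by (simp_all add: mult_2)
  have "g i (2 * r - i) \<le> g 0 (2 * r) + g (2 * r) 0"
  proof (cases "even i")
    case True
    then obtain a where "i = 2 * a" by (elim evenE)
    then show ?thesis using even[of a] i nn' by (simp add: diff_mult_distrib2)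
  next
    case False
    then obtain a where a: "i = 2 * a + 1" by (elim oddE)
    with i have "a < r" by simp
    then obtain b where b: "r = a + b + 1" by (auto simp: less_iff_Suc_add)
    have "i = a + (a + 1)" "2 * r - i = b + (b + 1)" "2 * a = a + a" "2 * (r - a) = (b + 1) + (b + 1)"
      "2 * (a + 1) = (a + 1) + (a + 1)" "2 * (r - (a + 1)) = b + b"
      using a b by auto
    then have "2 * g i (2 * r - i) \<le> g (2 * a) (2 * (r - a)) + g (2 * (a + 1)) (2 * (r - (a + 1)))"
      using am[of a "a + 1" b "b + 1"] by (simp only:)
    then show ?thesis using even[of a] even[of "a + 1"] nn' b by simp
  qed
  then show ?thesis unfolding ends[symmetric] by (simp add: g_def)
qed

lemma power_Suc_diff_telescope:
  fixes X Y :: "'a :: ring_1"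
  shows "X ^ Suc n - Y ^ Suc n = (\<Sum>i\<le>n. X ^ i * (X - Y) * Y ^ (n - i))"
proof (induction n)
  case (Suc n)
  have "X ^ Suc (Suc n) - Y ^ Suc (Suc n) = (X ^ Suc n - Y ^ Suc n) * Y + X ^ Suc n * (X - Y)"
    by (simp add: algebra_simps power_commutes)
  also have "(X ^ Suc n - Y ^ Suc n) * Y = (\<Sum>i\<le>n. X ^ i * (X - Y) * Y ^ (Suc n - i))"
    unfolding Suc sum_distrib_right
    by (intro sum.cong) (auto simp: Suc_diff_le mult.assoc power_commutes)
  finally show ?case by simp
qed simp

text \<open>A trace form of the mean value inequality for the odd power 2r+1: telescoping produces
  2r+1 mixed moments, and each is dominated by the two pure ones.\<close>

lemma tr_odd_power_diff_le:
  assumes "adj X = X" "adj Y = Y"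
  shows "tr V ((X - Y) * (X ^ Suc (2 * r) - Y ^ Suc (2 * r)))
    \<le> real (2 * r + 1) * (tr V ((X - Y) * (X - Y) * X ^ (2 * r)) + tr V ((X - Y) * (X - Y) * Y ^ (2 * r)))"
proof -
  have "tr V ((X - Y) * (X ^ Suc (2 * r) - Y ^ Suc (2 * r)))
      = (\<Sum>i\<le>2 * r. tr V ((X - Y) * X ^ i * (X - Y) * Y ^ (2 * r - i)))"
    unfolding power_Suc_diff_telescope sum_distrib_left tr_sum by (simp only: mult.assoc)
  also have "\<dots> \<le> (\<Sum>i\<le>2 * r. tr V ((X - Y) * (X - Y) * X ^ (2 * r)) + tr V ((X - Y) * (X - Y) * Y ^ (2 * r)))"
    using assms by (intro sum_mono tr_mixed_powers_le) auto
  finally show ?thesis by simp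
qed

section \<open>Operator inequalities tested by traces\<close>

definition psd :: "nat set \<Rightarrow> fmat \<Rightarrow> bool" where
  "psd V S \<longleftrightarrow> adj S = S \<and> (\<forall>Y. 0 \<le> tr V (adj Y * S * Y))"

text \<open>This is S <= c in the order of quadratic forms. The columns of the test matrix
  \<open>Y\<close> are the test vectors, which keeps the notion inside the ring of matrices.\<close>

definition form_le :: "nat set \<Rightarrow> fmat \<Rightarrow> real \<Rightarrow> bool" where
  "form_le V S c \<longleftrightarrow> (\<forall>Y. tr V (adj Y * S * Y) \<le> c * tr V (adj Y * Y))"

text \<open>For 0 <= W <= R this is W^2 <= R W, obtained without a square root of W: (W - R) W (W -
  R) is nonnegative and W^3 <= R W^2, hence 0 <= R (R W - W^2).\<close>

lemma psd_square_le:
  assumes W: "psd V W" "form_le V W R" and R: "R > 0"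
  shows "tr V (adj Y * (W * W) * Y) \<le> R * tr V (adj Y * W * Y)"
proof -
  have sym: "tr V (adj Y * (W * (W * Y))) = tr V (adj (W * Y) * (W * Y))"
    using W(1) by (simp add: psd_def mult.assoc)
  have "0 \<le> tr V (adj Z * W * Z)" for Z
    using W(1) unfolding psd_def by blast
  then have "0 \<le> tr V (adj (W * Y - R *\<^sub>R Y) * W * (W * Y - R *\<^sub>R Y))" .
  also have "\<dots> = tr V (adj (W * Y) * W * (W * Y)) - 2 * R * tr V (adj (W * Y) * (W * Y)) + R * R * tr V (adj Y * W * Y)"
    using W(1) by (simp add: psd_def algebra_simps)
  also have "\<dots> \<le> R * tr V (adj (W * Y) * (W * Y)) - 2 * R * tr V (adj (W * Y) * (W * Y)) + R * R * tr V (adj Y * W * Y)"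
    using W(2)[unfolded form_le_def, rule_format, of "W * Y"] by simp
  finally have "0 \<le> R * (R * tr V (adj Y * W * Y) - tr V (adj (W * Y) * (W * Y)))"
    by (simp add: algebra_simps)
  then have "tr V (adj (W * Y) * (W * Y)) \<le> R * tr V (adj Y * W * Y)"
    using R by (simp add: zero_le_mult_iff)
  then show ?thesis using sym by (simp add: mult.assoc)
qed

text \<open>A trace of a high even power bounds the norm. With S i the squared norm of X^i Y, the
  quotients S i / K^(2i) are midpoint convex, and the p-th is at most the 0-th by
  submultiplicativity. So the first is too, and the arithmetic-geometric mean of K Y and X Y
  finishes.\<close>

lemma form_le_of_tr_power:
  assumes X: "adj X = X" and p: "p > 0" and K: "K > 0" and le: "tr V (X ^ (2 * p)) \<le> K ^ (2 * p)"
  shows "form_le V X K"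
  unfolding form_le_def
proof
  fix Y
  define S where "S i = tr V (adj (X ^ i * Y) * (X ^ i * Y))" for i
  have convex: "2 * (S a / K ^ (2 * a)) \<le> S (a - 1) / K ^ (2 * (a - 1)) + S (a + 1) / K ^ (2 * (a + 1))" if pos: "0 < a" for a
  proof -
    obtain c where c: "a = Suc c" using pos by (cases a) auto
    have "c + Suc (Suc c) = Suc c + Suc c" by simp
    then have "tr V (adj (X ^ c * Y) * (X ^ Suc (Suc c) * Y)) = S (Suc c)"
      unfolding S_def adj_mult adj_power X by (metis mult.assoc power_add)
    then have "2 * S (Suc c) \<le> K\<^sup>2 * S c + S (Suc (Suc c)) / K\<^sup>2"
      using tr_amgm[of V "K *\<^sub>R (X ^ c * Y)" "(1 / K) *\<^sub>R (X ^ Suc (Suc c) * Y)"] K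
      unfolding S_def by (simp add: power2_eq_square del: power_Suc)
    then have "2 * S (Suc c) / K ^ (2 * Suc c) \<le> (K\<^sup>2 * S c + S (Suc (Suc c)) / K\<^sup>2) / K ^ (2 * Suc c)"
      using K by (intro divide_right_mono) auto
    also have "\<dots> = S c / K ^ (2 * c) + S (Suc (Suc c)) / K ^ (2 * Suc (Suc c))"
      using K by (simp add: add_divide_distrib power2_eq_square mult_ac)
    finally show ?thesis by (simp add: c)
  qed
  have "S p \<le> tr V (adj (X ^ p) * X ^ p) * S 0"
    unfolding S_def power_0 mult_1_left by (rule tr_square_mult_le)
  also have "tr V (adj (X ^ p) * X ^ p) = tr V (X ^ (2 * p))" by (simp add: X power_add mult_2)
  also have "\<dots> * S 0 \<le> K ^ (2 * p) * S 0"
    unfolding S_def by (intro mult_right_mono le tr_square_nonneg)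
  finally have "S p / K ^ (2 * p) \<le> S 0" using K by (simp add: field_simps)
  then have "S 1 / K\<^sup>2 \<le> S 0"
    using discrete_convex_le_max[of p "\<lambda>i. S i / K ^ (2 * i)" 1] convex p by simp
  then have S1: "S 1 \<le> K\<^sup>2 * S 0" using K by (simp add: field_simps)
  have "2 * tr V (adj (K *\<^sub>R Y) * (X * Y)) \<le> tr V (adj (K *\<^sub>R Y) * (K *\<^sub>R Y)) + tr V (adj (X * Y) * (X * Y))"
    by (rule tr_amgm)
  then have "2 * K * tr V (adj Y * (X * Y)) \<le> K * K * S 0 + S 1"
    by (simp add: S_def)
  also have "\<dots> \<le> 2 * K * (K * S 0)" using S1 by (simp add: power2_eq_square)
  finally have "tr V (adj Y * (X * Y)) \<le> K * S 0" using K by simp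
  then show "tr V (adj Y * X * Y) \<le> K * tr V (adj Y * Y)"
    by (simp add: S_def mult.assoc)
qed

text \<open>Exchangeability of a sample and its resampling at q: exchanging the old value at q with
  the fresh value a is an involution on the pairs (\<open>\<sigma>\<close>, a).\<close>

lemma sum_PiE_resample:
  assumes q: "q \<in> Q"
  shows "(\<Sum>\<sigma>\<in>Q \<rightarrow>\<^sub>E S. \<Sum>a\<in>S. f \<sigma> (\<sigma>(q := a))) = (\<Sum>\<sigma>\<in>Q \<rightarrow>\<^sub>E S. \<Sum>a\<in>S. f (\<sigma>(q := a)) \<sigma>)"
  unfolding sum.cartesian_product using q
  by (intro sum.reindex_bij_witness[of _ "\<lambda>(\<sigma>, a). (\<sigma>(q := a), \<sigma> q)" "\<lambda>(\<sigma>, a). (\<sigma>(q := a), \<sigma> q)"])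
    (auto simp: PiE_iff extensional_def)


text \<open>A sum of independent positive matrices, with probabilities expressed as counts in
  \<open>Q \<rightarrow>\<^sub>E S\<close>. \<open>R\<close> bounds one summand and \<open>m\<close>
  the expectation of the sum.\<close>

locale random_psd_sum =
  fixes V :: "nat set" and Q :: "'q set" and S :: "'a set" and W :: "'q \<Rightarrow> 'a \<Rightarrow> fmat"
    and R m :: real
  assumes V: "finite V" and Q: "finite Q" and S: "finite S" "S \<noteq> {}"
    and W_psd: "\<And>q a. q \<in> Q \<Longrightarrow> a \<in> S \<Longrightarrow> psd V (W q a)"
    and W_le: "\<And>q a. q \<in> Q \<Longrightarrow> a \<in> S \<Longrightarrow> form_le V (W q a) R"
    and mean_le: "form_le V (\<Sum>q\<in>Q. (1 / real (card S)) *\<^sub>R (\<Sum>a\<in>S. W q a)) m"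
    and R: "R > 0" and m: "m \<ge> 0"
begin

definition mean where "mean q = (1 / real (card S)) *\<^sub>R (\<Sum>a\<in>S. W q a)"

definition dev where "dev \<sigma> = (\<Sum>q\<in>Q. W q (\<sigma> q) - mean q)"

abbreviation samples where "samples \<equiv> Q \<rightarrow>\<^sub>E S"

lemma card_S: "real (card S) > 0"
  using S by (simp add: card_gt_0_iff)

lemma adj_W: "q \<in> Q \<Longrightarrow> a \<in> S \<Longrightarrow> adj (W q a) = W q a"
  using W_psd unfolding psd_def by blast

lemma adj_mean: "q \<in> Q \<Longrightarrow> adj (mean q) = mean q"
  by (simp add: mean_def adj_W)

lemma adj_dev: "\<sigma> \<in> samples \<Longrightarrow> adj (dev \<sigma>) = dev \<sigma>"
  by (auto simp: dev_def adj_mean adj_W PiE_iff intro!: sum.cong)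

lemma sum_W_minus_mean: "(\<Sum>a\<in>S. W q a - mean q) = 0"
proof -
  have "(\<Sum>a\<in>S. mean q) = real (card S) *\<^sub>R mean q"
    by (rule sum_constant_scaleR)
  then show ?thesis using card_S by (simp add: sum_subtractf mean_def)
qed

lemma dev_upd:
  assumes "q \<in> Q"
  shows "dev \<sigma> - dev (\<sigma>(q := a)) = W q (\<sigma> q) - W q a"
proof -
  have "dev \<sigma> - dev (\<sigma>(q := a)) = (\<Sum>p\<in>Q. if p = q then W q (\<sigma> q) - W q a else 0)"
    unfolding dev_def sum_subtractf[symmetric] by (intro sum.cong) auto
  then show ?thesis using assms Q by simp
qed

text \<open>The inequality (a - b)^2 <= 2 a^2 + 2 b^2 followed by W^2 <= R W makes the variance term
  linear in the summands, so that it can be compared with the sum itself.\<close>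

lemma tr_diff_square_le:
  assumes "q \<in> Q" "a \<in> S" "b \<in> S" "adj X = X"
  shows "tr V ((W q a - W q b) * (W q a - W q b) * X ^ (2 * r))
    \<le> 2 * R * (tr V (W q a * X ^ (2 * r)) + tr V (W q b * X ^ (2 * r)))"
proof -
  have cyc: "tr V (Z * X ^ (2 * r)) = tr V (adj (X ^ r) * Z * X ^ r)" for Z
    using tr_commute[of V "Z * X ^ r" "X ^ r"] assms(4) by (simp add: power_add mult_2 mult.assoc)
  have "0 \<le> tr V (adj ((W q a + W q b) * X ^ r) * ((W q a + W q b) * X ^ r))"
    by (rule tr_square_nonneg)
  then have "tr V (adj (X ^ r) * ((W q a - W q b) * (W q a - W q b)) * X ^ r)
      \<le> 2 * (tr V (adj (X ^ r) * (W q a * W q a) * X ^ r) + tr V (adj (X ^ r) * (W q b * W q b) * X ^ r))"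
    using assms by (simp add: adj_W algebra_simps)
  also have "\<dots> \<le> 2 * (R * tr V (adj (X ^ r) * W q a * X ^ r) + R * tr V (adj (X ^ r) * W q b * X ^ r))"
    using assms by (intro mult_left_mono add_mono psd_square_le W_psd W_le R) auto
  finally show ?thesis unfolding cyc by (simp add: algebra_simps)
qed

text \<open>Exchangeable pairs: resampling one coordinate turns \<open>tr ((W q - mean q) X\<^sup>k)\<close> into
  \<open>1/2 tr ((X - X') (X\<^sup>k - X'\<^sup>k))\<close>, where \<open>X'\<close> is the resampled sum.\<close>

lemma resampled_moment_le:
  assumes q: "q \<in> Q"
  shows "(\<Sum>\<sigma>\<in>samples. tr V ((W q (\<sigma> q) - mean q) * dev \<sigma> ^ Suc (2 * r)))
    \<le> 2 * R * real (2 * r + 1) * (\<Sum>\<sigma>\<in>samples. tr V (W q (\<sigma> q) * dev \<sigma> ^ (2 * r)) + tr V (mean q * dev \<sigma> ^ (2 * r)))"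
    (is "?L \<le> _ * ?M")
proof -
  let ?N = "real (card S)"
  let ?X = "\<lambda>\<sigma>. dev \<sigma> ^ Suc (2 * r)" and ?P = "\<lambda>\<sigma>. dev \<sigma> ^ (2 * r)"
  define D where "D \<sigma> \<tau> = dev \<sigma> - dev \<tau>" for \<sigma> \<tau>
  let ?T0 = "\<Sum>\<sigma>\<in>samples. \<Sum>a\<in>S. tr V (D \<sigma> (\<sigma>(q := a)) * ?X \<sigma>)"
  let ?T1 = "\<Sum>\<sigma>\<in>samples. \<Sum>a\<in>S. tr V (D \<sigma> (\<sigma>(q := a)) * D \<sigma> (\<sigma>(q := a)) * ?P \<sigma>)"
  let ?T2 = "\<Sum>\<sigma>\<in>samples. \<Sum>a\<in>S. tr V (D \<sigma> (\<sigma>(q := a)) * D \<sigma> (\<sigma>(q := a)) * ?P (\<sigma>(q := a)))"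
  have D: "D \<sigma> (\<sigma>(q := a)) = W q (\<sigma> q) - W q a" for \<sigma> a
    unfolding D_def by (rule dev_upd[OF q])
  have half: "2 * x \<le> c * (t + t) \<Longrightarrow> x \<le> c * t" for x c t :: real
    by (simp add: algebra_simps)
  have upd: "\<sigma>(q := a) \<in> samples" if "\<sigma> \<in> samples" "a \<in> S" for \<sigma> a
    using that q by (auto simp: PiE_iff extensional_def)
  \<comment> \<open>Summing over the fresh value a replaces \<open>W q a\<close> by its mean, since
    the deviations add up to zero.\<close>
  have "?N * ?L = ?T0"
  proof -
    have split: "(\<Sum>a\<in>S. c - tr V (d a * X)) = ?N * c - tr V ((\<Sum>a\<in>S. d a) * X)" for c d X
      by (simp add: sum_subtractf sum_distrib_right)
    have "(\<Sum>a\<in>S. tr V (D \<sigma> (\<sigma>(q := a)) * ?X \<sigma>)) = ?N * tr V ((W q (\<sigma> q) - mean q) * ?X \<sigma>)" for \<sigma>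
    proof -
      have "(\<Sum>a\<in>S. tr V (D \<sigma> (\<sigma>(q := a)) * ?X \<sigma>))
          = (\<Sum>a\<in>S. tr V ((W q (\<sigma> q) - mean q) * ?X \<sigma>) - tr V ((W q a - mean q) * ?X \<sigma>))"
        unfolding D by (intro sum.cong) (simp_all add: left_diff_distrib)
      also have "\<dots> = ?N * tr V ((W q (\<sigma> q) - mean q) * ?X \<sigma>) - tr V ((\<Sum>a\<in>S. W q a - mean q) * ?X \<sigma>)"
        by (rule split)
      finally show ?thesis unfolding sum_W_minus_mean by simp
    qed
    then show ?thesis by (simp add: sum_distrib_left del: power_Suc)
  qed
  \<comment> \<open>The second sum is \<open>?T0\<close> with the sample and its resampling
    exchanged. \<open>D\<close> changes sign under the exchange, so the two copies combine into a
    difference of odd powers.\<close>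
  then have "2 * (?N * ?L) = ?T0
      + (\<Sum>\<sigma>\<in>samples. \<Sum>a\<in>S. tr V (D (\<sigma>(q := a)) \<sigma> * ?X (\<sigma>(q := a))))"
    using sum_PiE_resample[OF q, of "\<lambda>\<sigma> \<tau>. tr V (D \<sigma> \<tau> * ?X \<sigma>)" S] by simp
  also have "\<dots> = (\<Sum>\<sigma>\<in>samples. \<Sum>a\<in>S. tr V (D \<sigma> (\<sigma>(q := a)) * (?X \<sigma> - ?X (\<sigma>(q := a)))))"
    unfolding sum.distrib[symmetric]
    by (intro sum.cong refl) (simp add: D_def left_diff_distrib right_diff_distrib del: power_Suc)
  also have "\<dots> \<le> (\<Sum>\<sigma>\<in>samples. \<Sum>a\<in>S. real (2 * r + 1) *
      (tr V (D \<sigma> (\<sigma>(q := a)) * D \<sigma> (\<sigma>(q := a)) * ?P \<sigma>) + tr V (D \<sigma> (\<sigma>(q := a)) * D \<sigma> (\<sigma>(q := a)) * ?P (\<sigma>(q := a)))))"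
    unfolding D_def by (intro sum_mono tr_odd_power_diff_le adj_dev upd)
  also have "\<dots> = real (2 * r + 1) * (?T1
      + ?T2)"
    by (simp only: sum.distrib sum_distrib_left distrib_left)
  also have "?T2
      = ?T1"
  proof -
    have "D \<tau> \<sigma> * D \<tau> \<sigma> = D \<sigma> \<tau> * D \<sigma> \<tau>" for \<sigma> \<tau>
      unfolding D_def by (simp add: algebra_simps)
    then show ?thesis
      using sum_PiE_resample[OF q, of "\<lambda>\<sigma> \<tau>. tr V (D \<sigma> \<tau> * D \<sigma> \<tau> * ?P \<tau>)" S] by simp
  qed
  finally have "?N * ?L \<le> real (2 * r + 1) * ?T1"
    by (rule half)
  also have "\<dots> \<le> real (2 * r + 1) * (\<Sum>\<sigma>\<in>samples. \<Sum>a\<in>S. 2 * R * (tr V (W q (\<sigma> q) * ?P \<sigma>) + tr V (W q a * ?P \<sigma>)))"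
    unfolding D using q by (intro mult_left_mono sum_mono tr_diff_square_le adj_dev) auto
  also have "(\<Sum>\<sigma>\<in>samples. \<Sum>a\<in>S. 2 * R * (tr V (W q (\<sigma> q) * ?P \<sigma>) + tr V (W q a * ?P \<sigma>))) = 2 * R * ?N * ?M"
  proof -
    have "(\<Sum>a\<in>S. tr V (W q a * ?P \<sigma>)) = ?N * tr V (mean q * ?P \<sigma>)" for \<sigma>
      using card_S by (simp add: mean_def tr_sum[symmetric] sum_distrib_right del: tr_sum)
    then have "(\<Sum>a\<in>S. 2 * R * (tr V (W q (\<sigma> q) * ?P \<sigma>) + tr V (W q a * ?P \<sigma>)))
        = 2 * R * ?N * (tr V (W q (\<sigma> q) * ?P \<sigma>) + tr V (mean q * ?P \<sigma>))" for \<sigma>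
      by (simp add: sum_distrib_left[symmetric] sum.distrib distrib_left)
    then show ?thesis by (simp add: sum_distrib_left)
  qed
  finally have "?N * ?L \<le> ?N * (2 * R * real (2 * r + 1) * ?M)"
    by (simp only: ac_simps)
  then show ?thesis using card_S by simp
qed

text \<open>One factor \<open>dev\<close> is expanded into its summands, and each is resampled. The
  random summands recombine to \<open>dev\<close> plus the mean, which produces a moment of order
  2r+1. The arithmetic-geometric mean splits it between the orders 2r and 2r+2, and the higher part
  is absorbed on the left.\<close>

lemma moment_Suc_le:
  shows "(\<Sum>\<sigma>\<in>samples. tr V (dev \<sigma> ^ (2 * Suc r)))
    \<le> (4 * R * real (Suc r) + 2 * m)\<^sup>2 * (\<Sum>\<sigma>\<in>samples. tr V (dev \<sigma> ^ (2 * r)))"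
    (is "?B \<le> _ * ?A")
proof -
  define K where "K = 2 * R * real (2 * r + 1)"
  have K: "K > 0" using R by (simp add: K_def)
  have A0: "tr V (dev \<sigma> ^ (2 * r)) \<ge> 0" if "\<sigma> \<in> samples" for \<sigma>
    using tr_square_nonneg[of V "dev \<sigma> ^ r"] adj_dev[OF that] by (simp add: mult_2 power_add)
  have "?B = (\<Sum>q\<in>Q. \<Sum>\<sigma>\<in>samples. tr V ((W q (\<sigma> q) - mean q) * dev \<sigma> ^ Suc (2 * r)))"
  proof -
    have "dev \<sigma> ^ (2 * Suc r) = (\<Sum>q\<in>Q. (W q (\<sigma> q) - mean q) * dev \<sigma> ^ Suc (2 * r))" for \<sigma>
    proof -
      have "dev \<sigma> ^ (2 * Suc r) = dev \<sigma> * dev \<sigma> ^ Suc (2 * r)" by simp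
      also have "\<dots> = (\<Sum>q\<in>Q. (W q (\<sigma> q) - mean q) * dev \<sigma> ^ Suc (2 * r))"
        by (subst (1) dev_def) (simp only: sum_distrib_right)
      finally show ?thesis .
    qed
    then show ?thesis by (simp only: tr_sum) (rule sum.swap)
  qed
  also have "\<dots> \<le> (\<Sum>q\<in>Q. K * (\<Sum>\<sigma>\<in>samples. tr V (W q (\<sigma> q) * dev \<sigma> ^ (2 * r)) + tr V (mean q * dev \<sigma> ^ (2 * r))))"
    unfolding K_def by (intro sum_mono resampled_moment_le)
  also have "\<dots> = K * (\<Sum>\<sigma>\<in>samples. tr V ((\<Sum>q\<in>Q. W q (\<sigma> q)) * dev \<sigma> ^ (2 * r)) + tr V ((\<Sum>q\<in>Q. mean q) * dev \<sigma> ^ (2 * r)))"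
    unfolding sum_distrib_left[symmetric] sum_distrib_right tr_sum sum.distrib[symmetric]
    by (subst sum.swap) simp
  \<comment> \<open>The weight 1 / (2K) is chosen so that the prefactor K leaves exactly half of
    \<open>?B\<close> on the right.\<close>
  also have "\<dots> \<le> K * (\<Sum>\<sigma>\<in>samples. (1 / (2 * K)) * tr V (dev \<sigma> ^ (2 * Suc r)) + (K / 2 + 2 * m) * tr V (dev \<sigma> ^ (2 * r)))"
  proof (intro mult_left_mono sum_mono)
    fix \<sigma> assume \<sigma>: "\<sigma> \<in> samples"
    note ad = adj_dev[OF \<sigma>]
    define X where "X = dev \<sigma>"
    have X: "adj X = X" using ad by (simp add: X_def)
    have W: "(\<Sum>q\<in>Q. W q (\<sigma> q)) = X + (\<Sum>q\<in>Q. mean q)"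
      by (simp add: X_def dev_def sum_subtractf)
    have "2 * tr V (adj (X ^ r) * ((1 / K) *\<^sub>R X ^ Suc r))
        \<le> tr V (adj (X ^ r) * X ^ r) + tr V (adj ((1 / K) *\<^sub>R X ^ Suc r) * ((1 / K) *\<^sub>R X ^ Suc r))"
      by (rule tr_amgm)
    moreover have "X ^ r * X ^ Suc r = X * X ^ (2 * r)" "X ^ r * X ^ r = X ^ (2 * r)"
        "X ^ Suc r * X ^ Suc r = X ^ (2 * Suc r)"
      by (simp_all only: power_add[symmetric] power_Suc[symmetric] mult_2 add_Suc_right add_Suc)
    ultimately have "2 * (1 / K) * tr V (X * X ^ (2 * r)) \<le> tr V (X ^ (2 * r)) + (1 / K)\<^sup>2 * tr V (X ^ (2 * Suc r))"
      by (simp add: X power2_eq_square del: power_Suc mult_Suc_right)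
    moreover have "t \<le> K / 2 * a + 1 / (2 * K) * b" if "2 * (1 / K) * t \<le> a + (1 / K)\<^sup>2 * b" for t a b :: real
    proof -
      have "K / 2 * (2 * (1 / K) * t) \<le> K / 2 * (a + (1 / K)\<^sup>2 * b)"
        using that K by (intro mult_left_mono) auto
      also have "\<dots> = K / 2 * a + 1 / (2 * K) * b"
        using K by (simp add: field_simps power2_eq_square)
      finally show ?thesis using K by simp
    qed
    ultimately have 1: "tr V (X * X ^ (2 * r)) \<le> K / 2 * tr V (X ^ (2 * r)) + 1 / (2 * K) * tr V (X ^ (2 * Suc r))"
      by blast
    have "tr V ((\<Sum>q\<in>Q. mean q) * X ^ (2 * r)) = tr V (adj (X ^ r) * (\<Sum>q\<in>Q. mean q) * X ^ r)"
      using tr_commute[of V "(\<Sum>q\<in>Q. mean q) * X ^ r" "X ^ r"] by (simp add: X power_add mult_2 mult.assoc)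
    also have "\<dots> \<le> m * tr V (adj (X ^ r) * X ^ r)"
      using mean_le[folded mean_def] unfolding form_le_def by blast
    finally have 2: "tr V ((\<Sum>q\<in>Q. mean q) * X ^ (2 * r)) \<le> m * tr V (X ^ (2 * r))"
      by (simp add: X power_add mult_2)
    show "tr V ((\<Sum>q\<in>Q. W q (\<sigma> q)) * dev \<sigma> ^ (2 * r)) + tr V ((\<Sum>q\<in>Q. mean q) * dev \<sigma> ^ (2 * r))
      \<le> (1 / (2 * K)) * tr V (dev \<sigma> ^ (2 * Suc r)) + (K / 2 + 2 * m) * tr V (dev \<sigma> ^ (2 * r))"
      using 1 2 unfolding W X_def[symmetric] by (simp add: distrib_right del: power_Suc mult_Suc_right)
  qed (use K in simp)
  also have "\<dots> = ?B / 2 + (K\<^sup>2 / 2 + 2 * K * m) * ?A"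
    unfolding sum.distrib sum_distrib_left[symmetric]
    using K by (simp add: field_simps power2_eq_square del: power_Suc mult_Suc_right)
  finally have "?B \<le> (K\<^sup>2 + 4 * K * m) * ?A" by (simp add: algebra_simps)
  also have "\<dots> \<le> (4 * R * real (Suc r) + 2 * m)\<^sup>2 * ?A"
  proof (rule mult_right_mono)
    have "K\<^sup>2 + 4 * K * m \<le> (K + 2 * m)\<^sup>2" by (simp add: power2_sum)
    also have "\<dots> \<le> (4 * R * real (Suc r) + 2 * m)\<^sup>2"
      using R m K by (intro power_mono) (auto simp: K_def algebra_simps)
    finally show "K\<^sup>2 + 4 * K * m \<le> (4 * R * real (Suc r) + 2 * m)\<^sup>2" .
  qed (intro sum_nonneg A0)
  finally show ?thesis .
qed

lemma moment_le:
  assumes "r \<le> p"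
  shows "(\<Sum>\<sigma>\<in>samples. tr V (dev \<sigma> ^ (2 * r)))
    \<le> real (card samples) * real (card V) * (4 * R * real p + 2 * m) ^ (2 * r)"
  using assms
proof (induction r)
  case 0
  then show ?case by (simp add: tr_one V)
next
  case (Suc r)
  let ?b = "4 * R * real p + 2 * m"
  have "(\<Sum>\<sigma>\<in>samples. tr V (dev \<sigma> ^ (2 * Suc r)))
      \<le> (4 * R * real (Suc r) + 2 * m)\<^sup>2 * (\<Sum>\<sigma>\<in>samples. tr V (dev \<sigma> ^ (2 * r)))"
    by (rule moment_Suc_le)
  also have "\<dots> \<le> (4 * R * real (Suc r) + 2 * m)\<^sup>2 * (real (card samples) * real (card V) * ?b ^ (2 * r))"
    using Suc by (intro mult_left_mono) auto
  also have "\<dots> \<le> ?b\<^sup>2 * (real (card samples) * real (card V) * ?b ^ (2 * r))"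
    using R m Suc.prems by (intro mult_right_mono power_mono add_mono mult_left_mono mult_nonneg_nonneg zero_le_power) auto
  also have "\<dots> = real (card samples) * real (card V) * ?b ^ (2 * Suc r)"
    by (simp add: power2_eq_square)
  finally show ?case .
qed

text \<open>Markov's inequality for the moment of order 2p at the threshold e b, b = 4 R p + 2 m,
  gains exp (-2p); the trace of the identity contributes the dimension. Since e <= 3, the deviation
  is at most 3 b, and adding the mean gives 3 b + m = 12 R p + 7 m.\<close>

theorem card_not_form_le:
  assumes p: "p > 0"
  shows "real (card {\<sigma> \<in> samples. \<not> form_le V (\<Sum>q\<in>Q. W q (\<sigma> q)) (12 * R * real p + 7 * m)})
    \<le> real (card samples) * real (card V) * exp (- 2 * real p)"
    (is "real (card ?bad) \<le> _")
proof -
  define b where "b = 4 * R * real p + 2 * m"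
  define bad where "bad = {\<sigma> \<in> samples. tr V (dev \<sigma> ^ (2 * p)) > (exp 1 * b) ^ (2 * p)}"
  have b: "b > 0" using R m p by (simp add: b_def add_pos_nonneg)
  have fin: "finite samples" using Q S by (intro finite_PiE) auto
  have A0: "tr V (dev \<sigma> ^ (2 * p)) \<ge> 0" if "\<sigma> \<in> samples" for \<sigma>
    using tr_square_nonneg[of V "dev \<sigma> ^ p"] adj_dev[OF that] by (simp add: mult_2 power_add)
  have "?bad \<subseteq> bad"
  proof (rule subsetI, rule ccontr)
    fix \<sigma> assume *: "\<sigma> \<in> ?bad" "\<sigma> \<notin> bad"
    then have \<sigma>: "\<sigma> \<in> samples" by simp
    have dev: "form_le V (dev \<sigma>) (exp 1 * b)"
      using * b p by (intro form_le_of_tr_power[of _ p] adj_dev \<sigma>) (auto simp: bad_def)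
    have "form_le V (\<Sum>q\<in>Q. W q (\<sigma> q)) (12 * R * real p + 7 * m)"
      unfolding form_le_def
    proof
      fix Y
      have "(\<Sum>q\<in>Q. W q (\<sigma> q)) = dev \<sigma> + (\<Sum>q\<in>Q. mean q)"
        by (simp add: dev_def sum_subtractf)
      then have "tr V (adj Y * (\<Sum>q\<in>Q. W q (\<sigma> q)) * Y) = tr V (adj Y * dev \<sigma> * Y) + tr V (adj Y * (\<Sum>q\<in>Q. mean q) * Y)"
        by (simp add: algebra_simps)
      also have "\<dots> \<le> exp 1 * b * tr V (adj Y * Y) + m * tr V (adj Y * Y)"
        using dev mean_le[folded mean_def] unfolding form_le_def by (intro add_mono) blast+
      also have "\<dots> \<le> (3 * b + m) * tr V (adj Y * Y)"
        using b exp_le by (simp add: distrib_right[symmetric] mult_right_mono tr_square_nonneg)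
      also have "3 * b + m = 12 * R * real p + 7 * m" by (simp add: b_def)
      finally show "tr V (adj Y * (\<Sum>q\<in>Q. W q (\<sigma> q)) * Y) \<le> (12 * R * real p + 7 * m) * tr V (adj Y * Y)" .
    qed
    then show False using * by simp
  qed
  then have "real (card ?bad) \<le> real (card bad)"
    using fin by (auto simp: bad_def intro!: card_mono)
  also have "real (card bad) * (exp 1 * b) ^ (2 * p) \<le> real (card samples) * real (card V) * b ^ (2 * p)"
  proof -
    have "real (card bad) * (exp 1 * b) ^ (2 * p) = (\<Sum>\<sigma>\<in>bad. (exp 1 * b) ^ (2 * p))" by simp
    also have "\<dots> \<le> (\<Sum>\<sigma>\<in>bad. tr V (dev \<sigma> ^ (2 * p)))"
      by (intro sum_mono) (auto simp: bad_def)
    also have "\<dots> \<le> (\<Sum>\<sigma>\<in>samples. tr V (dev \<sigma> ^ (2 * p)))"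
      using fin A0 by (intro sum_mono2) (auto simp: bad_def)
    also have "\<dots> \<le> real (card samples) * real (card V) * b ^ (2 * p)"
      unfolding b_def by (rule moment_le) simp
    finally show ?thesis .
  qed
  then have "real (card bad) * exp (2 * real p) \<le> real (card samples) * real (card V)"
    using b by (simp add: power_mult_distrib exp_of_nat_mult[symmetric])
  then have "real (card bad) \<le> real (card samples) * real (card V) * exp (- 2 * real p)"
    by (simp add: exp_minus field_simps)
  finally show ?thesis .
qed

end

section \<open>The points of a Cantor set by index\<close>

lemma card_alphabets: "card (alphabets M A) = M choose A"
  using n_subsets[of "{0..<M}" A] by (simp add: alphabets_def)

lemma finite_alphabets: "finite (alphabets M A)"
  by (rule finite_subset[of _ "Pow {0..<M}"]) (auto simp: alphabets_def)

lemma alphabets_nonempty: "A \<le> M \<Longrightarrow> alphabets M A \<noteq> {}"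
  by (auto simp: alphabets_def intro!: exI[of _ "{0..<A}"])

text \<open>Each digit belongs to binomial (M-1, A-1) of the alphabets, a proportion A/M. Values in
  a real vector space are allowed because the lemma is applied to matrices.\<close>

lemma sum_over_alphabets:
  fixes g :: "nat \<Rightarrow> 'v :: real_vector"
  assumes "0 < A" "A \<le> M"
  shows "(1 / real (card (alphabets M A))) *\<^sub>R (\<Sum>X\<in>alphabets M A. \<Sum>a\<in>X. g a) = (real A / real M) *\<^sub>R (\<Sum>a<M. g a)"
proof -
  have card_containing: "card {X \<in> alphabets M A. a \<in> X} = (M - 1) choose (A - 1)" if "a < M" for a
  proof -
    have "bij_betw (insert a) {Y. Y \<subseteq> {0..<M} - {a} \<and> card Y = A - 1} {X \<in> alphabets M A. a \<in> X}"
    proof (rule bij_betwI[of _ _ _ "\<lambda>X. X - {a}"])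
      show "insert a \<in> {Y. Y \<subseteq> {0..<M} - {a} \<and> card Y = A - 1} \<rightarrow> {X \<in> alphabets M A. a \<in> X}"
      proof (rule funcsetI)
        fix Y assume Y: "Y \<in> {Y. Y \<subseteq> {0..<M} - {a} \<and> card Y = A - 1}"
        then have "finite Y" "a \<notin> Y" by (auto intro: finite_subset)
        then show "insert a Y \<in> {X \<in> alphabets M A. a \<in> X}"
          using Y assms that by (auto simp: alphabets_def)
      qed
      show "(\<lambda>X. X - {a}) \<in> {X \<in> alphabets M A. a \<in> X} \<rightarrow> {Y. Y \<subseteq> {0..<M} - {a} \<and> card Y = A - 1}"
        by (auto simp: alphabets_def)
    qed auto
    then have "card {X \<in> alphabets M A. a \<in> X} = card {Y. Y \<subseteq> {0..<M} - {a} \<and> card Y = A - 1}"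
      by (simp add: bij_betw_same_card)
    also have "\<dots> = card ({0..<M} - {a}) choose (A - 1)"
      by (rule n_subsets) simp
    finally show ?thesis using that by simp
  qed
  have "(\<Sum>X\<in>alphabets M A. \<Sum>a\<in>X. g a) = (\<Sum>X\<in>alphabets M A. \<Sum>a<M. if a \<in> X then g a else 0)"
  proof (rule sum.cong[OF refl])
    fix X assume "X \<in> alphabets M A"
    then have "{a \<in> {..<M}. a \<in> X} = X" by (auto simp: alphabets_def)
    then show "(\<Sum>a\<in>X. g a) = (\<Sum>a<M. if a \<in> X then g a else 0)"
      using sum.inter_filter[of "{..<M}" g "\<lambda>a. a \<in> X"] by simp
  qed
  also have "\<dots> = (\<Sum>a<M. \<Sum>X\<in>alphabets M A. if a \<in> X then g a else 0)"
    by (rule sum.swap)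
  also have "\<dots> = (\<Sum>a<M. real ((M - 1) choose (A - 1)) *\<^sub>R g a)"
    using card_containing finite_alphabets[of M A]
    by (intro sum.cong refl) (simp add: sum.inter_filter[symmetric] scaleR_conv_of_real sum_constant_scaleR)
  also have "\<dots> = real ((M - 1) choose (A - 1)) *\<^sub>R (\<Sum>a<M. g a)"
    by (simp add: scaleR_sum_right)
  finally have eq: "(\<Sum>X\<in>alphabets M A. \<Sum>a\<in>X. g a) = real ((M - 1) choose (A - 1)) *\<^sub>R (\<Sum>a<M. g a)" .
  have "real A * real (M choose A) = real M * real ((M - 1) choose (A - 1))"
    using times_binomial_minus1_eq[of A M] assms by (metis of_nat_mult)
  moreover have "real (M choose A) > 0" using assms by simp
  ultimately have "real ((M - 1) choose (A - 1)) / real (M choose A) = real A / real M"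
    using assms by (simp add: field_simps)
  then show ?thesis unfolding eq card_alphabets by simp
qed

text \<open>The \<open>i\<close>-th point of the \<open>n\<close>-th generation is \<open>cantor_pos M A w n i / M ^ n\<close>; its parent has index
  \<open>i div A\<close>.\<close>

primrec cantor_pos :: "nat \<Rightarrow> nat \<Rightarrow> (nat \<Rightarrow> nat \<Rightarrow> nat set) \<Rightarrow> nat \<Rightarrow> nat \<Rightarrow> nat" where
  "cantor_pos M A w 0 i = 0"
| "cantor_pos M A w (Suc n) i =
     M * cantor_pos M A w n (i div A) + sorted_list_of_set (w (Suc n) (i div A)) ! (i mod A)"

abbreviation cantor_point :: "nat \<Rightarrow> nat \<Rightarrow> (nat \<Rightarrow> nat \<Rightarrow> nat set) \<Rightarrow> nat \<Rightarrow> nat \<Rightarrow> real" where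
  "cantor_point M A w n i \<equiv> real (cantor_pos M A w n i) / real (M ^ n)"

definition valid_choice :: "nat \<Rightarrow> nat \<Rightarrow> nat \<Rightarrow> (nat \<Rightarrow> nat \<Rightarrow> nat set) \<Rightarrow> bool" where
  "valid_choice M A n w \<longleftrightarrow> (\<forall>j\<in>{1..n}. \<forall>k<A ^ (j - 1). w j k \<in> alphabets M A)"

lemma valid_choice_mono: "valid_choice M A n w \<Longrightarrow> m \<le> n \<Longrightarrow> valid_choice M A m w"
  by (auto simp: valid_choice_def)

lemma valid_choiceD: "valid_choice M A n w \<Longrightarrow> Suc j \<le> n \<Longrightarrow> k < A ^ j \<Longrightarrow> w (Suc j) k \<in> alphabets M A"
  by (auto simp: valid_choice_def dest: bspec[of _ _ "Suc j"])

lemma alphabet_digits: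
  assumes "X \<in> alphabets M A"
  shows "finite X" "set (sorted_list_of_set X) = X" "length (sorted_list_of_set X) = A"
    "s < A \<Longrightarrow> sorted_list_of_set X ! s < M"
    "s < t \<Longrightarrow> t < A \<Longrightarrow> sorted_list_of_set X ! s < sorted_list_of_set X ! t"
proof -
  show fin: "finite X" using assms by (auto simp: alphabets_def intro: finite_subset)
  show set: "set (sorted_list_of_set X) = X" using fin by simp
  show len: "length (sorted_list_of_set X) = A" using assms by (simp add: alphabets_def)
  show "sorted_list_of_set X ! s < M" if "s < A"
    using nth_mem[of s "sorted_list_of_set X"] that len set assms by (auto simp: alphabets_def)
  show "sorted_list_of_set X ! s < sorted_list_of_set X ! t" if "s < t" "t < A"
    using sorted_wrt_nth_less[OF strict_sorted_list_of_set[of X] that(1)] that(2) len by simp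
qed

lemma div_less_power: "i < A ^ Suc n \<Longrightarrow> i div A < A ^ n" for A :: nat
  by (simp add: less_mult_imp_div_less mult.commute)

lemma cantor_pos_less:
  assumes "valid_choice M A n w" "i < A ^ n"
  shows "cantor_pos M A w n i < M ^ n"
  using assms
proof (induction n arbitrary: i)
  case (Suc n)
  have A: "A > 0" using Suc.prems by (cases A) auto
  have "cantor_pos M A w n (i div A) < M ^ n"
    using Suc by (intro Suc.IH div_less_power) (auto intro: valid_choice_mono)
  moreover have "sorted_list_of_set (w (Suc n) (i div A)) ! (i mod A) < M"
    using Suc.prems A by (intro alphabet_digits(4)[of _ M A] valid_choiceD[OF Suc.prems(1)] div_less_power) auto
  ultimately have "M * cantor_pos M A w n (i div A) + sorted_list_of_set (w (Suc n) (i div A)) ! (i mod A)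
      < M * cantor_pos M A w n (i div A) + M" by simp
  also have "\<dots> = M * (cantor_pos M A w n (i div A) + 1)" by simp
  also have "\<dots> \<le> M * M ^ n"
    using \<open>cantor_pos M A w n (i div A) < M ^ n\<close> by (intro mult_left_mono) auto
  finally show ?case by simp
qed simp

text \<open>Parents decide the order before digits do, since distinct parents are at least one full
  digit range M apart. Hence the index order is the spatial order, which identifies k with the k-th
  smallest point in the definition of the Cantor set.\<close>

lemma cantor_pos_strict_mono:
  assumes "valid_choice M A n w" "i < k" "k < A ^ n"
  shows "cantor_pos M A w n i < cantor_pos M A w n k"
  using assms
proof (induction n arbitrary: i k)
  case (Suc n)
  have A: "A > 0" using Suc.prems by (cases A) auto
  let ?d = "\<lambda>i. sorted_list_of_set (w (Suc n) (i div A)) ! (i mod A)"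
  have v: "w (Suc n) (j div A) \<in> alphabets M A" if "j < A ^ Suc n" for j
    using Suc.prems that by (intro valid_choiceD[OF Suc.prems(1)] div_less_power) auto
  show ?case
  proof (cases "i div A = k div A")
    case True
    then have "i mod A < k mod A"
      using Suc.prems(2) by (metis div_mult_mod_eq nat_add_left_cancel_less)
    then have "?d i < ?d k"
      using alphabet_digits(5)[OF v[of k]] A Suc.prems True by simp
    then show ?thesis using True by simp
  next
    case False
    then have lt: "i div A < k div A" using Suc.prems(2) by (meson div_le_mono le_neq_implies_less less_imp_le)
    have "cantor_pos M A w n (i div A) < cantor_pos M A w n (k div A)"
      using Suc lt by (intro Suc.IH div_less_power) (auto intro: valid_choice_mono)
    then have "M * cantor_pos M A w n (i div A) + M \<le> M * cantor_pos M A w n (k div A)"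
      by (metis Suc_leI mult_Suc_right mult_le_mono2 add.commute)
    moreover have "?d i < M"
      using Suc.prems A by (intro alphabet_digits(4)[of _ M A] v) auto
    ultimately show ?thesis by simp
  qed
qed simp

lemma inj_on_cantor_pos: "valid_choice M A n w \<Longrightarrow> inj_on (cantor_pos M A w n) {..<A ^ n}"
  by (intro strict_mono_on_imp_inj_on strict_mono_onI) (simp add: cantor_pos_strict_mono)

text \<open>Truncating digits leads to the same ancestor in positions (base M) and in indices (base
  A). This lets the distance of two points be read off from their ancestors.\<close>

lemma cantor_pos_div:
  assumes "valid_choice M A (n + m) w" "i < A ^ (n + m)"
  shows "cantor_pos M A w (n + m) i div M ^ m = cantor_pos M A w n (i div A ^ m)"
  using assms
proof (induction m arbitrary: i)
  case (Suc m)
  have A: "A > 0" using Suc.prems by (cases A) auto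
  have i: "i < A ^ Suc (n + m)" using Suc.prems by simp
  have d: "sorted_list_of_set (w (Suc (n + m)) (i div A)) ! (i mod A) < M"
    using Suc.prems A i by (intro alphabet_digits(4)[of _ M A] valid_choiceD[OF Suc.prems(1)] div_less_power) auto
  have "cantor_pos M A w (n + Suc m) i div M ^ Suc m = cantor_pos M A w (Suc (n + m)) i div M div M ^ m"
    by (simp add: div_mult2_eq)
  also have "cantor_pos M A w (Suc (n + m)) i div M = cantor_pos M A w (n + m) (i div A)"
    using d by simp
  also have "\<dots> div M ^ m = cantor_pos M A w n (i div A div A ^ m)"
    using Suc.prems i by (intro Suc.IH div_less_power) (auto intro: valid_choice_mono)
  also have "i div A div A ^ m = i div A ^ Suc m" by (simp add: div_mult2_eq)
  finally show ?case .
qed simp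

text \<open>A point depends only on the alphabets along its ancestral line. The alphabet chosen at
  generation j belongs to the ancestor at generation j - 1, hence the exponent n + 1 - j.\<close>

lemma cantor_pos_cong:
  assumes "\<And>j. 1 \<le> j \<Longrightarrow> j \<le> n \<Longrightarrow> w j (i div A ^ (n + 1 - j)) = w' j (i div A ^ (n + 1 - j))"
  shows "cantor_pos M A w n i = cantor_pos M A w' n i"
  using assms
proof (induction n arbitrary: i)
  case (Suc n)
  have "cantor_pos M A w n (i div A) = cantor_pos M A w' n (i div A)"
  proof (rule Suc.IH)
    fix j assume j: "1 \<le> j" "j \<le> n"
    have "i div A div A ^ (n + 1 - j) = i div A ^ (Suc n + 1 - j)"
      using j by (simp add: div_mult2_eq[symmetric] power_Suc[symmetric] Suc_diff_le del: power_Suc)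
    then show "w j (i div A div A ^ (n + 1 - j)) = w' j (i div A div A ^ (n + 1 - j))"
      using Suc.prems[of j] j by simp
  qed
  moreover have "w (Suc n) (i div A) = w' (Suc n) (i div A)"
    using Suc.prems[of "Suc n"] by simp
  ultimately show ?case by simp
qed simp

lemma cantor_points_eq:
  assumes "valid_choice M A n w" "M > 0"
  shows "cantor_points M w n = (\<lambda>i. cantor_point M A w n i) ` {..<A ^ n}"
  using assms
proof (induction n)
  case (Suc n)
  let ?b = "\<lambda>i. cantor_point M A w n i"
  have v: "valid_choice M A n w" using Suc.prems by (auto intro: valid_choice_mono)
  then have IH: "cantor_points M w n = ?b ` {..<A ^ n}" using Suc by blast
  let ?xs = "map ?b [0..<A ^ n]"
  have "sorted_wrt (<) ?xs"
    using cantor_pos_strict_mono[OF v] \<open>M > 0\<close>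
    by (auto simp: sorted_wrt_iff_nth_less divide_strict_right_mono)
  then have "sorted_list_of_set (set ?xs) = ?xs"
    by (intro sorted_list_of_set.idem_if_sorted_distinct) (auto simp: strict_sorted_iff)
  moreover have "set ?xs = cantor_points M w n" unfolding IH by auto
  ultimately have list: "sorted_list_of_set (cantor_points M w n) = ?xs" by simp
  then have card: "card (cantor_points M w n) = A ^ n"
    by (metis length_map length_sorted_list_of_set length_upt minus_nat.diff_0)
  have points: "cantor_points M w (Suc n) = (\<Union>k<A ^ n. (\<lambda>a. ?b k + real a / real M ^ Suc n) ` w (Suc n) k)"
    unfolding cantor_points.simps card list by (auto simp: image_def)
  have eq: "?b k + real a / real M ^ Suc n = real (M * cantor_pos M A w n k + a) / real (M ^ Suc n)" for k a
    using \<open>M > 0\<close> by (simp add: field_simps)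
  show ?case
  \<comment> \<open>For A = 0 the only alphabet is empty and \<open>0 ^ Suc n = 0\<close>, so both
    sides are empty; otherwise an index splits into a parent k and a digit number s.\<close>
  proof (cases "A = 0")
    case True
    have "w (Suc n) k = {}" if "k < A ^ n" for k
      using valid_choiceD[OF Suc.prems(1), of n k] that True by (auto simp: alphabets_def dest: finite_subset)
    then show ?thesis using True unfolding points by auto
  next
    case False
    have *: "w (Suc n) k = (\<lambda>s. sorted_list_of_set (w (Suc n) k) ! s) ` {..<A}" if "k < A ^ n" for k
    proof -
      have "w (Suc n) k \<in> alphabets M A" using valid_choiceD[OF Suc.prems(1), of n k] that by simp
      note digits = alphabet_digits[OF this]
      have "set (sorted_list_of_set (w (Suc n) k)) = (\<lambda>s. sorted_list_of_set (w (Suc n) k) ! s) ` {..<A}"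
        unfolding set_conv_nth digits(3) by auto
      then show ?thesis unfolding digits(2) .
    qed
    have "cantor_points M w (Suc n) = (\<Union>k<A ^ n. (\<lambda>s. real (cantor_pos M A w (Suc n) (A * k + s)) / real (M ^ Suc n)) ` {..<A})"
      unfolding points
    proof (intro SUP_cong refl)
      fix k assume "k \<in> {..<A ^ n}"
      then show "(\<lambda>a. ?b k + real a / real M ^ Suc n) ` w (Suc n) k
          = (\<lambda>s. real (cantor_pos M A w (Suc n) (A * k + s)) / real (M ^ Suc n)) ` {..<A}"
        unfolding eq by (subst *) (auto simp: image_image intro!: image_cong)
    qed
    also have "\<dots> = (\<lambda>i. real (cantor_pos M A w (Suc n) i) / real (M ^ Suc n)) ` {..<A ^ Suc n}"
    proof -
      have "(\<Union>k<A ^ n. (\<lambda>s. A * k + s) ` {..<A}) = {..<A ^ Suc n}"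
      proof (intro equalityI subsetI)
        fix i assume "i \<in> (\<Union>k<A ^ n. (\<lambda>s. A * k + s) ` {..<A})"
        then obtain k s where "k < A ^ n" "s < A" "i = A * k + s" by auto
        moreover from this have "A * k + s < A * (k + 1)" by simp
        moreover have "A * (k + 1) \<le> A * A ^ n" using \<open>k < A ^ n\<close> by (intro mult_le_mono2) simp
        ultimately show "i \<in> {..<A ^ Suc n}" by simp
      next
        fix i assume "i \<in> {..<A ^ Suc n}"
        then show "i \<in> (\<Union>k<A ^ n. (\<lambda>s. A * k + s) ` {..<A})"
          using False by (intro UN_I[of "i div A"] image_eqI[of _ _ "i mod A"]) (auto intro: div_less_power)
      qed
      then have "{..<A ^ Suc n} = (\<Union>k<A ^ n. (\<lambda>s. A * k + s) ` {..<A})" by simp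
      then show ?thesis by (simp add: image_UN image_image)
    qed
    finally show ?thesis .
  qed
qed (simp add: lessThan_Suc)

section \<open>Quadratic forms of exponentials\<close>

text \<open>The rank one matrix e e* with e_y = \<open>cis (\<beta> y)\<close>. Sums of these are
  Gram matrices of rows of exponentials.\<close>

lift_definition phase_mat :: "(nat \<Rightarrow> real) \<Rightarrow> fmat" is
  "\<lambda>\<beta> V i j. if finite V \<and> i \<in> V \<and> j \<in> V then cis (\<beta> i - \<beta> j) else 0"
  by auto

lemma entry_phase_mat: "finite V \<Longrightarrow> i \<in> V \<Longrightarrow> j \<in> V \<Longrightarrow> entry (phase_mat \<beta>) V i j = cis (\<beta> i - \<beta> j)"
  by (simp add: phase_mat.rep_eq)

lemma adj_phase_mat [simp]: "adj (phase_mat \<beta>) = phase_mat \<beta>"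
  by (rule fmat_eqI) (simp add: entry_phase_mat cis_cnj)

lemma tr_form: "tr V (adj Y * S * Y) = Re (\<Sum>k\<in>V. \<Sum>i\<in>V. \<Sum>j\<in>V. cnj (entry Y V i k) * entry S V i j * entry Y V j k)"
  unfolding tr_def entry_mult sum_distrib_right
  by (rule arg_cong[of _ _ Re], rule sum.cong[OF refl], subst sum.swap) simp

lemma tr_form_phase_mat:
  assumes "finite V"
  shows "tr V (adj Y * phase_mat \<beta> * Y) = (\<Sum>k\<in>V. (cmod (\<Sum>i\<in>V. cis (- \<beta> i) * entry Y V i k))\<^sup>2)"
proof -
  have "(\<Sum>i\<in>V. \<Sum>j\<in>V. cnj (entry Y V i k) * entry (phase_mat \<beta>) V i j * entry Y V j k)
      = cnj (\<Sum>i\<in>V. cis (- \<beta> i) * entry Y V i k) * (\<Sum>i\<in>V. cis (- \<beta> i) * entry Y V i k)" for k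
    unfolding cnj_sum sum_product
  proof (intro sum.cong refl)
    fix i j assume "i \<in> V" "j \<in> V"
    then have "entry (phase_mat \<beta>) V i j = cis (\<beta> i) * cis (- \<beta> j)"
      using assms by (simp add: entry_phase_mat cis_mult)
    then show "cnj (entry Y V i k) * entry (phase_mat \<beta>) V i j * entry Y V j k
        = cnj (cis (- \<beta> i) * entry Y V i k) * (cis (- \<beta> j) * entry Y V j k)"
      by (simp add: cis_cnj)
  qed
  moreover have "Re (cnj z * z) = (cmod z)\<^sup>2" for z
    unfolding cmod_power2 by (simp add: power2_eq_square)
  ultimately have "Re (\<Sum>i\<in>V. \<Sum>j\<in>V. cnj (entry Y V i k) * entry (phase_mat \<beta>) V i j * entry Y V j k)
      = (cmod (\<Sum>i\<in>V. cis (- \<beta> i) * entry Y V i k))\<^sup>2" for k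
    by presburger
  then show ?thesis unfolding tr_form by (subst Re_sum) (rule sum.cong[OF refl])
qed

lemma form_le_sum:
  assumes "\<And>i. i \<in> I \<Longrightarrow> form_le V (S i) (c i)"
  shows "form_le V (\<Sum>i\<in>I. S i) (\<Sum>i\<in>I. c i)"
  using assms unfolding form_le_def
  by (auto simp: sum_distrib_left sum_distrib_right intro!: sum_mono)

lemma form_le_scaleR: "form_le V S c \<Longrightarrow> r \<ge> 0 \<Longrightarrow> form_le V (r *\<^sub>R S) (r * c)"
  unfolding form_le_def by (auto simp: mult_left_mono mult.assoc)

lemma form_le_mono: "form_le V S c \<Longrightarrow> c \<le> d \<Longrightarrow> form_le V S d"
  unfolding form_le_def by (blast intro: order_trans mult_right_mono tr_square_nonneg)

lemma psd_sum: "(\<And>i. i \<in> I \<Longrightarrow> psd V (S i)) \<Longrightarrow> psd V (\<Sum>i\<in>I. S i)"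
  unfolding psd_def by (auto simp: sum_distrib_left sum_distrib_right intro!: sum_nonneg)

lemma psd_scaleR: "psd V S \<Longrightarrow> r \<ge> 0 \<Longrightarrow> psd V (r *\<^sub>R S)"
  unfolding psd_def by auto

lemma psd_phase_mat: "finite V \<Longrightarrow> psd V (phase_mat \<beta>)"
  unfolding psd_def by (auto simp: tr_form_phase_mat intro!: sum_nonneg)

text \<open>Schur's test. The products in the form are split by 2 |y_i| |y_j| <= |y_i|^2 + |y_j|^2;
  self-adjointness makes column sums equal to row sums, so one of the two hypotheses
  suffices.\<close>

lemma form_le_Schur:
  assumes S: "adj S = S" and V: "finite V"
    and row: "\<And>i. i \<in> V \<Longrightarrow> (\<Sum>j\<in>V. cmod (entry S V i j)) \<le> c"
  shows "form_le V S c"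
  unfolding form_le_def
proof
  fix Y
  let ?s = "\<lambda>i j. cmod (entry S V i j)" and ?y = "\<lambda>i k. (cmod (entry Y V i k))\<^sup>2"
  have sym: "?s i j = ?s j i" for i j
    using arg_cong[OF S, of "\<lambda>S. cmod (entry S V i j)"] by simp
  have "tr V (adj Y * S * Y) \<le> (\<Sum>k\<in>V. \<Sum>i\<in>V. \<Sum>j\<in>V. ?s i j * ?y i k / 2 + ?s i j * ?y j k / 2)"
    unfolding tr_form Re_sum
  proof (intro sum_mono)
    fix k i j
    have "Re (cnj (entry Y V i k) * entry S V i j * entry Y V j k) \<le> ?s i j * (cmod (entry Y V i k) * cmod (entry Y V j k))"
      using complex_Re_le_cmod[of "cnj (entry Y V i k) * entry S V i j * entry Y V j k"]
      by (simp add: norm_mult ac_simps)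
    also have "\<dots> \<le> ?s i j * ((?y i k + ?y j k) / 2)"
      using sum_squares_bound[of "cmod (entry Y V i k)" "cmod (entry Y V j k)"] by (intro mult_left_mono) auto
    finally show "Re (cnj (entry Y V i k) * entry S V i j * entry Y V j k) \<le> ?s i j * ?y i k / 2 + ?s i j * ?y j k / 2"
      by (simp only: distrib_left add_divide_distrib times_divide_eq_right)
  qed
  also have "\<dots> = (\<Sum>k\<in>V. \<Sum>i\<in>V. (\<Sum>j\<in>V. ?s i j) * ?y i k)"
  proof (rule sum.cong[OF refl])
    fix k
    have half: "(\<Sum>i\<in>V. \<Sum>j\<in>V. ?s i j * ?y j k / 2) = (\<Sum>i\<in>V. \<Sum>j\<in>V. ?s i j * ?y i k / 2)"
      by (subst sum.swap) (simp add: sym)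
    show "(\<Sum>i\<in>V. \<Sum>j\<in>V. ?s i j * ?y i k / 2 + ?s i j * ?y j k / 2) = (\<Sum>i\<in>V. (\<Sum>j\<in>V. ?s i j) * ?y i k)"
      unfolding sum.distrib half by (simp add: sum_distrib_right sum_divide_distrib[symmetric])
  qed
  also have "\<dots> \<le> (\<Sum>k\<in>V. \<Sum>i\<in>V. c * ?y i k)"
    by (intro sum_mono mult_right_mono row) auto
  also have "\<dots> = c * tr V (adj Y * Y)"
    unfolding tr_square by (simp add: sum_distrib_left)
  finally show "tr V (adj Y * S * Y) \<le> c * tr V (adj Y * Y)" .
qed

text \<open>Turns a vector into a test matrix for \<open>form_le\<close>: with the vector repeated
  in every column, both sides are multiplied by \<open>card V\<close>.\<close>

lift_definition constant_columns :: "(nat \<Rightarrow> complex) \<Rightarrow> fmat" is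
  "\<lambda>u V i j. if finite V \<and> i \<in> V \<and> j \<in> V then u i else 0"
  by auto

lemma form_le_phase_sum_imp:
  assumes V: "finite V" and le: "form_le V (\<Sum>x\<in>U. phase_mat (\<beta> x)) c"
  shows "(\<Sum>x\<in>U. (cmod (\<Sum>y\<in>V. cis (- \<beta> x y) * u y))\<^sup>2) \<le> c * (\<Sum>y\<in>V. (cmod (u y))\<^sup>2)"
proof (cases "V = {}")
  case False
  define Y where "Y = constant_columns u"
  have Y: "entry Y V i k = u i" if "i \<in> V" "k \<in> V" for i k
    using that V by (simp add: Y_def constant_columns.rep_eq)
  have "tr V (adj Y * (\<Sum>x\<in>U. phase_mat (\<beta> x)) * Y) = (\<Sum>x\<in>U. \<Sum>k\<in>V. (cmod (\<Sum>i\<in>V. cis (- \<beta> x i) * entry Y V i k))\<^sup>2)"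
    by (simp add: sum_distrib_left sum_distrib_right tr_form_phase_mat[OF V])
  also have "\<dots> = real (card V) * (\<Sum>x\<in>U. (cmod (\<Sum>y\<in>V. cis (- \<beta> x y) * u y))\<^sup>2)"
    by (simp add: Y sum_distrib_left)
  finally have 1: "tr V (adj Y * (\<Sum>x\<in>U. phase_mat (\<beta> x)) * Y) = real (card V) * (\<Sum>x\<in>U. (cmod (\<Sum>y\<in>V. cis (- \<beta> x y) * u y))\<^sup>2)" .
  have 2: "tr V (adj Y * Y) = real (card V) * (\<Sum>y\<in>V. (cmod (u y))\<^sup>2)"
    by (simp add: tr_square Y)
  have "real (card V) * (\<Sum>x\<in>U. (cmod (\<Sum>y\<in>V. cis (- \<beta> x y) * u y))\<^sup>2) \<le> c * (real (card V) * (\<Sum>y\<in>V. (cmod (u y))\<^sup>2))"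
    using le unfolding form_le_def 1[symmetric] 2[symmetric] by blast
  moreover have "real (card V) > 0" using False V by (simp add: card_gt_0_iff)
  ultimately show ?thesis by (simp add: mult.left_commute[of c])
qed simp

section \<open>The Dirichlet kernel and averaged rank one matrices\<close>

lemma norm_sum_cis_le:
  fixes t :: real
  assumes t: "0 < \<bar>t\<bar>" "\<bar>t\<bar> \<le> 1"
  shows "cmod (\<Sum>r<N. cis (real r * t)) \<le> 4 / \<bar>t\<bar>"
proof -
  \<comment> \<open>The denominator of the geometric sum is at least |sin t|. On (0, 1], an interval
    inside [0, pi/3], the cosine is at least 1/2, so the mean value theorem gives sin x >=
    x/2.\<close>
  have half_le_sin: "x / 2 \<le> sin x" if x: "0 < x" "x \<le> 1" for x :: real
  proof -
    obtain z where z: "0 < z" "z < x" "sin x - sin 0 = (x - 0) * cos z"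
      using MVT2[of 0 x sin cos] x by (auto intro: DERIV_sin)
    have "cos z \<ge> cos (pi / 3)"
      using z x pi_gt3 by (intro cos_monotone_0_pi_le) auto
    then show ?thesis using z x by (simp add: cos_60 mult_left_mono)
  qed
  have "\<bar>t\<bar> / 2 \<le> \<bar>sin t\<bar>"
    using half_le_sin[of t] half_le_sin[of "- t"] t by (cases "t > 0") auto
  also have "\<dots> = \<bar>Im (cis t - 1)\<bar>" by simp
  also have "\<dots> \<le> cmod (cis t - 1)" by (rule abs_Im_le_cmod)
  finally have den: "\<bar>t\<bar> / 2 \<le> cmod (cis t - 1)" .
  have "(\<Sum>r<N. cis (real r * t)) = (\<Sum>r<N. cis t ^ r)"
    by (intro sum.cong refl) (simp add: Complex.DeMoivre)
  then have "(cis t - 1) * (\<Sum>r<N. cis (real r * t)) = cis t ^ N - 1"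
    using power_diff_1_eq[of "cis t" N] by simp
  then have "cmod (cis t - 1) * cmod (\<Sum>r<N. cis (real r * t)) = cmod (cis t ^ N - 1)"
    by (simp add: norm_mult[symmetric])
  also have "\<dots> \<le> 2"
    using norm_triangle_ineq4[of "cis t ^ N" 1] by (simp add: norm_power)
  finally have "\<bar>t\<bar> / 2 * cmod (\<Sum>r<N. cis (real r * t)) \<le> 2"
    using mult_right_mono[OF den, of "cmod (\<Sum>r<N. cis (real r * t))"] by simp
  then show ?thesis using t by (simp add: field_simps)
qed

lemma sum_inverse_le:
  assumes "N > 0"
  shows "(\<Sum>t<N. 1 / max 1 (real t)) \<le> 2 + ln (real N)"
proof -
  have *: "(\<Sum>t<Suc (Suc N). 1 / max 1 (real t)) \<le> 2 + ln (real (Suc N))" for N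
  proof (induction N)
    case (Suc N)
    have "ln (real (Suc N) / real (Suc (Suc N))) \<le> real (Suc N) / real (Suc (Suc N)) - 1"
      by (intro ln_le_minus_one) auto
    also have "\<dots> = - 1 / real (Suc (Suc N))" by (simp add: field_simps)
    finally have "ln (real (Suc N)) + 1 / real (Suc (Suc N)) \<le> ln (real (Suc (Suc N)))"
      by (simp add: ln_div del: of_nat_Suc)
    moreover have "(\<Sum>t<Suc (Suc (Suc N)). 1 / max 1 (real t))
        = (\<Sum>t<Suc (Suc N). 1 / max 1 (real t)) + 1 / real (Suc (Suc N))"
      by simp
    ultimately show ?case using Suc by linarith
  qed simp
  show ?thesis
  proof (cases "N = 1")
    case False
    with assms have "2 \<le> N" by simp
    then obtain K where K: "N = Suc (Suc K)" using le_Suc_ex[of 2 N] by auto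
    have "ln (real (Suc K)) \<le> ln (real N)" unfolding K by (subst ln_le_cancel_iff) auto
    then show ?thesis using *[of K] unfolding K by linarith
  qed simp
qed

text \<open>This is 8 * 2 * (2 + ln (M^n)): 8 from the decay of a smeared entry, 2 for the two sides
  of a harmonic sum over at most M^n integers.\<close>

definition level_weight :: "nat \<Rightarrow> nat \<Rightarrow> real" where
  "level_weight M n = 32 + 16 * real n * ln (real M)"

text \<open>The average of the rank one matrices \<open>e\<^sub>x e\<^sub>x\<^sup>*\<close>, \<open>e\<^sub>x = (exp (i \<theta> x b y))\<^sub>y\<close>, over the \<open>M\<^bsup>n-j\<^esup>\<close> integers
  \<open>x\<close> whose leading digits are those of \<open>p\<close>.\<close>

definition smear :: "nat \<Rightarrow> nat \<Rightarrow> real \<Rightarrow> (nat \<Rightarrow> real) \<Rightarrow> nat \<Rightarrow> nat \<Rightarrow> fmat" where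
  "smear M n \<theta> b j p =
     (1 / real (M ^ (n - j))) *\<^sub>R (\<Sum>r<M ^ (n - j). phase_mat (\<lambda>y. \<theta> * real (p * M ^ (n - j) + r) * b y))"

lemma adj_smear [simp]: "adj (smear M n \<theta> b j p) = smear M n \<theta> b j p"
  by (simp add: smear_def)

lemma psd_smear: "finite V \<Longrightarrow> psd V (smear M n \<theta> b j p)"
  unfolding smear_def by (intro psd_scaleR psd_sum psd_phase_mat) auto

text \<open>The M intervals of integers belonging to the children of p tile the interval of p. This
  is the martingale identity of the proof: averaging the next digit leads back to the current
  generation.\<close>

lemma sum_smear_Suc:
  assumes "j < n" "M > 0"
  shows "(\<Sum>a<M. smear M n \<theta> b (Suc j) (M * p + a)) = real M *\<^sub>R smear M n \<theta> b j p"
proof -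
  define N where "N = M ^ (n - Suc j)"
  have N: "M ^ (n - j) = M * N"
    using assms unfolding N_def by (metis Suc_diff_Suc power_Suc)
  let ?f = "\<lambda>x. phase_mat (\<lambda>y. \<theta> * real x * b y)"
  have "(\<Sum>a<M. \<Sum>r<N. ?f ((M * p + a) * N + r)) = (\<Sum>a<M. \<Sum>x\<in>{a * N..<a * N + N}. ?f (p * (M * N) + x))"
  proof (rule sum.cong[OF refl])
    fix a
    have "(\<Sum>x\<in>{a * N..<a * N + N}. ?f (p * (M * N) + x)) = (\<Sum>r\<in>{0..<N}. ?f (p * (M * N) + (r + a * N)))"
      using sum.shift_bounds_nat_ivl[of "\<lambda>x. ?f (p * (M * N) + x)" 0 "a * N" N] by (simp add: add.commute)
    then show "(\<Sum>r<N. ?f ((M * p + a) * N + r)) = (\<Sum>x\<in>{a * N..<a * N + N}. ?f (p * (M * N) + x))"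
      by (simp add: lessThan_atLeast0 algebra_simps)
  qed
  also have "\<dots> = (\<Sum>x<M * N. ?f (p * (M * N) + x))"
    by (rule sum.nat_group)
  finally have "(\<Sum>a<M. smear M n \<theta> b (Suc j) (M * p + a)) = (1 / real N) *\<^sub>R (\<Sum>x<M * N. ?f (p * (M * N) + x))"
    by (simp add: smear_def N_def[symmetric] scaleR_sum_right[symmetric])
  then show ?thesis using assms by (simp add: smear_def N)
qed

text \<open>A smeared entry is a unimodular factor times the normalised Dirichlet kernel at \<theta>
  (b y - b y'). Only \<theta> >= 1/M is known, so M^(n-j) \<theta> >= M^(n-j-1), and the decay is
  measured at the coarser scale \<open>n - Suc j\<close>; \<theta> <= 1 keeps the frequency within
  [-1, 1].\<close>

lemma norm_entry_smear_le:
  assumes V: "finite V" "y \<in> V" "y' \<in> V" and M: "M > 0" and j: "j < n"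
    and \<theta>: "1 / real M \<le> \<theta>" "\<theta> \<le> 1" and b: "\<bar>b y - b y'\<bar> \<le> 1"
  shows "cmod (entry (smear M n \<theta> b j p) V y y') \<le> 1"
    and "real (M ^ (n - Suc j)) * \<bar>b y - b y'\<bar> \<ge> c \<Longrightarrow> c > 0 \<Longrightarrow> cmod (entry (smear M n \<theta> b j p) V y y') \<le> 4 / c"
proof -
  define N where "N = M ^ (n - j)"
  define t where "t = \<theta> * (b y - b y')"
  have entry_sum: "entry (\<Sum>r\<in>I. S r) V i k = (\<Sum>r\<in>I. entry (S r) V i k)" for I :: "nat set" and S i k
    by (induction I rule: infinite_finite_induct) auto
  have "entry (smear M n \<theta> b j p) V y y' = (1 / real N) *\<^sub>R (\<Sum>r<N. cis (real (p * N) * t) * cis (real r * t))"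
    unfolding smear_def N_def[symmetric] entry_simps entry_sum
    using V by (simp add: entry_phase_mat cis_mult t_def algebra_simps)
  then have eq: "cmod (entry (smear M n \<theta> b j p) V y y') = cmod (\<Sum>r<N. cis (real r * t)) / real N"
    by (simp add: sum_distrib_left[symmetric] norm_mult)
  have N0: "real N > 0" using M by (simp add: N_def)
  have "cmod (\<Sum>r<N. cis (real r * t)) \<le> (\<Sum>r<N. 1)"
    by (rule sum_norm_le) simp
  then show "cmod (entry (smear M n \<theta> b j p) V y y') \<le> 1" unfolding eq using N0 by simp
  assume c: "real (M ^ (n - Suc j)) * \<bar>b y - b y'\<bar> \<ge> c" "c > 0"
  have \<theta>0: "\<theta> > 0" using \<theta>(1) M by (meson less_le_trans divide_pos_pos of_nat_0_less_iff zero_less_one)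
  have "\<bar>b y - b y'\<bar> > 0" using c by (cases "b y = b y'") auto
  then have t0: "\<bar>t\<bar> > 0" using \<theta>0 by (simp add: t_def)
  have "\<bar>t\<bar> \<le> 1 * 1" unfolding t_def abs_mult using \<theta> \<theta>0 b by (intro mult_mono) auto
  then have "cmod (\<Sum>r<N. cis (real r * t)) / real N \<le> 4 / \<bar>t\<bar> / real N"
    using t0 N0 by (intro divide_right_mono norm_sum_cis_le) auto
  also have "\<dots> = 4 / (real N * \<bar>t\<bar>)" by (simp add: mult.commute)
  also have "\<dots> \<le> 4 / c"
  proof -
    have "real N = real M * real (M ^ (n - Suc j))"
      using j unfolding N_def by (metis Suc_diff_Suc of_nat_mult power_Suc)
    then have "real N * \<bar>t\<bar> = (real M * \<theta>) * (real (M ^ (n - Suc j)) * \<bar>b y - b y'\<bar>)"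
      using \<theta>0 by (simp add: t_def abs_mult)
    moreover have "real M * \<theta> \<ge> 1" using \<theta>(1) M by (simp add: field_simps)
    ultimately have "real N * \<bar>t\<bar> \<ge> 1 * c" using c by (simp only:) (intro mult_mono, auto)
    then show ?thesis using c N0 t0 by (intro divide_left_mono mult_pos_pos) auto
  qed
  finally show "cmod (entry (smear M n \<theta> b j p) V y y') \<le> 4 / c" unfolding eq .
qed

section \<open>One step of the recursion over generations\<close>

lemma sum_inverse_dist_le:
  assumes "d < N"
  shows "(\<Sum>t<N. 1 / max 1 \<bar>real d - real t\<bar>) \<le> 2 * (2 + ln (real N))"
proof -
  let ?f = "\<lambda>t. 1 / max 1 (real t)"
  have le: "(\<Sum>t<K. ?f t) \<le> 2 + ln (real N)" if "K \<le> N" "K > 0" for K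
  proof -
    have "ln (real K) \<le> ln (real N)" using that by (subst ln_le_cancel_iff) auto
    then show ?thesis using sum_inverse_le[of K] that by linarith
  qed
  have dist: "\<bar>real d - real t\<bar> = real (if t \<le> d then d - t else t - d)" for t
    by (simp add: of_nat_diff)
  have split: "{..<N} = {..d} \<union> {d<..<N}" using assms by auto
  have "(\<Sum>t<N. 1 / max 1 \<bar>real d - real t\<bar>)
      = (\<Sum>t\<le>d. 1 / max 1 \<bar>real d - real t\<bar>) + (\<Sum>t\<in>{d<..<N}. 1 / max 1 \<bar>real d - real t\<bar>)"
    unfolding split by (rule sum.union_disjoint) auto
  also have "(\<Sum>t\<le>d. 1 / max 1 \<bar>real d - real t\<bar>) = (\<Sum>t<Suc d. ?f t)"
    unfolding dist by (rule sum.reindex_bij_witness[of _ "\<lambda>t. d - t" "\<lambda>t. d - t"]) simp_all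
  also have "(\<Sum>t\<in>{d<..<N}. 1 / max 1 \<bar>real d - real t\<bar>) = (\<Sum>t\<in>{1..<N - d}. ?f t)"
    unfolding dist by (rule sum.reindex_bij_witness[of _ "\<lambda>t. t + d" "\<lambda>t. t - d"]) auto
  also have "\<dots> \<le> (\<Sum>t<N - d. ?f t)" by (intro sum_mono2) auto
  finally show ?thesis using le[of "Suc d"] le[of "N - d"] assms by simp
qed

lemma level_weight_ge: "M > 0 \<Longrightarrow> level_weight M n \<ge> 32"
  by (simp add: level_weight_def)

text \<open>Schur's test with the columns grouped by their ancestors at generation n - j - 1. Each
  ancestor has A^(j+1) descendants, and entries decay like the inverse distance of the ancestors,
  whose positions are distinct integers. The resulting harmonic sum costs only a logarithm. For j =
  n nothing is averaged and the number of columns is enough.\<close>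

lemma form_le_smear:
  assumes w: "valid_choice M A n w" and M: "M > 0" and A: "A > 0" and j: "j \<le> n"
    and \<theta>: "1 / real M \<le> \<theta>" "\<theta> \<le> 1"
    and V: "V \<subseteq> {..<A ^ n}" and b: "\<And>y. y \<in> V \<Longrightarrow> b y = cantor_point M A w n y"
  shows "form_le V (smear M n \<theta> b j p) (real (A ^ (j + 1)) * level_weight M n)"
proof (rule form_le_Schur)
  show fin: "finite V" using V by (rule finite_subset) simp
  fix y assume y: "y \<in> V"
  show "(\<Sum>y'\<in>V. cmod (entry (smear M n \<theta> b j p) V y y')) \<le> real (A ^ (j + 1)) * level_weight M n"
  proof (cases "j = n")
    case True
    have "cmod (entry (smear M n \<theta> b j p) V y y') = 1" if "y' \<in> V" for y'
      using True fin y that by (simp add: smear_def entry_phase_mat)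
    then have "(\<Sum>y'\<in>V. cmod (entry (smear M n \<theta> b j p) V y y')) = real (card V)" by simp
    also have "\<dots> \<le> real (A ^ n)" using card_mono[OF _ V] by simp
    also have "\<dots> = real (A ^ n) * 1" by simp
    also have "\<dots> \<le> real (A ^ (j + 1)) * level_weight M n"
    proof (rule mult_mono)
      show "real (A ^ n) \<le> real (A ^ (j + 1))" using True A by simp
      show "1 \<le> level_weight M n" using level_weight_ge[OF M, of n] by simp
    qed auto
    finally show ?thesis .
  next
    case False
    then have jn: "j < n" using j by simp
    define N where "N = n - Suc j"
    have n: "n = N + Suc j" using jn by (simp add: N_def)
    define d where "d = cantor_pos M A w N"
    define K where "K = A ^ Suc j"
    have K: "K > 0" using A by (simp add: K_def)
    have wN: "valid_choice M A N w" using w n valid_choice_mono by auto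
    have dN: "d i < M ^ N" if "i < A ^ N" for i unfolding d_def by (rule cantor_pos_less[OF wN that])
    have parent: "y' div K < A ^ N" if "y' < A ^ n" for y'
      using that unfolding n K_def power_add by (simp add: less_mult_imp_div_less)
    have pos_div: "cantor_pos M A w n y' div M ^ Suc j = d (y' div K)" if "y' < A ^ n" for y'
      unfolding d_def K_def n by (rule cantor_pos_div) (use w that n in auto)
    \<comment> \<open>Each ancestor position is the floor of the rescaled point, so passing to
      ancestors changes the distance by at most 1.\<close>
    have pos_diff: "\<bar>real (d (y div K)) - real (d (y' div K))\<bar> - 1 \<le> real (M ^ N) * \<bar>b y - b y'\<bar>" if y': "y' \<in> V" for y'
    proof -
      have scaled: "real (M ^ N) * b z = real (cantor_pos M A w n z) / real (M ^ Suc j)" if "z \<in> V" for z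
        using b[OF that] M by (simp add: n power_add field_simps)
      have near: "real (d (z div K)) \<le> real (M ^ N) * b z" "real (M ^ N) * b z \<le> real (d (z div K)) + 1" if "z \<in> V" for z
      proof -
        have "\<lfloor>real (M ^ N) * b z\<rfloor> = int (cantor_pos M A w n z div M ^ Suc j)"
          unfolding scaled[OF that] by (rule floor_divide_of_nat_eq)
        then have "\<lfloor>real (M ^ N) * b z\<rfloor> = int (d (z div K))"
          using pos_div[of z] V that by auto
        then show "real (d (z div K)) \<le> real (M ^ N) * b z" "real (M ^ N) * b z \<le> real (d (z div K)) + 1"
          by linarith+
      qed
      have "\<bar>real (d (y div K)) - real (d (y' div K))\<bar> - 1 \<le> \<bar>real (M ^ N) * b y - real (M ^ N) * b y'\<bar>"
        using near[OF y] near[OF y'] by linarith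
      then show ?thesis by (simp add: abs_mult right_diff_distrib[symmetric])
    qed
    have b01: "\<bar>b y - b y'\<bar> \<le> 1" if "y' \<in> V" for y'
    proof -
      have "0 \<le> b z \<and> b z \<le> 1" if "z \<in> V" for z
      proof -
        have "cantor_pos M A w n z < M ^ n" using V that by (intro cantor_pos_less[OF w]) auto
        then have "real (cantor_pos M A w n z) \<le> real (M ^ n)" by (simp only: of_nat_le_iff less_imp_le)
        then show ?thesis using b[OF that] M by simp
      qed
      from this[OF y] this[OF that] show ?thesis by linarith
    qed
    \<comment> \<open>Up to distance 2 the trivial bound 1 suffices. Beyond it the rounding loss is
      harmless because 4 / (c - 1) <= 8 / c for c >= 2.\<close>
    have entry_le: "cmod (entry (smear M n \<theta> b j p) V y y') \<le> 8 / max 1 \<bar>real (d (y div K)) - real (d (y' div K))\<bar>"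
      if y': "y' \<in> V" for y'
    proof (cases "\<bar>real (d (y div K)) - real (d (y' div K))\<bar> \<le> 2")
      case True
      have "cmod (entry (smear M n \<theta> b j p) V y y') \<le> 1"
        by (rule norm_entry_smear_le(1)[OF fin y y' M jn \<theta> b01[OF y']])
      also have "1 \<le> 8 / max 1 \<bar>real (d (y div K)) - real (d (y' div K))\<bar>"
        using True by simp
      finally show ?thesis .
    next
      case False
      let ?c = "\<bar>real (d (y div K)) - real (d (y' div K))\<bar>"
      have "cmod (entry (smear M n \<theta> b j p) V y y') \<le> 4 / (?c - 1)"
        using False by (intro norm_entry_smear_le(2)[OF fin y y' M jn \<theta> b01[OF y']] pos_diff[OF y', unfolded N_def]) auto
      also have "\<dots> \<le> 8 / ?c" using False by (simp add: field_simps)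
      finally show ?thesis using False by simp
    qed
    let ?g = "\<lambda>t. 8 / max 1 \<bar>real (d (y div K)) - real t\<bar>"
    have "(\<Sum>y'\<in>V. cmod (entry (smear M n \<theta> b j p) V y y')) \<le> (\<Sum>y'\<in>V. ?g (d (y' div K)))"
      by (intro sum_mono entry_le)
    also have "\<dots> \<le> (\<Sum>y'<A ^ N * K. ?g (d (y' div K)))"
    proof (rule sum_mono2)
      have "A ^ n = A ^ N * K" by (simp add: n K_def power_add)
      then show "V \<subseteq> {..<A ^ N * K}" using V by simp
    qed auto
    also have "\<dots> = (\<Sum>i<A ^ N. \<Sum>y'\<in>{i * K..<i * K + K}. ?g (d (y' div K)))"
      by (rule sum.nat_group[symmetric])
    also have "\<dots> = (\<Sum>i<A ^ N. real K * ?g (d i))"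
    proof (rule sum.cong[OF refl])
      fix i
      have "y' div K = i" if "y' \<in> {i * K..<i * K + K}" for y'
        using that by (intro div_nat_eqI) (auto simp: algebra_simps)
      then have "(\<Sum>y'\<in>{i * K..<i * K + K}. ?g (d (y' div K))) = (\<Sum>y'\<in>{i * K..<i * K + K}. ?g (d i))"
        by (intro sum.cong) auto
      then show "(\<Sum>y'\<in>{i * K..<i * K + K}. ?g (d (y' div K))) = real K * ?g (d i)"
        by (simp only: sum_constant card_atLeastLessThan) simp
    qed
    also have "\<dots> = real K * (\<Sum>i<A ^ N. ?g (d i))" by (rule sum_distrib_left[symmetric])
    \<comment> \<open>Ancestors occupy distinct positions, so the sum over them may be enlarged to
      all integers below M^N.\<close>
    also have "\<dots> = real K * (\<Sum>t\<in>d ` {..<A ^ N}. ?g t)"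
      using inj_on_cantor_pos[OF wN] unfolding d_def by (simp add: sum.reindex)
    also have "\<dots> \<le> real K * (\<Sum>t<M ^ N. ?g t)"
      using dN by (intro mult_left_mono sum_mono2) auto
    also have "(\<Sum>t<M ^ N. ?g t) = 8 * (\<Sum>t<M ^ N. 1 / max 1 \<bar>real (d (y div K)) - real t\<bar>)"
      by (simp add: sum_distrib_left)
    also have "real K * (8 * (\<Sum>t<M ^ N. 1 / max 1 \<bar>real (d (y div K)) - real t\<bar>)) \<le> real K * (8 * (2 * (2 + ln (real (M ^ N)))))"
      using V y by (intro mult_left_mono sum_inverse_dist_le dN parent) auto
    also have "\<dots> \<le> real K * level_weight M n"
    proof (intro mult_left_mono)
      have "real N * ln (real M) \<le> real n * ln (real M)"
        using M by (intro mult_right_mono) (auto simp: n)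
      then show "8 * (2 * (2 + ln (real (M ^ N)))) \<le> level_weight M n"
        using M by (simp add: level_weight_def ln_realpow)
    qed simp
    finally show ?thesis by (simp add: K_def)
  qed
qed simp

section \<open>Descendants of a cell and the refinement of rows\<close>

definition block :: "nat \<Rightarrow> nat \<Rightarrow> nat \<Rightarrow> nat \<Rightarrow> nat set" where
  "block A k c j = {c * A ^ (j - k)..<(c + 1) * A ^ (j - k)}"

definition outside :: "nat \<Rightarrow> nat \<Rightarrow> nat \<Rightarrow> nat \<Rightarrow> nat set" where
  "outside A n k c = {..<A ^ n} - block A k c n"

text \<open>The value 0 inside the block removes all dependence on the alphabets below c, so that
  resampling them leaves the whole function unchanged.\<close>

definition outer_pos :: "nat \<Rightarrow> nat \<Rightarrow> nat \<Rightarrow> nat \<Rightarrow> nat \<Rightarrow> (nat \<Rightarrow> nat \<Rightarrow> nat set) \<Rightarrow> nat \<Rightarrow> real" where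
  "outer_pos M A n k c w y =
     (if y \<in> outside A n k c then cantor_point M A w n y else 0)"

text \<open>\<open>19\<close> absorbs the constants \<open>12\<close> and \<open>7\<close> of the matrix Chernoff bound at each generation.\<close>

definition level_bound :: "nat \<Rightarrow> nat \<Rightarrow> nat \<Rightarrow> nat \<Rightarrow> nat \<Rightarrow> real" where
  "level_bound M A n p j = 19 ^ j * real (A ^ (j + 2)) * level_weight M n * real p"

text \<open>Up to the factor A^(n-j), the sum is the conditional mean of the Gram matrix with rows
  below c and columns outside c, given the columns and the rows up to generation j. For j = n it is
  that Gram matrix itself.\<close>

definition level_ok :: "nat \<Rightarrow> nat \<Rightarrow> nat \<Rightarrow> real \<Rightarrow> nat \<Rightarrow> nat \<Rightarrow> nat \<Rightarrow> (nat \<Rightarrow> nat \<Rightarrow> nat set) \<Rightarrow> nat \<Rightarrow> bool" where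
  "level_ok M A n \<theta> p k c w j \<longleftrightarrow>
     form_le (outside A n k c)
       (\<Sum>i\<in>block A k c j. smear M n \<theta> (outer_pos M A n k c w) j (cantor_pos M A w j i))
       (level_bound M A n p j)"

definition resample :: "nat \<Rightarrow> nat set \<Rightarrow> (nat \<Rightarrow> nat set) \<Rightarrow> (nat \<Rightarrow> nat \<Rightarrow> nat set) \<Rightarrow> nat \<Rightarrow> nat \<Rightarrow> nat set" where
  "resample j Q \<sigma> w = w(j := \<lambda>i. if i \<in> Q then \<sigma> i else w j i)"

lemma mem_block_iff:
  assumes "A > 0"
  shows "i \<in> block A k c j \<longleftrightarrow> i div A ^ (j - k) = c"
proof -
  have "A ^ (j - k) > 0" using assms by simp
  then have "i \<in> block A k c j \<longleftrightarrow> c \<le> i div A ^ (j - k) \<and> i div A ^ (j - k) < c + 1"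
    unfolding block_def atLeastLessThan_iff by (simp only: less_eq_div_iff_mult_less_eq div_less_iff_less_mult)
  then show ?thesis by auto
qed

lemma block_less: "A > 0 \<Longrightarrow> k \<le> j \<Longrightarrow> c < A ^ k \<Longrightarrow> i \<in> block A k c j \<Longrightarrow> i < A ^ j"
proof -
  assume *: "A > 0" "k \<le> j" "c < A ^ k" "i \<in> block A k c j"
  then have "i < (c + 1) * A ^ (j - k)" by (simp add: block_def)
  also have "\<dots> \<le> A ^ k * A ^ (j - k)" using * by (intro mult_right_mono) auto
  also have "\<dots> = A ^ j" using * by (simp add: power_add[symmetric])
  finally show ?thesis .
qed

lemma sum_block_Suc:
  assumes "A > 0" "k \<le> j"
  shows "(\<Sum>i\<in>block A k c (Suc j). f i) = (\<Sum>q\<in>block A k c j. \<Sum>s<A. f (q * A + s))"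
proof -
  have "(\<Sum>q\<in>block A k c j. \<Sum>s<A. f (q * A + s)) = (\<Sum>(q, s)\<in>block A k c j \<times> {..<A}. f (q * A + s))"
    by (rule sum.cartesian_product)
  also have "\<dots> = (\<Sum>i\<in>block A k c (Suc j). f i)"
  proof (rule sum.reindex_bij_witness[of _ "\<lambda>i. (i div A, i mod A)" "\<lambda>(q, s). q * A + s"])
    fix i assume "i \<in> block A k c (Suc j)"
    then show "(i div A, i mod A) \<in> block A k c j \<times> {..<A}"
      using assms by (simp add: mem_block_iff Suc_diff_le div_mult2_eq)
  next
    fix x assume "x \<in> block A k c j \<times> {..<A}"
    then show "(case x of (q, s) \<Rightarrow> q * A + s) \<in> block A k c (Suc j)"
      using assms by (auto simp: mem_block_iff Suc_diff_le div_mult2_eq)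
  qed (use assms in auto)
  finally show ?thesis by simp
qed

lemma cantor_pos_resample_below: "m \<le> j \<Longrightarrow> cantor_pos M A (resample (Suc j) Q \<sigma> w) m i = cantor_pos M A w m i"
  by (rule cantor_pos_cong) (simp add: resample_def)

text \<open>The source of independence: no ancestor of a point outside c is a descendant of c, so
  fresh alphabets below c do not move the columns.\<close>

lemma outer_pos_resample:
  assumes "A > 0" "k \<le> j" "j < n"
  shows "outer_pos M A n k c (resample (Suc j) (block A k c j) \<sigma> w) = outer_pos M A n k c w"
proof
  fix y
  have "cantor_pos M A (resample (Suc j) (block A k c j) \<sigma> w) n y = cantor_pos M A w n y" if y: "y \<in> outside A n k c"
  proof (rule cantor_pos_cong)
    fix i assume i: "1 \<le> i" "i \<le> n"
    have "y div A ^ (n + 1 - Suc j) \<notin> block A k c j"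
    proof
      assume "y div A ^ (n + 1 - Suc j) \<in> block A k c j"
      then have "y div (A ^ (n - j) * A ^ (j - k)) = c"
        using assms by (simp add: mem_block_iff div_mult2_eq)
      moreover have "A ^ (n - j) * A ^ (j - k) = A ^ (n - k)"
        using assms by (simp add: power_add[symmetric])
      ultimately show False using y assms by (simp add: outside_def mem_block_iff)
    qed
    then show "resample (Suc j) (block A k c j) \<sigma> w i (y div A ^ (n + 1 - i)) = w i (y div A ^ (n + 1 - i))"
      by (simp add: resample_def)
  qed
  then show "outer_pos M A n k c (resample (Suc j) (block A k c j) \<sigma> w) y = outer_pos M A n k c w y"
    by (simp add: outer_pos_def)
qed

lemma sum_digits:
  assumes "X \<in> alphabets M A"
  shows "(\<Sum>s<A. g (sorted_list_of_set X ! s)) = (\<Sum>a\<in>X. g a)"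
proof -
  note X = alphabet_digits[OF assms]
  have "(\<Sum>a\<in>X. g a) = sum_list (map g (sorted_list_of_set X))"
    using X by (simp add: sum_list_distinct_conv_sum_set)
  also have "\<dots> = (\<Sum>s<A. g (sorted_list_of_set X ! s))"
    using assms by (simp add: sum_list_sum_nth lessThan_atLeast0 alphabets_def)
  finally show ?thesis by simp
qed

lemma sum_block_resample:
  assumes "A > 0" "k \<le> j" and \<sigma>: "\<sigma> \<in> block A k c j \<rightarrow>\<^sub>E alphabets M A"
  shows "(\<Sum>i\<in>block A k c (Suc j). f (cantor_pos M A (resample (Suc j) (block A k c j) \<sigma> w) (Suc j) i))
    = (\<Sum>q\<in>block A k c j. \<Sum>a\<in>\<sigma> q. f (M * cantor_pos M A w j q + a))"
  unfolding sum_block_Suc[OF assms(1,2)]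
proof (rule sum.cong[OF refl])
  fix q assume q: "q \<in> block A k c j"
  then have \<sigma>q: "\<sigma> q \<in> alphabets M A" using \<sigma> by auto
  have "(\<Sum>s<A. f (cantor_pos M A (resample (Suc j) (block A k c j) \<sigma> w) (Suc j) (q * A + s)))
      = (\<Sum>s<A. f (M * cantor_pos M A w j q + sorted_list_of_set (\<sigma> q) ! s))"
    using q assms(1) by (intro sum.cong refl) (simp add: cantor_pos_resample_below, simp add: resample_def)
  then show "(\<Sum>s<A. f (cantor_pos M A (resample (Suc j) (block A k c j) \<sigma> w) (Suc j) (q * A + s)))
      = (\<Sum>a\<in>\<sigma> q. f (M * cantor_pos M A w j q + a))"
    unfolding sum_digits[OF \<sigma>q, of "\<lambda>a. f (M * cantor_pos M A w j q + a)"] .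
qed

text \<open>At j = k the block consists of the single cell c, so the deterministic bound for one
  smear starts the recursion without any probability.\<close>

lemma level_ok_base:
  assumes w: "valid_choice M A n w" and M: "M > 0" and A: "A > 0" and k: "k \<le> n"
    and \<theta>: "1 / real M \<le> \<theta>" "\<theta> \<le> 1" and p: "p > 0"
  shows "level_ok M A n \<theta> p k c w k"
proof -
  have "form_le (outside A n k c) (smear M n \<theta> (outer_pos M A n k c w) k (cantor_pos M A w k c))
      (real (A ^ (k + 1)) * level_weight M n)"
    by (rule form_le_smear[OF w M A k \<theta>]) (auto simp: outside_def outer_pos_def)
  moreover have "real (A ^ (k + 1)) * level_weight M n \<le> level_bound M A n p k"
  proof -
    have "real (A ^ (k + 1)) * level_weight M n = (1 * real (A ^ (k + 1))) * level_weight M n * 1" by simp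
    also have "\<dots> \<le> (19 ^ k * real (A ^ (k + 2))) * level_weight M n * real p"
    proof (intro mult_mono)
      have "A ^ (k + 1) \<le> A ^ (k + 2)" using A by (intro power_increasing) auto
      then show "real (A ^ (k + 1)) \<le> real (A ^ (k + 2))" by (simp only: of_nat_le_iff)
    qed (use p level_weight_ge[OF M, of n] in auto)
    finally show ?thesis by (simp only: level_bound_def)
  qed
  ultimately show ?thesis
    unfolding level_ok_def by (simp add: block_def form_le_mono)
qed

text \<open>One Chernoff step, conditional on everything but the alphabets at generation j + 1 of
  the cells in the block. A summand collects the A digits of one cell, each of size A^(j+2) times
  the weight, which gives \<open>R\<close>. The dimension is at most A^n.\<close>

lemma card_resample_bad_le:
  assumes w: "valid_choice M A n w" and A: "A > 0" "A \<le> M" and j: "k \<le> j" "j < n" and c: "c < A ^ k"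
    and \<theta>: "1 / real M \<le> \<theta>" "\<theta> \<le> 1" and p: "p > 0"
  shows "real (card {\<sigma> \<in> block A k c j \<rightarrow>\<^sub>E alphabets M A. level_ok M A n \<theta> p k c w j \<and>
      \<not> level_ok M A n \<theta> p k c (resample (Suc j) (block A k c j) \<sigma> w) (Suc j)})
    \<le> real (card (block A k c j \<rightarrow>\<^sub>E alphabets M A)) * real (A ^ n) * exp (- 2 * real p)"
proof (cases "level_ok M A n \<theta> p k c w j")
  case True
  define V where "V = outside A n k c"
  define Q where "Q = block A k c j"
  define b where "b = outer_pos M A n k c w"
  define W where "W q X = (\<Sum>a\<in>X. smear M n \<theta> b (Suc j) (M * cantor_pos M A w j q + a))" for q X
  define R where "R = real (A ^ (j + 3)) * level_weight M n"
  define m where "m = real A * level_bound M A n p j"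
  have M: "M > 0" using A by simp
  have fin: "finite V" and sub: "V \<subseteq> {..<A ^ n}" by (auto simp: V_def outside_def)
  have weight: "level_weight M n \<ge> 32" by (rule level_weight_ge[OF M])
  interpret random_psd_sum V Q "alphabets M A" W R m
  proof
    show "finite V" by (rule fin)
    show "finite Q" by (simp add: Q_def block_def)
    show "finite (alphabets M A)" "alphabets M A \<noteq> {}" using A by (simp_all add: finite_alphabets alphabets_nonempty)
    show "psd V (W q X)" for q X unfolding W_def by (intro psd_sum psd_smear fin)
    show "form_le V (W q X) R" if "X \<in> alphabets M A" for q X
    proof -
      have "form_le V (W q X) (\<Sum>a\<in>X. real (A ^ (Suc j + 1)) * level_weight M n)"
        unfolding W_def using j sub
        by (intro form_le_sum form_le_smear[OF w M A(1) _ \<theta>]) (auto simp: b_def V_def outer_pos_def)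
      moreover have "(\<Sum>a\<in>X. real (A ^ (Suc j + 1)) * level_weight M n) = R"
        using that by (simp add: alphabets_def R_def power_add eval_nat_numeral)
      ultimately show ?thesis by simp
    qed
    \<comment> \<open>A digit is chosen with probability A/M, and summing over all M digits gives M
      times the parent's smear: the factors M cancel.\<close>
    have "(1 / real (card (alphabets M A))) *\<^sub>R (\<Sum>X\<in>alphabets M A. W q X)
        = real A *\<^sub>R smear M n \<theta> b j (cantor_pos M A w j q)" for q
      unfolding W_def sum_over_alphabets[OF A] sum_smear_Suc[OF j(2) M] using M by simp
    then have "(\<Sum>q\<in>Q. (1 / real (card (alphabets M A))) *\<^sub>R (\<Sum>X\<in>alphabets M A. W q X))
        = real A *\<^sub>R (\<Sum>q\<in>Q. smear M n \<theta> b j (cantor_pos M A w j q))"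
      by (simp add: scaleR_sum_right)
    then show "form_le V (\<Sum>q\<in>Q. (1 / real (card (alphabets M A))) *\<^sub>R (\<Sum>X\<in>alphabets M A. W q X)) m"
      using True unfolding level_ok_def m_def V_def Q_def b_def by (simp add: form_le_scaleR)
    show "R > 0" using A weight by (simp add: R_def)
    show "m \<ge> 0" using weight by (simp add: m_def level_bound_def)
  qed
  \<comment> \<open>The mean already carries one factor p from the previous step, and the new
    summand bound is multiplied by p once. Hence p does not accumulate over generations; only the
    constant 19 does.\<close>
  have bound: "12 * R * real p + 7 * m \<le> level_bound M A n p (Suc j)"
  proof -
    let ?x = "real (A ^ (j + 3)) * level_weight M n * real p"
    have x: "?x \<ge> 0" using weight by simp
    have "12 * R * real p + 7 * m = (12 + 7 * 19 ^ j) * ?x"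
      by (simp add: R_def m_def level_bound_def algebra_simps power_add eval_nat_numeral)
    also have "\<dots> \<le> 19 ^ Suc j * ?x"
    proof (intro mult_right_mono x)
      have "(1::real) \<le> 19 ^ j" by simp
      then show "12 + 7 * 19 ^ j \<le> (19::real) ^ Suc j" by simp
    qed
    also have "\<dots> = level_bound M A n p (Suc j)" by (simp add: level_bound_def eval_nat_numeral)
    finally show ?thesis .
  qed
  let ?L = "{\<sigma> \<in> samples. level_ok M A n \<theta> p k c w j \<and> \<not> level_ok M A n \<theta> p k c (resample (Suc j) Q \<sigma> w) (Suc j)}"
  let ?F = "{\<sigma> \<in> samples. \<not> form_le V (\<Sum>q\<in>Q. W q (\<sigma> q)) (12 * R * real p + 7 * m)}"
  have "?L
      \<subseteq> ?F"
  proof safe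
    fix \<sigma> assume \<sigma>: "\<sigma> \<in> samples" and le: "form_le V (\<Sum>q\<in>Q. W q (\<sigma> q)) (12 * R * real p + 7 * m)"
      and bad: "\<not> level_ok M A n \<theta> p k c (resample (Suc j) Q \<sigma> w) (Suc j)"
    have "(\<Sum>i\<in>block A k c (Suc j). smear M n \<theta> (outer_pos M A n k c (resample (Suc j) Q \<sigma> w)) (Suc j)
        (cantor_pos M A (resample (Suc j) Q \<sigma> w) (Suc j) i)) = (\<Sum>q\<in>Q. W q (\<sigma> q))"
      unfolding Q_def outer_pos_resample[OF A(1) j] b_def[symmetric] W_def
      by (rule sum_block_resample[OF A(1) j(1) \<sigma>[unfolded Q_def]])
    then show False
      using bad form_le_mono[OF le bound] by (simp add: level_ok_def V_def)
  qed
  then have "real (card ?L)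
      \<le> real (card ?F)"
    using Q S by (auto intro!: card_mono finite_subset[OF Collect_subset] finite_PiE)
  also have "\<dots> \<le> real (card samples) * real (card V) * exp (- 2 * real p)"
    by (rule card_not_form_le[OF p])
  also have "\<dots> \<le> real (card samples) * real (A ^ n) * exp (- 2 * real p)"
    using card_mono[OF _ sub] by (intro mult_right_mono mult_left_mono) auto
  finally show ?thesis unfolding Q_def .
qed simp

section \<open>The discrete Fourier bound\<close>

text \<open>With \<theta> = 1 / (h M^n) this is exp (-i b_x b_y / h). Keeping the row as an integer
  moves its scale into \<theta>, which then ranges over the fixed interval [1/M, 1].\<close>

definition dft_entry :: "nat \<Rightarrow> nat \<Rightarrow> nat \<Rightarrow> real \<Rightarrow> (nat \<Rightarrow> nat \<Rightarrow> nat set) \<Rightarrow> nat \<Rightarrow> nat \<Rightarrow> complex" where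
  "dft_entry M A n \<theta> w x y = cis (- (\<theta> * real (cantor_pos M A w n x) * (cantor_point M A w n y)))"

text \<open>The parameter \<open>\<theta> = i / M\<^bsup>2n\<^esup>\<close> runs over a net: moving \<open>\<theta>\<close> by \<open>M\<^bsup>-2n\<^esup>\<close> changes the matrix by at most \<open>1\<close> in norm.\<close>

definition bad_level :: "nat \<Rightarrow> nat \<Rightarrow> nat \<Rightarrow> nat \<Rightarrow> (nat \<Rightarrow> nat \<Rightarrow> nat set) \<Rightarrow> nat \<times> nat \<times> nat \<times> nat \<Rightarrow> bool" where
  "bad_level M A n p w = (\<lambda>(i, k, c, j). let \<theta> = real i / real (M ^ (2 * n)) in
     level_ok M A n \<theta> p k c w j \<and> \<not> level_ok M A n \<theta> p k c w (Suc j))"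

text \<open>A net point i, a cell c of generation k, and the refinement from generation j to j + 1.
  The lower limit on i is \<theta> >= 1/M.\<close>

definition level_indices :: "nat \<Rightarrow> nat \<Rightarrow> nat \<Rightarrow> (nat \<times> nat \<times> nat \<times> nat) set" where
  "level_indices M A n = {(i, k, c, j). M ^ (2 * n - 1) \<le> i \<and> i \<le> M ^ (2 * n) \<and> k \<le> j \<and> j < n \<and> c < A ^ k}"

lemma net_point_bounds:
  assumes "M > 0" "n > 0" "M ^ (2 * n - 1) \<le> i" "i \<le> M ^ (2 * n)"
  shows "1 / real M \<le> real i / real (M ^ (2 * n))" "real i / real (M ^ (2 * n)) \<le> 1"
proof -
  have "M ^ (2 * n) = M ^ (2 * n - 1) * M"
    using assms by (metis power_minus_mult mult_pos_pos zero_less_numeral)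
  then have "1 / real M = real (M ^ (2 * n - 1)) / real (M ^ (2 * n))" using assms by simp
  also have "\<dots> \<le> real i / real (M ^ (2 * n))" using assms by (intro divide_right_mono) auto
  finally show "1 / real M \<le> real i / real (M ^ (2 * n))" .
  have "real i \<le> real (M ^ (2 * n))" using assms by (simp only: of_nat_le_iff)
  then show "real i / real (M ^ (2 * n)) \<le> 1" using assms by simp
qed

lemma level_ok_if_no_bad_level:
  assumes w: "valid_choice M A n w" and M: "M > 0" and A: "A > 0" and n: "n > 0" and p: "p > 0"
    and good: "\<forall>I\<in>level_indices M A n. \<not> bad_level M A n p w I"
    and i: "M ^ (2 * n - 1) \<le> i" "i \<le> M ^ (2 * n)" and c: "c < A ^ k" and j: "k \<le> j" "j \<le> n"
  shows "level_ok M A n (real i / real (M ^ (2 * n))) p k c w j"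
proof -
  note \<theta> = net_point_bounds[OF M n i]
  show ?thesis
    using j
  proof (induction j rule: dec_induct)
    case base
    then show ?case using w M A \<theta> p by (intro level_ok_base) auto
  next
    case (step j)
    then show ?case
      using good i c by (auto simp: level_indices_def bad_level_def Let_def)
  qed
qed

lemma block_outside_sum_le:
  assumes ok: "level_ok M A n \<theta> p k c w n" and V: "V \<subseteq> outside A n k c"
  shows "(\<Sum>x\<in>block A k c n. (cmod (\<Sum>y\<in>V. dft_entry M A n \<theta> w x y * u y))\<^sup>2)
    \<le> level_bound M A n p n * (\<Sum>y\<in>V. (cmod (u y))\<^sup>2)"
proof -
  let ?V = "outside A n k c"
  let ?u = "\<lambda>y. if y \<in> V then u y else 0"
  have fin: "finite ?V" by (simp add: outside_def)
  have "form_le ?V (\<Sum>x\<in>block A k c n. phase_mat (\<lambda>y. \<theta> * real (cantor_pos M A w n x) * outer_pos M A n k c w y))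
      (level_bound M A n p n)"
    using ok by (simp add: level_ok_def smear_def)
  from form_le_phase_sum_imp[OF fin this, of ?u]
  have "(\<Sum>x\<in>block A k c n. (cmod (\<Sum>y\<in>?V. cis (- (\<theta> * real (cantor_pos M A w n x) * outer_pos M A n k c w y)) * ?u y))\<^sup>2)
      \<le> level_bound M A n p n * (\<Sum>y\<in>?V. (cmod (?u y))\<^sup>2)" .
  moreover have "(\<Sum>y\<in>?V. cis (- (\<theta> * real (cantor_pos M A w n x) * outer_pos M A n k c w y)) * ?u y)
      = (\<Sum>y\<in>V. dft_entry M A n \<theta> w x y * u y)" for x
    using V fin by (intro sum.mono_neutral_cong_right) (auto simp: dft_entry_def outer_pos_def)
  moreover have "(\<Sum>y\<in>?V. (cmod (?u y))\<^sup>2) = (\<Sum>y\<in>V. (cmod (u y))\<^sup>2)"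
    using V fin by (intro sum.mono_neutral_cong_right) auto
  ultimately show ?thesis by simp
qed

lemma sum_blocks:
  assumes "A > 0" "k \<le> n"
  shows "(\<Sum>c<A ^ k. \<Sum>x\<in>block A k c n. f x) = (\<Sum>x<A ^ n. f x)"
proof -
  have "(\<Sum>c<A ^ k. \<Sum>x\<in>block A k c n. f x) = (\<Sum>x<A ^ k * A ^ (n - k). f x)"
    unfolding block_def by (simp add: sum.nat_group[symmetric] add.commute)
  then show ?thesis using assms by (simp add: power_add[symmetric])
qed

text \<open>The entries are grouped by the generation \<open>k\<close> at which \<open>x\<close> and \<open>y\<close> separate. For fixed \<open>k\<close> the matrix is
  block diagonal with respect to the cells of generation \<open>k - 1\<close>, and each diagonal block consists of \<open>A\<close> strips.\<close>

lemma dft_bound_at_net_point: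
  assumes A: "A > 0" and \<Lambda>: "real A * level_bound M A n p n \<ge> 1"
    and ok: "\<And>k c. 1 \<le> k \<Longrightarrow> k \<le> n \<Longrightarrow> c < A ^ k \<Longrightarrow> level_ok M A n \<theta> p k c w n"
  shows "(\<Sum>x<A ^ n. (cmod (\<Sum>y<A ^ n. dft_entry M A n \<theta> w x y * u y))\<^sup>2)
    \<le> (real n + 1)\<^sup>2 * (real A * level_bound M A n p n) * (\<Sum>y<A ^ n. (cmod (u y))\<^sup>2)"
proof -
  let ?e = "dft_entry M A n \<theta> w" and ?\<Lambda> = "level_bound M A n p n"
  let ?U = "\<Sum>y<A ^ n. (cmod (u y))\<^sup>2"
  \<comment> \<open>For k > 0 these are the columns sharing with x the cell of generation k - 1 but
    not that of generation k; k = 0 is reserved for the diagonal entry.\<close>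
  define V where "V k x = (if k = 0 then {x} else block A (k - 1) (x div A ^ (n - (k - 1))) n \<inter> outside A n k (x div A ^ (n - k)))" for k x
  define S where "S k x = (\<Sum>y\<in>V k x. ?e x y * u y)" for k x
  have fin: "finite (V k x)" for k x by (simp add: V_def outside_def)
  have blk: "y \<in> block A m (x div A ^ (n - m)) n \<longleftrightarrow> y div A ^ (n - m) = x div A ^ (n - m)" for x y m
    by (rule mem_block_iff[OF A])
  have partition: "(\<Sum>y<A ^ n. ?e x y * u y) = (\<Sum>k\<le>n. S k x)" if x: "x < A ^ n" for x
  proof -
    have "m \<le> n \<Longrightarrow> (\<Sum>k\<le>m. S k x) = ?e x x * u x + (\<Sum>y\<in>{..<A ^ n} - block A m (x div A ^ (n - m)) n. ?e x y * u y)" for m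
    proof (induction m)
      case 0
      have "x div A ^ n = 0" using x by simp
      then have e: "{..<A ^ n} - block A 0 (x div A ^ (n - 0)) n = {}" by (auto simp: block_def)
      show ?case unfolding e by (simp add: S_def V_def)
    next
      case (Suc m)
      let ?B = "\<lambda>m. block A m (x div A ^ (n - m)) n"
      have nested: "?B (Suc m) \<subseteq> ?B m"
      proof
        fix y assume "y \<in> ?B (Suc m)"
        then have "y div A ^ (n - Suc m) div A = x div A ^ (n - Suc m) div A" by (simp add: blk)
        moreover have "A ^ (n - m) = A ^ (n - Suc m) * A"
          using Suc.prems by (metis Suc_diff_le Suc_le_lessD diff_Suc_Suc power_Suc2)
        ultimately have "y div A ^ (n - m) = x div A ^ (n - m)" by (simp only: div_mult2_eq)
        then show "y \<in> ?B m" by (simp only: blk)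
      qed
      have "V (Suc m) x = ?B m \<inter> ({..<A ^ n} - ?B (Suc m))" by (simp add: V_def outside_def)
      then have "{..<A ^ n} - ?B (Suc m) = ({..<A ^ n} - ?B m) \<union> V (Suc m) x" "({..<A ^ n} - ?B m) \<inter> V (Suc m) x = {}"
        using nested by auto
      then have "(\<Sum>y\<in>{..<A ^ n} - ?B (Suc m). ?e x y * u y) = (\<Sum>y\<in>{..<A ^ n} - ?B m. ?e x y * u y) + S (Suc m) x"
        unfolding S_def by (simp only:) (rule sum.union_disjoint, use fin in auto)
      then show ?case using Suc by simp
    qed
    from this[of n] have "(\<Sum>k\<le>n. S k x) = ?e x x * u x + (\<Sum>y\<in>{..<A ^ n} - {x}. ?e x y * u y)"
      by (simp add: block_def)
    also have "\<dots> = (\<Sum>y<A ^ n. ?e x y * u y)"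
      using x by (subst (2) sum.remove[of _ x]) auto
    finally show ?thesis by simp
  qed
  have U0: "?U \<ge> 0" by (intro sum_nonneg) auto
  have strip: "(\<Sum>x<A ^ n. (cmod (S k x))\<^sup>2) \<le> real A * ?\<Lambda> * ?U" if k: "k \<le> n" for k
  proof (cases "k = 0")
    case True
    have "cmod (S k x) = cmod (u x)" for x
      using True by (simp add: S_def V_def norm_mult dft_entry_def)
    then have "(\<Sum>x<A ^ n. (cmod (S k x))\<^sup>2) = 1 * ?U" by simp
    also have "\<dots> \<le> real A * ?\<Lambda> * ?U" by (intro mult_right_mono \<Lambda> U0)
    finally show ?thesis .
  next
    case False
    then obtain m where m: "k = Suc m" by (cases k) auto
    have pow: "A ^ (n - m) = A ^ (n - k) * A"
      using k m by (metis Suc_diff_le Suc_le_lessD diff_Suc_Suc power_Suc2)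
    let ?W = "\<lambda>c. block A m (c div A) n \<inter> outside A n k c"
    have VW: "V k x = ?W c" if "x \<in> block A k c n" for x c
      using that A by (simp add: V_def m[symmetric] mem_block_iff) (simp add: m pow[unfolded m] div_mult2_eq)
    have "(\<Sum>x<A ^ n. (cmod (S k x))\<^sup>2) = (\<Sum>c<A ^ k. \<Sum>x\<in>block A k c n. (cmod (S k x))\<^sup>2)"
      by (rule sum_blocks[OF A k, symmetric])
    also have "\<dots> = (\<Sum>c<A ^ k. \<Sum>x\<in>block A k c n. (cmod (\<Sum>y\<in>?W c. ?e x y * u y))\<^sup>2)"
      unfolding S_def by (intro sum.cong refl) (simp add: VW)
    also have "\<dots> \<le> (\<Sum>c<A ^ k. ?\<Lambda> * (\<Sum>y\<in>?W c. (cmod (u y))\<^sup>2))"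
      using False k by (intro sum_mono block_outside_sum_le ok) auto
    also have "\<dots> \<le> (\<Sum>c<A ^ k. ?\<Lambda> * (\<Sum>y\<in>block A m (c div A) n. (cmod (u y))\<^sup>2))"
    proof (intro sum_mono mult_left_mono sum_mono2)
      show "?\<Lambda> \<ge> 0" using \<Lambda> A by (meson less_le_trans mult_pos_pos not_less of_nat_0_less_iff zero_less_mult_pos zero_less_one less_imp_le)
    qed (auto simp: block_def)
    also have "\<dots> = ?\<Lambda> * (\<Sum>c<A ^ m * A. \<Sum>y\<in>block A m (c div A) n. (cmod (u y))\<^sup>2)"
      by (simp add: sum_distrib_left m mult.commute)
    also have "(\<Sum>c<A ^ m * A. \<Sum>y\<in>block A m (c div A) n. (cmod (u y))\<^sup>2)
        = (\<Sum>d<A ^ m. \<Sum>c\<in>{d * A..<d * A + A}. \<Sum>y\<in>block A m (c div A) n. (cmod (u y))\<^sup>2)"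
      by (rule sum.nat_group[symmetric])
    also have "\<dots> = (\<Sum>d<A ^ m. real A * (\<Sum>y\<in>block A m d n. (cmod (u y))\<^sup>2))"
    proof (rule sum.cong[OF refl])
      fix d
      have "c div A = d" if "c \<in> {d * A..<d * A + A}" for c
        using that by (intro div_nat_eqI) (auto simp: algebra_simps)
      then have "(\<Sum>c\<in>{d * A..<d * A + A}. \<Sum>y\<in>block A m (c div A) n. (cmod (u y))\<^sup>2)
          = (\<Sum>c\<in>{d * A..<d * A + A}. \<Sum>y\<in>block A m d n. (cmod (u y))\<^sup>2)"
        by (intro sum.cong) auto
      then show "(\<Sum>c\<in>{d * A..<d * A + A}. \<Sum>y\<in>block A m (c div A) n. (cmod (u y))\<^sup>2) = real A * (\<Sum>y\<in>block A m d n. (cmod (u y))\<^sup>2)"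
        by (simp only: sum_constant card_atLeastLessThan) simp
    qed
    also have "\<dots> = real A * ?U"
      using sum_blocks[OF A, of m n "\<lambda>y. (cmod (u y))\<^sup>2"] k m by (simp add: sum_distrib_left[symmetric])
    finally show ?thesis by (simp add: ac_simps)
  qed
  \<comment> \<open>Cauchy-Schwarz over the n + 1 separation classes gives one factor n + 1; summing
    their bounds gives the other.\<close>
  have "(\<Sum>x<A ^ n. (cmod (\<Sum>y<A ^ n. ?e x y * u y))\<^sup>2) \<le> (\<Sum>x<A ^ n. (real n + 1) * (\<Sum>k\<le>n. (cmod (S k x))\<^sup>2))"
  proof (intro sum_mono)
    fix x assume "x \<in> {..<A ^ n}"
    then have "cmod (\<Sum>y<A ^ n. ?e x y * u y) \<le> (\<Sum>k\<le>n. 1 * cmod (S k x))"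
      using partition[of x] by (simp add: norm_sum)
    then have "(cmod (\<Sum>y<A ^ n. ?e x y * u y))\<^sup>2 \<le> (\<Sum>k\<le>n. 1 * cmod (S k x))\<^sup>2"
      by (intro power_mono) auto
    also have "\<dots> \<le> (\<Sum>k\<le>n. 1\<^sup>2) * (\<Sum>k\<le>n. (cmod (S k x))\<^sup>2)" by (rule Cauchy_Schwarz_ineq_sum)
    finally show "(cmod (\<Sum>y<A ^ n. ?e x y * u y))\<^sup>2 \<le> (real n + 1) * (\<Sum>k\<le>n. (cmod (S k x))\<^sup>2)"
      by (simp add: add.commute)
  qed
  also have "\<dots> = (real n + 1) * (\<Sum>k\<le>n. \<Sum>x<A ^ n. (cmod (S k x))\<^sup>2)"
    by (subst sum.swap) (rule sum_distrib_left[symmetric])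
  also have "\<dots> \<le> (real n + 1) * (\<Sum>k\<le>n. real A * ?\<Lambda> * ?U)"
    by (intro mult_left_mono sum_mono strip) auto
  also have "\<dots> = (real n + 1)\<^sup>2 * (real A * ?\<Lambda>) * ?U" by (simp add: power2_eq_square algebra_simps)
  finally show ?thesis .
qed

text \<open>Rounding \<theta> down to the net moves every entry by at most M^(-n), so the
  perturbation has Hilbert-Schmidt norm at most (A/M)^n <= 1. The factor 4 comes from splitting a
  square into two and from bounding the error by the main term.\<close>

theorem dft_bound:
  assumes w: "valid_choice M A n w" and A: "A > 0" "A \<le> M" and n: "n > 0" and p: "p > 0"
    and good: "\<forall>I\<in>level_indices M A n. \<not> bad_level M A n p w I"
    and \<theta>: "1 / real M \<le> \<theta>" "\<theta> \<le> 1"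
  shows "(\<Sum>x<A ^ n. (cmod (\<Sum>y<A ^ n. dft_entry M A n \<theta> w x y * u y))\<^sup>2)
    \<le> 4 * (real n + 1)\<^sup>2 * (real A * level_bound M A n p n) * (\<Sum>y<A ^ n. (cmod (u y))\<^sup>2)"
proof -
  let ?U = "\<Sum>y<A ^ n. (cmod (u y))\<^sup>2" and ?K = "(real n + 1)\<^sup>2 * (real A * level_bound M A n p n)"
  have M: "M > 0" using A by simp
  define i where "i = nat \<lfloor>\<theta> * real (M ^ (2 * n))\<rfloor>"
  define \<theta>' where "\<theta>' = real i / real (M ^ (2 * n))"
  have "M ^ (2 * n) = M ^ (2 * n - 1) * M"
    using n by (metis power_minus_mult mult_pos_pos zero_less_numeral)
  then have "real (M ^ (2 * n - 1)) = 1 / real M * real (M ^ (2 * n))" using M by simp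
  also have "\<dots> \<le> \<theta> * real (M ^ (2 * n))" using \<theta> by (intro mult_right_mono) auto
  finally have lo: "real (M ^ (2 * n - 1)) \<le> \<theta> * real (M ^ (2 * n))" .
  have hi: "\<theta> * real (M ^ (2 * n)) \<le> real (M ^ (2 * n))" using mult_right_mono[OF \<theta>(2), of "real (M ^ (2 * n))"] by simp
  have i: "M ^ (2 * n - 1) \<le> i" "i \<le> M ^ (2 * n)"
    using lo hi unfolding i_def by (simp_all only: nat_le_iff le_nat_iff le_floor_iff) linarith+
  have i': "\<bar>\<theta> * real (M ^ (2 * n)) - real i\<bar> \<le> 1"
  proof -
    have "0 \<le> \<theta> * real (M ^ (2 * n))" using lo by (meson of_nat_0_le_iff order_trans)
    then have "real i = of_int \<lfloor>\<theta> * real (M ^ (2 * n))\<rfloor>" unfolding i_def by (subst of_nat_nat) auto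
    then show ?thesis by linarith
  qed
  have net: "\<bar>\<theta> - \<theta>'\<bar> \<le> 1 / real (M ^ (2 * n))"
  proof -
    have "\<theta> - \<theta>' = (\<theta> * real (M ^ (2 * n)) - real i) / real (M ^ (2 * n))"
      using M by (simp add: \<theta>'_def field_simps)
    then show ?thesis using i' M by (simp add: abs_div divide_right_mono)
  qed
  have K1: "real A * level_bound M A n p n \<ge> 1"
  proof -
    have "1 * (1 * 1 * 1 * 1) \<le> real A * level_bound M A n p n"
      unfolding level_bound_def
    proof (intro mult_mono)
      show "1 \<le> level_weight M n" using level_weight_ge[OF M, of n] by simp
      have "1 \<le> A ^ (n + 2)" using A by simp
      then show "1 \<le> real (A ^ (n + 2))" by (simp only: real_of_nat_ge_one_iff)
    qed (use A p level_weight_ge[OF M, of n] in auto)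
    then show ?thesis by simp
  qed
  let ?e = "dft_entry M A n \<theta> w" and ?e' = "dft_entry M A n \<theta>' w"
  let ?d = "\<lambda>x y. ?e x y - ?e' x y"
  let ?s = "\<lambda>e x. \<Sum>y<A ^ n. e x y * u y"
  let ?S = "\<lambda>e. \<Sum>x<A ^ n. (cmod (?s e x))\<^sup>2"
  have main: "?S ?e' \<le> ?K * ?U"
    using A K1 unfolding \<theta>'_def
    by (intro dft_bound_at_net_point level_ok_if_no_bad_level[OF w M A(1) n p good i]) auto
  have cis_diff: "cmod (cis a - cis b) \<le> \<bar>a - b\<bar>" for a b
  proof -
    have "cis a - cis b = cis b * (cis (a - b) - 1)" by (simp add: right_diff_distrib cis_mult)
    then have "cmod (cis a - cis b) = cmod (iexp (a - b) - 1)" by (simp add: norm_mult cis_conv_exp)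
    then show ?thesis using iexp_approx1[of "a - b" 0] by simp
  qed
  have entry: "cmod (?e x y - ?e' x y) \<le> 1 / real (M ^ n)" if "x < A ^ n" "y < A ^ n" for x y
  proof -
    let ?x = "real (cantor_pos M A w n x)" and ?y = "cantor_point M A w n y"
    have x: "?x \<le> real (M ^ n)" using cantor_pos_less[OF w that(1)] by (simp only: of_nat_le_iff less_imp_le)
    have "real (cantor_pos M A w n y) \<le> real (M ^ n)" using cantor_pos_less[OF w that(2)] by (simp only: of_nat_le_iff less_imp_le)
    then have y: "?y \<le> 1" using M by simp
    have "cmod (?e x y - ?e' x y) \<le> \<bar>- (\<theta> * ?x * ?y) - - (\<theta>' * ?x * ?y)\<bar>"
      unfolding dft_entry_def by (rule cis_diff)
    also have "- (\<theta> * ?x * ?y) - - (\<theta>' * ?x * ?y) = - ((\<theta> - \<theta>') * (?x * ?y))"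
      by (simp only: left_diff_distrib mult.assoc minus_diff_eq minus_diff_minus diff_minus_eq_add)
    also have "\<bar>\<dots>\<bar> = \<bar>\<theta> - \<theta>'\<bar> * (?x * ?y)" by (simp add: abs_mult)
    also have "\<dots> \<le> 1 / real (M ^ (2 * n)) * (real (M ^ n) * 1)"
      using net x y by (intro mult_mono) auto
    also have "\<dots> = 1 / real (M ^ n)" using M by (simp add: mult_2 power_add)
    finally show ?thesis .
  qed
  have err: "?S ?d \<le> ?U"
  proof -
    have "(cmod (?s ?d x))\<^sup>2 \<le> real (A ^ n) * (1 / real (M ^ n))\<^sup>2 * ?U" if x: "x < A ^ n" for x
    proof -
      have "cmod (?s ?d x) \<le> (\<Sum>y<A ^ n. 1 / real (M ^ n) * cmod (u y))"
        using entry[OF x] 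
        by (intro sum_norm_le) (simp only: norm_mult lessThan_iff mult_right_mono norm_ge_zero)
      then have "(cmod (?s ?d x))\<^sup>2 \<le> (\<Sum>y<A ^ n. 1 / real (M ^ n) * cmod (u y))\<^sup>2"
        by (intro power_mono) auto
      also have "\<dots> \<le> (\<Sum>y<A ^ n. (1 / real (M ^ n))\<^sup>2) * ?U" by (rule Cauchy_Schwarz_ineq_sum)
      finally show ?thesis by simp
    qed
    then have "?S ?d
        \<le> (\<Sum>x<A ^ n. real (A ^ n) * (1 / real (M ^ n))\<^sup>2 * ?U)"
      by (intro sum_mono) auto
    also have "\<dots> = (real (A ^ n) / real (M ^ n))\<^sup>2 * ?U" by (simp add: power2_eq_square)
    also have "\<dots> \<le> 1 * ?U"
    proof (intro mult_right_mono)
      have "real (A ^ n) \<le> real (M ^ n)" using A by (simp add: power_mono)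
      then show "(real (A ^ n) / real (M ^ n))\<^sup>2 \<le> 1" using M by (intro power_le_one) auto
    qed (auto intro: sum_nonneg)
    finally show ?thesis by simp
  qed
  have "?S ?e
      \<le> (\<Sum>x<A ^ n. 2 * (cmod (?s ?e' x))\<^sup>2 + 2 * (cmod (?s ?d x))\<^sup>2)"
  proof (intro sum_mono)
    fix x
    have "?s ?e x = ?s ?e' x + ?s ?d x"
      by (simp add: sum.distrib[symmetric] algebra_simps)
    then have "cmod (?s ?e x) \<le> cmod (?s ?e' x) + cmod (?s ?d x)"
      by (simp add: norm_triangle_ineq)
    then have "(cmod (?s ?e x))\<^sup>2 \<le> (cmod (?s ?e' x) + cmod (?s ?d x))\<^sup>2"
      by (intro power_mono) auto
    also have "\<dots> \<le> 2 * (cmod (?s ?e' x))\<^sup>2 + 2 * (cmod (?s ?d x))\<^sup>2"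
      by (smt (verit) power2_sum sum_squares_bound)
    finally show "(cmod (?s ?e x))\<^sup>2
        \<le> 2 * (cmod (?s ?e' x))\<^sup>2 + 2 * (cmod (?s ?d x))\<^sup>2" .
  qed
  also have "\<dots> \<le> 2 * (?K * ?U) + 2 * ?U"
    using main err by (simp add: sum.distrib sum_distrib_left[symmetric])
  also have "\<dots> \<le> 2 * (?K * ?U) + 2 * (?K * ?U)"
  proof -
    have "1 * 1 \<le> ?K" using K1 by (intro mult_mono one_le_power) auto
    then have "1 * ?U \<le> ?K * ?U" by (intro mult_right_mono) (auto intro: sum_nonneg)
    then show ?thesis by linarith
  qed
  also have "\<dots> = 4 * ?K * ?U" by simp
  finally show ?thesis by (simp only: mult.assoc)
qed

section \<open>From the discrete bound to the operator norm\<close>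

definition sq_norm :: "(real \<Rightarrow> complex) \<Rightarrow> ennreal" where
  "sq_norm u = (\<integral>\<^sup>+ x. ennreal ((cmod (u x))\<^sup>2) \<partial>lborel)"

lemma L2_norm_eq: "L2_norm u = (if sq_norm u = \<infinity> then \<infinity> else ennreal (sqrt (enn2real (sq_norm u))))"
  by (simp add: L2_norm_def sq_norm_def)

lemma L2_norm_square: "(L2_norm u)\<^sup>2 = sq_norm u"
  by (cases "sq_norm u") (auto simp: L2_norm_eq ennreal_power)

lemma sq_norm_finite: "u \<in> L2 \<Longrightarrow> sq_norm u < \<infinity>"
  by (auto simp: L2_def L2_norm_eq top.not_eq_extremum split: if_splits)

lemma L2_measurable: "u \<in> L2 \<Longrightarrow> u \<in> borel_measurable borel"
  by (simp add: L2_def)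

lemma L2_norm_le_of_sq_norm_le: "sq_norm u \<le> ennreal (c\<^sup>2) \<Longrightarrow> c \<ge> 0 \<Longrightarrow> L2_norm u \<le> ennreal c"
  by (cases "sq_norm u") (auto simp: L2_norm_eq top_unique real_le_lsqrt intro!: ennreal_leI)

text \<open>On a bounded interval |u| <= 1 + |u|^2 is integrable, so the Fourier integral of a
  cut-off function converges absolutely.\<close>

lemma integrable_of_L2_bounded_support:
  assumes u: "u \<in> borel_measurable borel" "sq_norm u < \<infinity>" and supp: "\<And>x. x \<notin> {a..b} \<Longrightarrow> u x = 0"
  shows "integrable lborel u"
proof (rule integrableI_bounded)
  show "u \<in> borel_measurable lborel" using u by simp
  have "(\<integral>\<^sup>+ x. ennreal (cmod (u x)) \<partial>lborel) \<le> (\<integral>\<^sup>+ x. indicator {a..b} x + ennreal ((cmod (u x))\<^sup>2) \<partial>lborel)"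
  proof (rule nn_integral_mono)
    fix x
    have "cmod (u x) \<le> 1 + (cmod (u x))\<^sup>2" using sum_squares_bound[of 1 "cmod (u x)"] norm_ge_zero[of "u x"]
      unfolding power_one by linarith
    then have "ennreal (cmod (u x)) \<le> 1 + ennreal ((cmod (u x))\<^sup>2)"
      by (simp add: ennreal_1[symmetric] ennreal_plus[symmetric] ennreal_leI del: ennreal_1 ennreal_plus)
    then show "ennreal (cmod (u x)) \<le> indicator {a..b} x + ennreal ((cmod (u x))\<^sup>2)"
      using supp[of x] by (cases "x \<in> {a..b}") auto
  qed
  also have "\<dots> = emeasure lborel {a..b} + sq_norm u"
    using u by (subst nn_integral_add) (auto simp: sq_norm_def)
  also have "\<dots> < \<infinity>" using u by (simp add: emeasure_lborel_Icc_eq)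
  finally show "(\<integral>\<^sup>+ x. ennreal (cmod (u x)) \<partial>lborel) < \<infinity>" .
qed

lemma ennreal_power2_le_imp_le: "x\<^sup>2 \<le> y\<^sup>2 \<Longrightarrow> x \<le> y" for x y :: ennreal
proof (cases y)
  case (real b)
  assume le: "x\<^sup>2 \<le> y\<^sup>2"
  show ?thesis
  proof (cases x)
    case (real a)
    then have "a\<^sup>2 \<le> b\<^sup>2" using le \<open>y = ennreal b\<close> \<open>0 \<le> b\<close> by (simp add: ennreal_power)
    then have "a \<le> b" using \<open>0 \<le> b\<close> by (rule power2_le_imp_le)
    then show ?thesis using real \<open>y = ennreal b\<close> by (simp add: ennreal_leI)
  next
    case top
    then show ?thesis using le real by (simp add: ennreal_power top_unique)
  qed
qed simp

lemma norm_integral_mult_le: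
  assumes [measurable]: "f \<in> borel_measurable borel" "g \<in> borel_measurable borel"
  shows "ennreal (cmod (\<integral>x. f x * g x \<partial>lborel)) \<le> L2_norm f * L2_norm g"
proof -
  \<comment> \<open>If the product is not integrable, its Bochner integral is 0 and the bound is
    trivial.\<close>
  have "ennreal (cmod (\<integral>x. f x * g x \<partial>lborel)) \<le> (\<integral>\<^sup>+ x. ennreal (cmod (f x * g x)) \<partial>lborel)"
    using integral_norm_bound_ennreal[of lborel "\<lambda>x. f x * g x"]
    by (cases "integrable lborel (\<lambda>x. f x * g x)") (auto simp: not_integrable_integral_eq)
  also have "\<dots> = (\<integral>\<^sup>+ x. ennreal (cmod (f x)) * ennreal (cmod (g x)) \<partial>lborel)"
    by (simp add: norm_mult ennreal_mult)
  finally have "(ennreal (cmod (\<integral>x. f x * g x \<partial>lborel)))\<^sup>2 \<le> (\<integral>\<^sup>+ x. ennreal (cmod (f x)) * ennreal (cmod (g x)) \<partial>lborel)\<^sup>2"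
    by (intro power_mono) auto
  also have "\<dots> \<le> sq_norm f * sq_norm g"
    using Cauchy_Schwarz_nn_integral[of "\<lambda>x. ennreal (cmod (f x))" lborel "\<lambda>x. ennreal (cmod (g x))"]
    by (simp add: sq_norm_def ennreal_power)
  also have "\<dots> = (L2_norm f * L2_norm g)\<^sup>2"
    by (simp add: L2_norm_square power_mult_distrib)
  finally show ?thesis by (rule ennreal_power2_le_imp_le)
qed


section \<open>The extended transform on functions of bounded support\<close>

lemma fourier_integral_measurable [measurable]:
  assumes [measurable]: "f \<in> borel_measurable borel"
  shows "fourier_integral h f \<in> borel_measurable borel"
  unfolding fourier_integral_def by measurable

lemma norm_fourier_integral_le:
  "cmod (fourier_integral h f \<xi>) \<le> \<bar>1 / sqrt (2 * pi * h)\<bar> * (\<integral>x. cmod (f x) \<partial>lborel)"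
proof -
  have "cmod (\<integral>x. exp (- (\<i> * complex_of_real (x * \<xi> / h))) * f x \<partial>lborel)
      \<le> (\<integral>x. cmod (exp (- (\<i> * complex_of_real (x * \<xi> / h))) * f x) \<partial>lborel)"
    by (rule integral_norm_bound)
  then show ?thesis
    by (auto simp: fourier_integral_def norm_mult simp del: of_real_divide of_real_mult intro!: divide_right_mono)
qed

text \<open>The multiplication formula. With \<open>g\<close> the indicator of an interval, it
  replaces a test of the transform of \<open>f\<close> by a test of \<open>f\<close> against an
  explicit function.\<close>

lemma fourier_integral_swap:
  assumes f: "integrable lborel f" and g: "integrable lborel g"
  shows "(\<integral>\<xi>. g \<xi> * fourier_integral h f \<xi> \<partial>lborel) = (\<integral>x. f x * fourier_integral h g x \<partial>lborel)"
proof -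
  let ?c = "complex_of_real (1 / sqrt (2 * pi * h))"
  let ?e = "\<lambda>x \<xi>. exp (- (\<i> * complex_of_real (x * \<xi> / h)))"
  let ?F = "\<lambda>x \<xi>. ?e x \<xi> * f x * g \<xi>"
  have [measurable]: "f \<in> borel_measurable borel" "g \<in> borel_measurable borel"
    using borel_measurable_integrable[OF f] borel_measurable_integrable[OF g] by simp_all
  have int: "integrable (lborel \<Otimes>\<^sub>M lborel) (\<lambda>(x, \<xi>). ?F x \<xi>)"
  proof (rule lborel_pair.Fubini_integrable)
    have "integrable lborel (\<lambda>x. cmod (f x) * (\<integral>\<xi>. cmod (g \<xi>) \<partial>lborel))"
      using f by (intro integrable_mult_left integrable_norm)
    then show "integrable lborel (\<lambda>x. \<integral>\<xi>. cmod (case (x, \<xi>) of (x, \<xi>) \<Rightarrow> ?F x \<xi>) \<partial>lborel)"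
      by (simp add: norm_mult del: of_real_divide of_real_mult)
    show "AE x in lborel. integrable lborel (\<lambda>\<xi>. case (x, \<xi>) of (x, \<xi>) \<Rightarrow> ?F x \<xi>)"
    proof (intro AE_I2, simp only: prod.case)
      fix x
      have "integrable lborel (\<lambda>\<xi>. f x * g \<xi>)" using g by simp
      then show "integrable lborel (\<lambda>\<xi>. ?F x \<xi>)"
        by (rule Bochner_Integration.integrable_bound) (auto simp: norm_mult simp del: of_real_divide of_real_mult)
    qed
  qed measurable
  have "(\<integral>\<xi>. g \<xi> * fourier_integral h f \<xi> \<partial>lborel) = (\<integral>\<xi>. ?c * (\<integral>x. ?F x \<xi> \<partial>lborel) \<partial>lborel)"
  proof (rule Bochner_Integration.integral_cong[OF refl])
    fix \<xi>
    have "(\<integral>x. ?F x \<xi> \<partial>lborel) = (\<integral>x. ?e x \<xi> * f x \<partial>lborel) * g \<xi>"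
      by (rule integral_mult_left_zero)
    then show "g \<xi> * fourier_integral h f \<xi> = ?c * (\<integral>x. ?F x \<xi> \<partial>lborel)"
      by (simp only: fourier_integral_def ac_simps)
  qed
  also have "\<dots> = ?c * (\<integral>\<xi>. (\<integral>x. ?F x \<xi> \<partial>lborel) \<partial>lborel)"
    by simp
  also have "(\<integral>\<xi>. (\<integral>x. ?F x \<xi> \<partial>lborel) \<partial>lborel) = (\<integral>x. (\<integral>\<xi>. ?F x \<xi> \<partial>lborel) \<partial>lborel)"
    by (rule lborel_pair.Fubini_integral[OF int])
  also have "?c * \<dots> = (\<integral>x. ?c * (\<integral>\<xi>. ?F x \<xi> \<partial>lborel) \<partial>lborel)"
    by simp
  also have "\<dots> = (\<integral>x. f x * fourier_integral h g x \<partial>lborel)"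
  proof (rule Bochner_Integration.integral_cong[OF refl])
    fix x
    have "?e x \<xi> = exp (- (\<i> * complex_of_real (\<xi> * x / h)))" for \<xi>
      by (simp only: mult.commute)
    then have "(\<integral>\<xi>. ?F x \<xi> \<partial>lborel) = (\<integral>\<xi>. f x * (exp (- (\<i> * complex_of_real (\<xi> * x / h))) * g \<xi>) \<partial>lborel)"
      by (simp only: ac_simps)
    also have "\<dots> = f x * (\<integral>\<xi>. exp (- (\<i> * complex_of_real (\<xi> * x / h))) * g \<xi> \<partial>lborel)"
      by (rule integral_mult_right_zero)
    finally show "?c * (\<integral>\<xi>. ?F x \<xi> \<partial>lborel) = f x * fourier_integral h g x"
      by (simp only: fourier_integral_def ac_simps)
  qed
  finally show ?thesis .
qed

lemma L2_norm_indicator_finite: "L2_norm (\<lambda>x. indicator {a..b} x) < \<infinity>"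
proof -
  have "sq_norm (\<lambda>x. indicator {a..b} x) = emeasure lborel {a..b}"
    unfolding sq_norm_def
    by (subst nn_integral_indicator[symmetric]) (simp, intro nn_integral_cong, simp split: split_indicator)
  then show ?thesis by (simp add: L2_norm_eq emeasure_lborel_Icc_eq)
qed

text \<open>The transform of an interval is \<open>O (1 / \<bar>x\<bar>)\<close>, hence square integrable: this replaces Plancherel's
  theorem below.\<close>

lemma L2_norm_fourier_indicator_finite:
  assumes h: "h > 0" and ab: "a \<le> b"
  shows "L2_norm (fourier_integral h (\<lambda>x. indicator {a..b} x)) < \<infinity>"
proof -
  let ?k = "fourier_integral h (\<lambda>x. indicator {a..b} x)"
  define c where "c = 1 / sqrt (2 * pi * h)"
  \<comment> \<open>The sum of the trivial bound on the transform and of the bound, by explicit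
    integration, on |x| times the transform.\<close>
  define D where "D = c * ((b - a) + 2 * h)"
  have c: "c > 0" using h by (simp add: c_def)
  have decay: "cmod (?k x) * (1 + \<bar>x\<bar>) \<le> D" for x
  proof -
    have k: "?k x = complex_of_real c * (\<integral>\<xi>. indicator {a..b} \<xi> *\<^sub>R exp (- (\<i> * complex_of_real (\<xi> * x / h))) \<partial>lborel)"
      unfolding fourier_integral_def c_def
      by (intro arg_cong2[of _ _ _ _ "(*)"] refl Bochner_Integration.integral_cong) (auto split: split_indicator)
    have 1: "cmod (?k x) \<le> c * (b - a)"
    proof -
      have "(\<integral>x. cmod (indicator {a..b} x) \<partial>lborel) = (\<integral>x. indicator {a..b} x \<partial>lborel)"
        by (intro Bochner_Integration.integral_cong) (auto split: split_indicator)
      also have "\<dots> = b - a" using ab by simp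
      finally show ?thesis
        using norm_fourier_integral_le[of h "\<lambda>x. indicator {a..b} x" x] c by (simp add: c_def[symmetric])
    qed
    have 2: "cmod (?k x) * \<bar>x\<bar> \<le> c * (2 * h)"
    proof (cases "x = 0")
      case False
      define F where "F \<xi> = exp (- (\<i> * complex_of_real (\<xi> * x / h))) * (\<i> * h / x)" for \<xi>
      have "(\<integral>\<xi>. indicator {a..b} \<xi> *\<^sub>R exp (- (\<i> * complex_of_real (\<xi> * x / h))) \<partial>lborel) = F b - F a"
      proof (rule integral_FTC_Icc[OF ab])
        show "(F has_vector_derivative exp (- (\<i> * complex_of_real (\<xi> * x / h)))) (at \<xi> within {a..b})" for \<xi>
        proof -
          have "((\<lambda>z. exp (- (\<i> * (z * x / h))) * (\<i> * h / x)) has_field_derivative exp (- (\<i> * (complex_of_real \<xi> * x / h)))) (at (complex_of_real \<xi>))"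
            using False h by (auto intro!: derivative_eq_intros simp: field_simps)
          from has_vector_derivative_real_field[OF this] show ?thesis by (simp add: F_def[abs_def])
        qed
        show "continuous_on {a..b} (\<lambda>\<xi>. exp (- (\<i> * complex_of_real (\<xi> * x / h))))"
          by (intro continuous_intros) (use h in auto)
      qed
      then have "cmod (?k x) = c * cmod (F b - F a)" using c unfolding k by (simp add: norm_mult)
      also have "cmod (F b - F a) \<le> cmod (F b) + cmod (F a)" by (rule norm_triangle_ineq4)
      also have "cmod (F b) + cmod (F a) = 2 * (h / \<bar>x\<bar>)"
        using h by (simp add: F_def norm_mult norm_divide del: of_real_divide of_real_mult)
      finally show ?thesis using c False by (simp add: field_simps)
    qed (use c h in simp)
    show ?thesis using 1 2 by (simp add: D_def algebra_simps)
  qed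
  have "sq_norm ?k \<le> (\<integral>\<^sup>+ x. ennreal (D\<^sup>2 * inverse (1 + x\<^sup>2)) \<partial>lborel)"
    unfolding sq_norm_def
  proof (intro nn_integral_mono ennreal_leI)
    fix x
    have "(cmod (?k x) * (1 + \<bar>x\<bar>))\<^sup>2 \<le> D\<^sup>2" by (intro power_mono decay) auto
    moreover have "1 + x\<^sup>2 \<le> (1 + \<bar>x\<bar>)\<^sup>2" by (simp add: power2_sum)
    ultimately have "(cmod (?k x))\<^sup>2 * (1 + x\<^sup>2) \<le> D\<^sup>2"
      by (simp add: power_mult_distrib) (meson mult_left_mono order_trans zero_le_power2)
    then show "(cmod (?k x))\<^sup>2 \<le> D\<^sup>2 * inverse (1 + x\<^sup>2)"
      by (simp add: field_simps add_pos_nonneg)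
  qed
  also have "\<dots> < \<infinity>"
  proof -
    have "integrable lborel (\<lambda>x::real. inverse (1 + x\<^sup>2))"
      using integrable_inverse_1_plus_square by (simp add: set_integrable_def)
    then have "integrable lborel (\<lambda>x::real. D\<^sup>2 * inverse (1 + x\<^sup>2))" by (rule integrable_mult_right)
    then show ?thesis
      by (subst nn_integral_eq_integral) auto
  qed
  finally show ?thesis by (auto simp: L2_norm_eq)
qed


lemma integrable_test_function:
  assumes "test_function \<phi>"
  shows "integrable lborel \<phi>"
proof -
  have "\<phi> differentiable (at x)" for x
    using assms unfolding test_function_def by (metis funpow_0)
  then have cont: "continuous_on S \<phi>" for S
    by (meson differentiable_imp_continuous_within continuous_at_imp_continuous_on)
  have cpt: "compact (closure {x. \<phi> x \<noteq> 0})" using assms by (simp add: test_function_def)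
  have "(\<lambda>x. indicator (closure {x. \<phi> x \<noteq> 0}) x *\<^sub>R \<phi> x) = \<phi>"
    using closure_subset[of "{x. \<phi> x \<noteq> 0}"] by (auto simp: fun_eq_iff split: split_indicator)
  then show ?thesis using borel_integrable_compact[OF cpt cont] by simp
qed

lemma integral_zero_on_intervals_imp_AE_zero:
  fixes f :: "real \<Rightarrow> complex"
  assumes f: "integrable lborel f"
    and zero: "\<And>a b. a \<le> b \<Longrightarrow> (\<integral>x. indicator {a..b} x *\<^sub>R f x \<partial>lborel) = 0"
  shows "AE x in lborel. f x = 0"
proof (rule sigma_finite_measure.density_zero[OF sigma_finite_lborel f])
  \<comment> \<open>The complement case of the induction over Borel sets needs the integral over the
    whole line, reached as a limit over growing intervals.\<close>
  have whole: "(\<integral>x. f x \<partial>lborel) = 0"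
  proof -
    have "(\<lambda>k::nat. \<integral>x. indicator {- real k..real k} x *\<^sub>R f x \<partial>lborel) \<longlonglongrightarrow> (\<integral>x. f x \<partial>lborel)"
    proof (rule integral_dominated_convergence[where w = "\<lambda>x. cmod (f x)"])
      show "AE x in lborel. (\<lambda>k. indicator {- real k..real k} x *\<^sub>R f x) \<longlonglongrightarrow> f x"
      proof (rule AE_I2)
        fix x :: real
        obtain k0 :: nat where "\<bar>x\<bar> \<le> real k0" using real_arch_simple by blast
        then have "\<forall>\<^sub>F k in sequentially. indicator {- real k..real k} x *\<^sub>R f x = f x"
          by (intro eventually_sequentiallyI[of k0]) (auto simp: abs_le_iff)
        then show "(\<lambda>k. indicator {- real k..real k} x *\<^sub>R f x) \<longlonglongrightarrow> f x"
          by (rule tendsto_eventually)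
      qed
      show "AE x in lborel. norm (indicator {- real k..real k} x *\<^sub>R f x) \<le> cmod (f x)" for k
        by (auto split: split_indicator)
    qed (use f in auto)
    moreover have "(\<integral>x. indicator {- real k..real k} x *\<^sub>R f x \<partial>lborel) = 0" for k :: nat
      by (rule zero) simp
    ultimately show ?thesis by (simp add: LIMSEQ_const_iff)
  qed
  fix A :: "real set" assume "A \<in> sets lborel"
  then have "A \<in> sets borel" by simp
  then have "(LINT x:A|lborel. f x) = 0"
  proof (induction A rule: borel_set_induct)
    case empty
    then show ?case by (simp add: set_lebesgue_integral_def)
  next
    case (interval a b)
    then show ?case using zero by (simp add: set_lebesgue_integral_def)
  next
    case (compl A)
    have int: "integrable lborel (\<lambda>x. indicator A x *\<^sub>R f x)"
      using f compl by (intro integrable_mult_indicator) auto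
    have "(LINT x:-A|lborel. f x) = (\<integral>x. f x - indicator A x *\<^sub>R f x \<partial>lborel)"
      unfolding set_lebesgue_integral_def by (intro Bochner_Integration.integral_cong) (auto split: split_indicator)
    also have "\<dots> = 0" using compl f int whole by (simp add: set_lebesgue_integral_def)
    finally show ?case .
  next
    case (union F)
    then have "(LINT x:(\<Union>i. F i)|lborel. f x) = (\<Sum>i. (LINT x:F i|lborel. f x))"
      using f unfolding set_integrable_def
      by (intro lebesgue_integral_countable_add) (auto simp: disjoint_family_on_def set_integrable_def intro!: integrable_mult_indicator)
    then show ?case using union by simp
  qed
  then show "set_lebesgue_integral lborel A f = 0" .
qed

lemma ennreal_le_tendsto_zero:
  fixes s :: "nat \<Rightarrow> ennreal"
  assumes "\<And>n. ennreal c \<le> s n" "s \<longlonglongrightarrow> 0"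
  shows "c \<le> 0"
proof -
  have "ennreal c \<le> 0" by (rule LIMSEQ_le_const[OF assms(2)]) (use assms(1) in auto)
  then show ?thesis by (simp add: ennreal_eq_0_iff)
qed

text \<open>\<open>w\<close> is known only as an L2 limit of transforms, so it is compared with the
  Fourier integral through integrals over intervals. The multiplication formula moves the transform
  onto the indicator, whose transform is in L2, and both approximation errors vanish by
  Cauchy-Schwarz.\<close>

lemma is_fourier_AE_eq:
  assumes h: "h > 0" and F: "is_fourier h u w" and supp: "\<And>x. x \<notin> {- B..B} \<Longrightarrow> u x = 0"
  shows "AE \<xi> in lborel. w \<xi> = fourier_integral h u \<xi>"
proof -
  from F obtain \<phi> where u: "u \<in> L2" and w: "w \<in> L2" and \<phi>: "\<And>n. test_function (\<phi> n)"
    and lim1: "(\<lambda>n. L2_norm (\<lambda>x. \<phi> n x - u x)) \<longlonglongrightarrow> 0"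
    and lim2: "(\<lambda>n. L2_norm (\<lambda>\<xi>. fourier_integral h (\<phi> n) \<xi> - w \<xi>)) \<longlonglongrightarrow> 0"
    unfolding is_fourier_def by blast
  have [measurable]: "u \<in> borel_measurable borel" "w \<in> borel_measurable borel"
    using u w by (simp_all add: L2_measurable)
  have u_int: "integrable lborel u"
    by (rule integrable_of_L2_bounded_support[OF _ sq_norm_finite[OF u] supp]) auto
  have \<phi>_int: "integrable lborel (\<phi> n)" for n by (rule integrable_test_function[OF \<phi>])
  have [measurable]: "\<phi> n \<in> borel_measurable borel" for n
    using borel_measurable_integrable[OF \<phi>_int] by simp
  have F_int: "integrable lborel (\<lambda>\<xi>. indicator {a..b} \<xi> * fourier_integral h f \<xi>)" if "integrable lborel f" for a b f
  proof -
    have [measurable]: "f \<in> borel_measurable borel" using borel_measurable_integrable[OF that] by simp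
    let ?C = "\<bar>1 / sqrt (2 * pi * h)\<bar> * (\<integral>x. cmod (f x) \<partial>lborel)"
    have "integrable lborel (\<lambda>\<xi>. ?C * indicator {a..b} \<xi> :: real)"
      by (intro integrable_mult_right) (auto simp: emeasure_lborel_Icc_eq)
    then show ?thesis
    proof (rule Bochner_Integration.integrable_bound)
      have "0 \<le> ?C" by (intro mult_nonneg_nonneg integral_nonneg_AE) auto
      then have "cmod (indicator {a..b} \<xi> * fourier_integral h f \<xi>) \<le> norm (?C * indicator {a..b} \<xi> :: real)" for \<xi>
        using norm_fourier_integral_le[of h f \<xi>] by (cases "\<xi> \<in> {a..b}") (simp_all only: indicator_simps, simp_all)
      then show "AE \<xi> in lborel. cmod (indicator {a..b} \<xi> * fourier_integral h f \<xi>) \<le> norm (?C * indicator {a..b} \<xi> :: real)"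
        by (intro AE_I2)
    qed measurable
  qed
  have w_int: "integrable lborel (\<lambda>\<xi>. indicator {a..b} \<xi> * w \<xi>)" for a b :: real
  proof (rule integrable_of_L2_bounded_support[of _ a b])
    have "sq_norm (\<lambda>\<xi>. indicator {a..b} \<xi> * w \<xi>) \<le> sq_norm w"
      unfolding sq_norm_def by (intro nn_integral_mono) (auto split: split_indicator)
    then show "sq_norm (\<lambda>\<xi>. indicator {a..b} \<xi> * w \<xi>) < \<infinity>"
      using sq_norm_finite[OF w] by (rule le_less_trans)
  qed auto
  define g where "g \<xi> = w \<xi> - fourier_integral h u \<xi>" for \<xi>
  have [measurable]: "g \<in> borel_measurable borel" unfolding g_def by measurable
  have g_zero: "(\<integral>\<xi>. indicator {a..b} \<xi> * g \<xi> \<partial>lborel) = 0" if ab: "a \<le> b" for a b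
  proof -
    let ?i = "\<lambda>x. indicator {a..b} x :: complex" and ?k = "fourier_integral h (\<lambda>x. indicator {a..b} x)"
    have one_int: "integrable lborel ?i"
      using borel_integrable_compact[of "{a..b}" "\<lambda>_. 1 :: complex"]
      by (simp add: scaleR_conv_of_real of_real_indicator)
    obtain C where k_bd: "cmod (?k x) \<le> C" for x
      using norm_fourier_integral_le by blast
    have "C \<ge> 0" using k_bd[of 0] norm_ge_zero order_trans by blast
    have fk_int: "integrable lborel (\<lambda>x. f x * ?k x)" if "integrable lborel f" for f
    proof -
      have [measurable]: "f \<in> borel_measurable borel" using borel_measurable_integrable[OF that] by simp
      have "integrable lborel (\<lambda>x. cmod (f x) * C)"
        using that by (intro integrable_mult_left integrable_norm)
      then show ?thesis
        by (rule Bochner_Integration.integrable_bound)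
          (use k_bd \<open>C \<ge> 0\<close> in \<open>auto simp: norm_mult mult_left_mono\<close>)
    qed
    let ?d = "\<integral>\<xi>. ?i \<xi> * g \<xi> \<partial>lborel"
    define s where "s n = L2_norm ?i * L2_norm (\<lambda>\<xi>. fourier_integral h (\<phi> n) \<xi> - w \<xi>)
      + L2_norm (\<lambda>x. \<phi> n x - u x) * L2_norm ?k" for n
    have "cmod ?d \<le> 0"
    proof (rule ennreal_le_tendsto_zero)
      fix n
      have e1: "(\<integral>\<xi>. ?i \<xi> * (fourier_integral h (\<phi> n) \<xi> - w \<xi>) \<partial>lborel)
          = (\<integral>\<xi>. ?i \<xi> * fourier_integral h (\<phi> n) \<xi> \<partial>lborel) - (\<integral>\<xi>. ?i \<xi> * w \<xi> \<partial>lborel)"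
        unfolding right_diff_distrib by (rule Bochner_Integration.integral_diff[OF F_int[OF \<phi>_int] w_int])
      have e2: "(\<integral>x. (\<phi> n x - u x) * ?k x \<partial>lborel) = (\<integral>x. \<phi> n x * ?k x \<partial>lborel) - (\<integral>x. u x * ?k x \<partial>lborel)"
        unfolding left_diff_distrib by (rule Bochner_Integration.integral_diff[OF fk_int[OF \<phi>_int] fk_int[OF u_int]])
      have e3: "?d = (\<integral>\<xi>. ?i \<xi> * w \<xi> \<partial>lborel) - (\<integral>\<xi>. ?i \<xi> * fourier_integral h u \<xi> \<partial>lborel)"
        unfolding g_def right_diff_distrib by (rule Bochner_Integration.integral_diff[OF w_int F_int[OF u_int]])
      have "?d = (\<integral>x. (\<phi> n x - u x) * ?k x \<partial>lborel) - (\<integral>\<xi>. ?i \<xi> * (fourier_integral h (\<phi> n) \<xi> - w \<xi>) \<partial>lborel)"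
        unfolding e1 e2 e3 fourier_integral_swap[OF \<phi>_int one_int] fourier_integral_swap[OF u_int one_int] by simp
      then have "cmod ?d \<le> cmod (\<integral>\<xi>. ?i \<xi> * (fourier_integral h (\<phi> n) \<xi> - w \<xi>) \<partial>lborel) + cmod (\<integral>x. (\<phi> n x - u x) * ?k x \<partial>lborel)"
        by (simp only:) (metis add.commute norm_triangle_ineq4)
      then have "ennreal (cmod ?d) \<le> ennreal (cmod (\<integral>\<xi>. ?i \<xi> * (fourier_integral h (\<phi> n) \<xi> - w \<xi>) \<partial>lborel))
          + ennreal (cmod (\<integral>x. (\<phi> n x - u x) * ?k x \<partial>lborel))"
        by (simp add: ennreal_plus[symmetric] ennreal_leI del: ennreal_plus)
      also have "\<dots> \<le> s n"
        unfolding s_def by (intro add_mono norm_integral_mult_le) measurable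
      finally show "ennreal (cmod ?d) \<le> s n" .
    next
      have "s \<longlonglongrightarrow> L2_norm ?i * 0 + 0 * L2_norm ?k"
        unfolding s_def
        unfolding mult.commute[of _ "L2_norm ?k"] mult.commute[of 0]
        using L2_norm_indicator_finite[of a b] L2_norm_fourier_indicator_finite[OF h ab]
        by (intro tendsto_add ennreal_tendsto_cmult lim1 lim2) (auto simp: infinity_ennreal_def)
      then show "s \<longlonglongrightarrow> 0" by simp
    qed
    then show ?thesis by simp
  qed
  have "AE \<xi> in lborel. \<forall>k::nat. indicator {- real k..real k} \<xi> * g \<xi> = 0"
    unfolding AE_all_countable
  proof
    fix k :: nat
    show "AE \<xi> in lborel. indicator {- real k..real k} \<xi> * g \<xi> = 0"
    proof (rule integral_zero_on_intervals_imp_AE_zero)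
      show "integrable lborel (\<lambda>\<xi>. indicator {- real k..real k} \<xi> * g \<xi>)"
        unfolding g_def right_diff_distrib by (intro Bochner_Integration.integrable_diff w_int F_int u_int)
      fix a b :: real assume "a \<le> b"
      let ?a = "max a (- real k)" and ?b = "min b (real k)"
      have eq: "indicator {a..b} \<xi> *\<^sub>R (indicator {- real k..real k} \<xi> * g \<xi>) = indicator {?a..?b} \<xi> * g \<xi>" for \<xi>
        by (auto split: split_indicator)
      show "(\<integral>\<xi>. indicator {a..b} \<xi> *\<^sub>R (indicator {- real k..real k} \<xi> * g \<xi>) \<partial>lborel) = 0"
        unfolding eq using g_zero[of ?a ?b] by (cases "?a \<le> ?b") auto
    qed
  qed
  then show ?thesis
  proof (eventually_elim)
    case (elim \<xi>)
    obtain k :: nat where "\<bar>\<xi>\<bar> \<le> real k" using real_arch_simple by blast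
    then have "\<xi> \<in> {- real k..real k}" by auto
    then show ?case using elim[rule_format, of k] by (simp add: g_def)
  qed
qed


section \<open>Reduction of the operator norm to the matrix of phases\<close>

lemma sq_norm_shift_sum:
  assumes [measurable]: "u \<in> borel_measurable borel" "\<And>y. J y \<in> sets borel"
    and cover: "\<And>x. (\<Sum>y<N. indicator (J y) x :: ennreal) * ennreal ((cmod (u x))\<^sup>2) = ennreal ((cmod (u x))\<^sup>2)"
  shows "(\<Sum>y<N. \<integral>\<^sup>+ s. ennreal ((cmod (indicator (J y) (b y + s) * u (b y + s)))\<^sup>2) \<partial>lborel) = sq_norm u"
proof -
  have "(\<integral>\<^sup>+ s. ennreal ((cmod (indicator (J y) (b y + s) * u (b y + s)))\<^sup>2) \<partial>lborel)
      = (\<integral>\<^sup>+ x. indicator (J y) x * ennreal ((cmod (u x))\<^sup>2) \<partial>lborel)" for y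
  proof -
    have "(\<integral>\<^sup>+ x. indicator (J y) x * ennreal ((cmod (u x))\<^sup>2) \<partial>lborel)
        = (\<integral>\<^sup>+ s. indicator (J y) (b y + s) * ennreal ((cmod (u (b y + s)))\<^sup>2) \<partial>lborel)"
      using nn_integral_real_affine[of "\<lambda>x. indicator (J y) x * ennreal ((cmod (u x))\<^sup>2)" 1 "b y"] by simp
    also have "\<dots> = (\<integral>\<^sup>+ s. ennreal ((cmod (indicator (J y) (b y + s) * u (b y + s)))\<^sup>2) \<partial>lborel)"
      by (intro nn_integral_cong) (simp split: split_indicator)
    finally show ?thesis by simp
  qed
  then have "(\<Sum>y<N. \<integral>\<^sup>+ s. ennreal ((cmod (indicator (J y) (b y + s) * u (b y + s)))\<^sup>2) \<partial>lborel)
      = (\<integral>\<^sup>+ x. (\<Sum>y<N. indicator (J y) x * ennreal ((cmod (u x))\<^sup>2)) \<partial>lborel)"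
    by (subst nn_integral_sum) auto
  then show ?thesis by (simp add: sum_distrib_right[symmetric] cover sq_norm_def)
qed

lemma sum_indicator_unique:
  fixes N :: nat
  assumes "y0 < N" "\<And>y. y < N \<Longrightarrow> x \<in> J y \<longleftrightarrow> y = y0"
  shows "(\<Sum>y<N. indicator (J y) x) = (1 :: 'a :: comm_semiring_1)"
proof -
  have "(\<Sum>y<N. indicator (J y) x) = (\<Sum>y<N. if y = y0 then 1 else (0 :: 'a))"
    using assms(2) by (intro sum.cong) (auto simp: indicator_def)
  also have "\<dots> = (if y0 \<in> {..<N} then 1 else 0)"
    by (rule sum.delta) simp
  finally show ?thesis using assms(1) by simp
qed

text \<open>All pieces of u are translated to the common window [-h, 2h]. Cauchy-Schwarz in the
  offset s of the input costs its length 3h, integrating over the offset t of the output costs 3h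
  again, and the normalisation contributes 1 / (2 pi h).\<close>

lemma sq_norm_fourier_le:
  fixes b :: "nat \<Rightarrow> real"
  assumes h: "h > 0" and K: "K \<ge> 0"
    and E: "\<And>u :: nat \<Rightarrow> complex. (\<Sum>x<N. (cmod (\<Sum>y<N. cis (- (b x * b y / h)) * u y))\<^sup>2) \<le> K * (\<Sum>y<N. (cmod (u y))\<^sup>2)"
    and X[measurable]: "X \<in> sets borel" and cover: "X \<subseteq> (\<Union>x<N. {b x - h..b x + 2 * h})" and B: "X \<subseteq> {- B..B}"
    and u[measurable]: "u \<in> borel_measurable borel" and supp: "\<And>x. x \<notin> X \<Longrightarrow> u x = 0" and fin: "sq_norm u < \<infinity>"
  shows "sq_norm (cutoff X (fourier_integral h u)) \<le> ennreal (9 * h / (2 * pi) * K) * sq_norm u"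
proof -
  let ?I = "{- h..2 * h}"
  \<comment> \<open>Every x in X is assigned to the first interval containing it, so overlaps of the
    cover cost nothing on the input side.\<close>
  define J where "J y = X \<inter> {b y - h..b y + 2 * h} - (\<Union>y'<y. {b y' - h..b y' + 2 * h})" for y
  have [measurable]: "J y \<in> sets borel" for y unfolding J_def by measurable
  define v where "v y s = indicator (J y) (b y + s) * u (b y + s)" for y s
  have [measurable]: "v y \<in> borel_measurable borel" for y unfolding v_def by measurable
  have v_supp: "v y s = 0" if "s \<notin> ?I" for y s
    using that by (auto simp: v_def J_def split: split_indicator)
  have u_int: "integrable lborel u"
  proof (rule integrable_of_L2_bounded_support[OF u fin])
    fix x assume "x \<notin> {- B..B}"
    then have "x \<notin> X" using B by blast
    then show "u x = 0" by (rule supp)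
  qed
  have J_ex: "\<exists>y0<N. \<forall>y<N. x \<in> J y \<longleftrightarrow> y = y0" if x: "x \<in> X" for x
  proof -
    have ex: "\<exists>y. y < N \<and> x \<in> {b y - h..b y + 2 * h}" using subsetD[OF cover x] by auto
    define y0 where "y0 = (LEAST y. y < N \<and> x \<in> {b y - h..b y + 2 * h})"
    have y0: "y0 < N" "x \<in> {b y0 - h..b y0 + 2 * h}"
      using LeastI_ex[OF ex] unfolding y0_def by blast+
    have least: "x \<notin> {b y - h..b y + 2 * h}" if "y < y0" for y
      using not_less_Least[of y "\<lambda>y. y < N \<and> x \<in> {b y - h..b y + 2 * h}"] that y0(1) unfolding y0_def by auto
    have "x \<in> J y \<longleftrightarrow> y = y0" if "y < N" for y
    proof
      assume "x \<in> J y"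
      then show "y = y0" using least[of y] y0 unfolding J_def by (cases y y0 rule: linorder_cases) auto
    next
      assume "y = y0"
      then show "x \<in> J y" using y0 least x unfolding J_def by auto
    qed
    then show ?thesis using y0 by blast
  qed
  have J_unique: "(\<Sum>y<N. indicator (J y) x) = (1 :: real)" "(\<Sum>y<N. indicator (J y) x) = (1 :: ennreal)" if "x \<in> X" for x
    using J_ex[OF that] by (blast intro: sum_indicator_unique)+
  have v_int: "integrable lborel (v y)" for y
  proof -
    have "integrable lborel (\<lambda>x. indicator (J y) x *\<^sub>R u x)" by (intro integrable_mult_indicator u_int) simp
    then have "integrable lborel (\<lambda>s. indicator (J y) (b y + 1 * s) *\<^sub>R u (b y + 1 * s))"
      by (rule lborel_integrable_real_affine) simp
    then show ?thesis by (simp add: v_def[abs_def] scaleR_conv_of_real of_real_indicator)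
  qed
  have v_sum: "(\<Sum>y<N. \<integral>\<^sup>+ s. ennreal ((cmod (v y s))\<^sup>2) \<partial>lborel) = sq_norm u"
    unfolding v_def
  proof (rule sq_norm_shift_sum)
    show "(\<Sum>y<N. indicator (J y) x :: ennreal) * ennreal ((cmod (u x))\<^sup>2) = ennreal ((cmod (u x))\<^sup>2)" for x
      using J_unique(2)[of x] supp[of x] by (cases "x \<in> X") auto
  qed measurable
  define c where "c = 1 / (2 * pi * h)"
  have c: "c > 0" using h by (simp add: c_def)
  have pointwise: "(\<Sum>z<N. ennreal ((cmod (fourier_integral h u (b z + t)))\<^sup>2)) \<le> ennreal (c * (3 * h * K)) * sq_norm u" for t
  proof -
    \<comment> \<open>(b_y + s) (b_z + t) = b_z b_y + b_y t + s (b_z + t). The middle term is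
      absorbed into the vector without changing its norm; the last is independent of y and
      disappears in the modulus for each fixed s.\<close>
    define w where "w y s = cis (- (b y * t / h)) * v y s" for y s
    have [measurable]: "w y \<in> borel_measurable borel" for y unfolding w_def by measurable
    define G where "G z s = cmod (\<Sum>y<N. cis (- (b z * b y / h)) * w y s)" for z s
    have [measurable]: "G z \<in> borel_measurable borel" for z unfolding G_def by measurable
    define I where "I z = (\<integral>x. exp (- (\<i> * complex_of_real (x * (b z + t) / h))) * u x \<partial>lborel)" for z
    have I_le: "ennreal (cmod (I z)) \<le> (\<integral>\<^sup>+ s. ennreal (G z s) \<partial>lborel)" for z
    proof -
      let ?e = "\<lambda>x. exp (- (\<i> * complex_of_real (x * (b z + t) / h)))"
      have e_int: "integrable lborel (\<lambda>x. ?e x * f x)" if "integrable lborel f" for f :: "real \<Rightarrow> complex"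
      proof (rule Bochner_Integration.integrable_bound[OF that])
        have [measurable]: "f \<in> borel_measurable borel" using borel_measurable_integrable[OF that] by simp
        show "(\<lambda>x. ?e x * f x) \<in> borel_measurable lborel" by measurable
      qed (auto simp: norm_mult simp del: of_real_divide of_real_mult)
      have e_v_int: "integrable lborel (\<lambda>s. ?e (b y + s) * v y s)" for y
      proof (rule Bochner_Integration.integrable_bound[OF v_int[of y]])
        show "(\<lambda>s. ?e (b y + s) * v y s) \<in> borel_measurable lborel" by measurable
      qed (auto simp: norm_mult simp del: of_real_divide of_real_mult)
      have "I z = (\<integral>x. (\<Sum>y<N. ?e x * (indicator (J y) x *\<^sub>R u x)) \<partial>lborel)"
        unfolding I_def
      proof (rule Bochner_Integration.integral_cong[OF refl])
        fix x
        have "(\<Sum>y<N. ?e x * (indicator (J y) x *\<^sub>R u x)) = ?e x * ((\<Sum>y<N. indicator (J y) x) *\<^sub>R u x)"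
          by (simp add: sum_distrib_left scaleR_sum_left)
        also have "\<dots> = ?e x * u x" using J_unique(1)[of x] supp[of x] by (cases "x \<in> X") simp_all
        finally show "?e x * u x = (\<Sum>y<N. ?e x * (indicator (J y) x *\<^sub>R u x))" by simp
      qed
      also have "\<dots> = (\<Sum>y<N. \<integral>x. ?e x * (indicator (J y) x *\<^sub>R u x) \<partial>lborel)"
        by (intro Bochner_Integration.integral_sum e_int integrable_mult_indicator u_int) simp
      also have "\<dots> = (\<Sum>y<N. \<integral>s. ?e (b y + s) * v y s \<partial>lborel)"
      proof (rule sum.cong[OF refl])
        fix y
        show "(\<integral>x. ?e x * (indicator (J y) x *\<^sub>R u x) \<partial>lborel) = (\<integral>s. ?e (b y + s) * v y s \<partial>lborel)"
          by (subst lborel_integral_real_affine[of 1 _ "b y"]) (simp_all add: v_def scaleR_conv_of_real of_real_indicator)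
      qed
      also have "\<dots> = (\<integral>s. (\<Sum>y<N. ?e (b y + s) * v y s) \<partial>lborel)"
        by (rule Bochner_Integration.integral_sum[symmetric]) (rule e_v_int)
      finally have I: "I z = (\<integral>s. (\<Sum>y<N. ?e (b y + s) * v y s) \<partial>lborel)" .
      have "ennreal (cmod (I z)) \<le> (\<integral>\<^sup>+ s. ennreal (cmod (\<Sum>y<N. ?e (b y + s) * v y s)) \<partial>lborel)"
        unfolding I by (intro integral_norm_bound_ennreal Bochner_Integration.integrable_sum e_v_int)
      also have "\<dots> = (\<integral>\<^sup>+ s. ennreal (G z s) \<partial>lborel)"
      proof (intro nn_integral_cong arg_cong[of _ _ ennreal])
        fix s
        have "?e (b y + s) * v y s = cis (- (s * (b z + t) / h)) * (cis (- (b z * b y / h)) * w y s)" for y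
        proof -
          have "?e (b y + s) = cis (- ((b y + s) * (b z + t) / h))" by (simp add: cis_conv_exp del: of_real_divide of_real_mult)
          also have "- ((b y + s) * (b z + t) / h) = - (s * (b z + t) / h) + (- (b z * b y / h) + - (b y * t / h))"
            using h by (simp add: field_simps)
          finally show ?thesis by (simp only: w_def cis_mult[symmetric] mult.assoc)
        qed
        then have "(\<Sum>y<N. ?e (b y + s) * v y s) = cis (- (s * (b z + t) / h)) * (\<Sum>y<N. cis (- (b z * b y / h)) * w y s)"
          by (simp only: sum_distrib_left)
        then show "cmod (\<Sum>y<N. ?e (b y + s) * v y s) = G z s"
          by (simp add: G_def norm_mult)
      qed
      finally show ?thesis .
    qed
    have I_sq: "ennreal ((cmod (I z))\<^sup>2) \<le> ennreal (3 * h) * (\<integral>\<^sup>+ s. ennreal ((G z s)\<^sup>2) \<partial>lborel)" for z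
    proof -
      have "(\<integral>\<^sup>+ s. ennreal (G z s) \<partial>lborel) = (\<integral>\<^sup>+ s. indicator ?I s * ennreal (G z s) \<partial>lborel)"
        by (intro nn_integral_cong) (auto simp: G_def w_def v_supp split: split_indicator)
      then have "(ennreal (cmod (I z)))\<^sup>2 \<le> (\<integral>\<^sup>+ s. indicator ?I s * ennreal (G z s) \<partial>lborel)\<^sup>2"
        using I_le[of z] by (intro power_mono) auto
      also have "\<dots> \<le> (\<integral>\<^sup>+ s. (indicator ?I s)\<^sup>2 \<partial>lborel) * (\<integral>\<^sup>+ s. (ennreal (G z s))\<^sup>2 \<partial>lborel)"
        by (rule Cauchy_Schwarz_nn_integral) auto
      also have "(\<integral>\<^sup>+ s. (indicator ?I s :: ennreal)\<^sup>2 \<partial>lborel) = (\<integral>\<^sup>+ s. indicator ?I s \<partial>lborel)"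
        by (intro nn_integral_cong) (auto split: split_indicator)
      also have "\<dots> = ennreal (3 * h)" using h by (simp add: emeasure_lborel_Icc_eq)
      finally show ?thesis by (simp add: ennreal_power G_def)
    qed
    have "(\<Sum>z<N. ennreal ((cmod (fourier_integral h u (b z + t)))\<^sup>2)) = (\<Sum>z<N. ennreal c * ennreal ((cmod (I z))\<^sup>2))"
    proof (rule sum.cong[OF refl])
      fix z
      have "(cmod (fourier_integral h u (b z + t)))\<^sup>2 = c * (cmod (I z))\<^sup>2"
      proof -
        have "fourier_integral h u (b z + t) = complex_of_real (1 / sqrt (2 * pi * h)) * I z"
          by (simp only: fourier_integral_def I_def)
        then show ?thesis using h by (simp add: norm_mult power_mult_distrib power_divide c_def norm_divide)
      qed
      then show "ennreal ((cmod (fourier_integral h u (b z + t)))\<^sup>2) = ennreal c * ennreal ((cmod (I z))\<^sup>2)"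
        using c by (simp add: ennreal_mult)
    qed
    also have "\<dots> \<le> (\<Sum>z<N. ennreal c * (ennreal (3 * h) * (\<integral>\<^sup>+ s. ennreal ((G z s)\<^sup>2) \<partial>lborel)))"
      by (intro sum_mono mult_left_mono I_sq) auto
    also have "\<dots> = ennreal c * (ennreal (3 * h) * (\<integral>\<^sup>+ s. (\<Sum>z<N. ennreal ((G z s)\<^sup>2)) \<partial>lborel))"
      by (subst nn_integral_sum) (auto simp: sum_distrib_left)
    also have "\<dots> \<le> ennreal c * (ennreal (3 * h) * (\<integral>\<^sup>+ s. ennreal K * (\<Sum>y<N. ennreal ((cmod (v y s))\<^sup>2)) \<partial>lborel))"
    proof (intro mult_left_mono nn_integral_mono)
      fix s
      have "(\<Sum>z<N. (G z s)\<^sup>2) \<le> K * (\<Sum>y<N. (cmod (w y s))\<^sup>2)" unfolding G_def by (rule E)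
      also have "\<dots> = K * (\<Sum>y<N. (cmod (v y s))\<^sup>2)" by (simp add: w_def norm_mult)
      finally show "(\<Sum>z<N. ennreal ((G z s)\<^sup>2)) \<le> ennreal K * (\<Sum>y<N. ennreal ((cmod (v y s))\<^sup>2))"
        using K by (simp add: sum_ennreal ennreal_mult[symmetric] sum_nonneg ennreal_leI)
    qed auto
    also have "(\<integral>\<^sup>+ s. ennreal K * (\<Sum>y<N. ennreal ((cmod (v y s))\<^sup>2)) \<partial>lborel) = ennreal K * sq_norm u"
    proof -
      have "(\<integral>\<^sup>+ s. (\<Sum>y<N. ennreal ((cmod (v y s))\<^sup>2)) \<partial>lborel) = sq_norm u"
        unfolding v_sum[symmetric] by (rule nn_integral_sum) measurable
      then show ?thesis by (subst nn_integral_cmult) auto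
    qed
    also have "ennreal c * (ennreal (3 * h) * (ennreal K * sq_norm u)) = ennreal (c * (3 * h * K)) * sq_norm u"
      using c h K by (simp add: ennreal_mult mult_ac)
    finally show ?thesis .
  qed
  let ?f = "\<lambda>z \<xi>. indicator {b z - h..b z + 2 * h} \<xi> * ennreal ((cmod (fourier_integral h u \<xi>))\<^sup>2)"
  let ?g = "\<lambda>z t. indicator ?I t * ennreal ((cmod (fourier_integral h u (b z + t)))\<^sup>2)"
  have "sq_norm (cutoff X (fourier_integral h u))
      \<le> (\<integral>\<^sup>+ \<xi>. (\<Sum>z<N. ?f z \<xi>) \<partial>lborel)"
    unfolding sq_norm_def
  proof (rule nn_integral_mono)
    fix \<xi>
    show "ennreal ((cmod (cutoff X (fourier_integral h u) \<xi>))\<^sup>2)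
        \<le> (\<Sum>z<N. ?f z \<xi>)"
    proof (cases "\<xi> \<in> X")
      case True
      then obtain z where z: "z < N" "\<xi> \<in> {b z - h..b z + 2 * h}" using subsetD[OF cover True] by auto
      then have "ennreal ((cmod (cutoff X (fourier_integral h u) \<xi>))\<^sup>2)
          = ?f z \<xi>"
        using True by (simp add: cutoff_def)
      also have "\<dots> \<le> (\<Sum>z<N. ?f z \<xi>)"
        using z by (intro member_le_sum[of z "{..<N}"]) auto
      finally show ?thesis .
    qed (simp add: cutoff_def)
  qed
  also have "\<dots> = (\<Sum>z<N. \<integral>\<^sup>+ \<xi>. ?f z \<xi> \<partial>lborel)"
    by (rule nn_integral_sum) measurable
  also have "\<dots> = (\<Sum>z<N. \<integral>\<^sup>+ t. ?g z t \<partial>lborel)"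
  proof (rule sum.cong[OF refl])
    fix z
    have "(\<integral>\<^sup>+ \<xi>. ?f z \<xi> \<partial>lborel)
        = (\<integral>\<^sup>+ t. indicator {b z - h..b z + 2 * h} (b z + t) * ennreal ((cmod (fourier_integral h u (b z + t)))\<^sup>2) \<partial>lborel)"
      using nn_integral_real_affine[of "\<lambda>\<xi>. ?f z \<xi>" 1 "b z"]
      by simp
    then show "(\<integral>\<^sup>+ \<xi>. ?f z \<xi> \<partial>lborel)
        = (\<integral>\<^sup>+ t. ?g z t \<partial>lborel)"
      by (simp add: indicator_def)
  qed
  also have "\<dots> = (\<integral>\<^sup>+ t. (\<Sum>z<N. ?g z t) \<partial>lborel)"
    by (rule nn_integral_sum[symmetric]) measurable
  also have "\<dots> \<le> (\<integral>\<^sup>+ t. (ennreal (c * (3 * h * K)) * sq_norm u) * indicator ?I t \<partial>lborel)"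
  proof (rule nn_integral_mono)
    fix t
    show "(\<Sum>z<N. ?g z t) \<le> (ennreal (c * (3 * h * K)) * sq_norm u) * indicator ?I t"
      using pointwise[of t] by (cases "t \<in> ?I")
        (simp_all only: indicator_simps mult_1 mult_1_right mult_zero_left mult_zero_right sum.neutral_const order_refl not_False_eq_True)
  qed
  also have "\<dots> = ennreal (c * (3 * h * K)) * sq_norm u * ennreal (3 * h)"
    using h by (subst nn_integral_cmult_indicator) (auto simp: emeasure_lborel_Icc_eq)
  also have "\<dots> = ennreal (c * (3 * h * K) * (3 * h)) * sq_norm u"
    using c h K by (simp add: ennreal_mult mult_ac)
  also have "c * (3 * h * K) * (3 * h) = 9 * h / (2 * pi) * K"
    using h by (simp add: c_def field_simps)
  finally show ?thesis .
qed

theorem opnorm_cutoff_fourier_le: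
  fixes b :: "nat \<Rightarrow> real"
  assumes h: "h > 0" and K: "K \<ge> 0"
    and E: "\<And>u :: nat \<Rightarrow> complex. (\<Sum>x<N. (cmod (\<Sum>y<N. cis (- (b x * b y / h)) * u y))\<^sup>2) \<le> K * (\<Sum>y<N. (cmod (u y))\<^sup>2)"
    and X: "X \<in> sets borel" "X \<subseteq> (\<Union>x<N. {b x - h..b x + 2 * h})" "X \<subseteq> {- B..B}"
  shows "L2_opnorm (cutoff_fourier X h) \<le> ennreal (sqrt (9 * h / (2 * pi) * K))"
  unfolding L2_opnorm_def
proof (rule Sup_least, clarify)
  fix u v assume u: "u \<in> L2" "L2_norm u \<le> 1" and "cutoff_fourier X h u v"
  then obtain w where F: "is_fourier h (cutoff X u) w" and v: "v = cutoff X w"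
    unfolding cutoff_fourier_def by blast
  have [measurable]: "u \<in> borel_measurable borel" "w \<in> borel_measurable borel" "X \<in> sets borel"
    using u F X by (simp_all add: is_fourier_def L2_measurable)
  have cut_meas [measurable]: "cutoff X f \<in> borel_measurable borel" if [measurable]: "f \<in> borel_measurable borel" for f
    unfolding cutoff_def by measurable
  have "sq_norm (cutoff X u) \<le> sq_norm u"
    unfolding sq_norm_def by (intro nn_integral_mono) (auto simp: cutoff_def split: split_indicator)
  also have "\<dots> = (L2_norm u)\<^sup>2" by (rule L2_norm_square[symmetric])
  also have "\<dots> \<le> 1\<^sup>2" by (intro power_mono u) simp
  finally have u1: "sq_norm (cutoff X u) \<le> 1" by simp
  have "AE \<xi> in lborel. w \<xi> = fourier_integral h (cutoff X u) \<xi>"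
  proof (rule is_fourier_AE_eq[OF h F])
    fix x assume "x \<notin> {- B..B}"
    then have "x \<notin> X" using X(3) by blast
    then show "cutoff X u x = 0" by (simp add: cutoff_def)
  qed
  then have "sq_norm v = sq_norm (cutoff X (fourier_integral h (cutoff X u)))"
    unfolding sq_norm_def v by (intro nn_integral_cong_AE) (auto simp: cutoff_def)
  also have "\<dots> \<le> ennreal (9 * h / (2 * pi) * K) * sq_norm (cutoff X u)"
    by (rule sq_norm_fourier_le[OF h K E X]) (use u1 in \<open>auto simp: cutoff_def intro: le_less_trans\<close>)
  also have "\<dots> \<le> ennreal (9 * h / (2 * pi) * K) * 1" by (intro mult_left_mono u1) simp
  also have "\<dots> = ennreal ((sqrt (9 * h / (2 * pi) * K))\<^sup>2)" using h K by simp
  finally show "L2_norm v \<le> ennreal (sqrt (9 * h / (2 * pi) * K))"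
    by (rule L2_norm_le_of_sq_norm_le) (use h K in auto)
qed

section \<open>Probability of the bad events\<close>

text \<open>The nested intervals with index 0 have a common point. Nonemptiness matters because
  \<open>infdist\<close> to the empty set is 0, which would make the neighborhood the whole
  line.\<close>

lemma cantor_set_nonempty:
  assumes w: "\<And>n. valid_choice M A n w" and A: "A > 0" and M: "M > 0"
  shows "cantor_set M w \<noteq> {}"
proof -
  define I where "I n = {real (cantor_pos M A w n 0) / real M ^ n..real (cantor_pos M A w n 0) / real M ^ n + 1 / real M ^ n}" for n
  have "(\<Inter>n. I n) \<noteq> {}"
  proof (rule compact_nest)
    show "compact (I n)" "I n \<noteq> {}" for n using M by (simp_all add: I_def)
    have "I (Suc n) \<subseteq> I n" for n
    proof -
      let ?d = "sorted_list_of_set (w (Suc n) 0) ! 0"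
      have "?d < M" using A by (intro alphabet_digits(4)[of _ M A] valid_choiceD[OF w[of "Suc n"]]) auto
      then have "real (cantor_pos M A w (Suc n) 0) \<ge> real M * real (cantor_pos M A w n 0)"
        "real (cantor_pos M A w (Suc n) 0) + 1 \<le> real M * (real (cantor_pos M A w n 0) + 1)"
        by (simp_all add: algebra_simps)
      then have "real M * real (cantor_pos M A w n 0) / real M ^ Suc n \<le> real (cantor_pos M A w (Suc n) 0) / real M ^ Suc n"
        "(real (cantor_pos M A w (Suc n) 0) + 1) / real M ^ Suc n \<le> real M * (real (cantor_pos M A w n 0) + 1) / real M ^ Suc n"
        by (intro divide_right_mono; simp)+
      then show ?thesis
        using M unfolding I_def by (auto simp: add_divide_distrib)
    qed
    then show "I n \<subseteq> I m" if "m \<le> n" for m n using that by (rule lift_Suc_antimono_le)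
  qed
  then obtain x where x: "\<And>n. x \<in> I n" by auto
  have "x \<in> cantor_set M w"
    unfolding cantor_set_def
  proof
    fix n :: nat
    have "cantor_point M A w n 0 \<in> cantor_points M w n"
      unfolding cantor_points_eq[OF w M] using A by (intro imageI) auto
    then show "x \<in> (\<Union>b\<in>cantor_points M w n. {b..b + 1 / real M ^ n})"
      using x[of n] by (intro UN_I) (auto simp: I_def)
  qed
  then show ?thesis by auto
qed

lemma cantor_set_subset:
  assumes w: "valid_choice M A n w" and M: "M > 0" and n: "n > 0"
  shows "cantor_set M w \<subseteq> (\<Union>x<A ^ n. {cantor_point M A w n x..cantor_point M A w n x + 1 / real (M ^ n)})"
proof -
  have "cantor_set M w \<subseteq> (\<Union>b\<in>cantor_points M w n. {b..b + 1 / real M ^ n})"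
    unfolding cantor_set_def using n by (intro INT_lower) auto
  then show ?thesis unfolding cantor_points_eq[OF w M] by simp
qed

lemma closed_cantor_set:
  assumes w: "\<And>n. valid_choice M A n w" and M: "M > 0"
  shows "closed (cantor_set M w)"
  unfolding cantor_set_def cantor_points_eq[OF w M] by (intro closed_INT ballI closed_UN) auto

text \<open>A nearest point of the Cantor set lies within M^(-n) <= h to the right of some b, which
  accounts for the asymmetric margins h and 2h.\<close>

lemma neighborhood_cover:
  assumes w: "\<And>n. valid_choice M A n w" and A: "A > 0" and M: "M > 0" and n: "n > 0" and h: "1 / real (M ^ n) \<le> h"
  shows "neighborhood (cantor_set M w) h
    \<subseteq> (\<Union>x<A ^ n. {cantor_point M A w n x - h..cantor_point M A w n x + 2 * h})"
proof
  fix x assume "x \<in> neighborhood (cantor_set M w) h"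
  moreover obtain c where c: "c \<in> cantor_set M w" "infdist x (cantor_set M w) = dist x c"
    using infdist_attains_inf[OF closed_cantor_set[OF w M] cantor_set_nonempty[OF w A M]] by blast
  ultimately have "\<bar>x - c\<bar> \<le> h" by (simp add: neighborhood_def dist_real_def)
  moreover obtain y where "y < A ^ n" "c \<in> {cantor_point M A w n y..cantor_point M A w n y + 1 / real (M ^ n)}"
    using subsetD[OF cantor_set_subset[OF w M n] c(1)] by auto
  ultimately show "x \<in> (\<Union>x<A ^ n. {cantor_point M A w n x - h..cantor_point M A w n x + 2 * h})"
    using h by (intro UN_I[of y]) auto
qed

lemma neighborhood_borel: "neighborhood X h \<in> sets borel"
proof -
  have "closed {x. infdist x X \<le> h}" by (intro closed_Collect_le continuous_intros)
  then show ?thesis by (simp add: neighborhood_def borel_closed)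
qed

section \<open>Events decided by finitely many generations\<close>

lemma level_ok_cong:
  assumes "\<And>i. 1 \<le> i \<Longrightarrow> i \<le> n \<Longrightarrow> w i = w' i" and j: "j \<le> n"
  shows "level_ok M A n \<theta> p k c w j = level_ok M A n \<theta> p k c w' j"
proof -
  have pos: "cantor_pos M A w m = cantor_pos M A w' m" if "m \<le> n" for m
    using that assms(1) by (intro ext cantor_pos_cong) auto
  then have "outer_pos M A n k c w = outer_pos M A n k c w'"
    by (intro ext) (simp add: outer_pos_def)
  then show ?thesis using pos[OF j] by (simp add: level_ok_def)
qed

lemma bad_level_cong:
  assumes "\<And>i. 1 \<le> i \<Longrightarrow> i \<le> n \<Longrightarrow> w i = w' i" and "I \<in> level_indices M A n"
  shows "bad_level M A n p w I = bad_level M A n p w' I"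
  using assms(2) level_ok_cong[of n w w' _ M A, OF assms(1)]
  by (auto simp: bad_level_def level_indices_def Let_def)

lemma level_ok_resample:
  assumes "A > 0" "k \<le> j" "j < n"
  shows "level_ok M A n \<theta> p k c (resample (Suc j) (block A k c j) \<sigma> w) j = level_ok M A n \<theta> p k c w j"
  unfolding level_ok_def outer_pos_resample[OF assms] by (simp add: cantor_pos_resample_below)

lemma resample_restrict_resample:
  assumes "\<sigma> \<in> extensional Q"
  shows "resample j Q (restrict (w j) Q) (resample j Q \<sigma> w) = w" "restrict (resample j Q \<sigma> w j) Q = \<sigma>"
  using assms by (auto simp: resample_def fun_eq_iff extensional_def)

abbreviation level_choices :: "nat \<Rightarrow> nat \<Rightarrow> nat \<Rightarrow> (nat \<Rightarrow> nat \<Rightarrow> nat set) set" where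
  "level_choices M A n \<equiv> \<Pi>\<^sub>E j\<in>{1..n}. choices M A j"

lemma resample_in_choices:
  assumes w: "w \<in> level_choices M A n" and Q: "Q \<subseteq> {..<A ^ j}" and j: "j < n" and \<sigma>: "\<sigma> \<in> Q \<rightarrow>\<^sub>E alphabets M A"
  shows "resample (Suc j) Q \<sigma> w \<in> level_choices M A n" "restrict (w (Suc j)) Q \<in> Q \<rightarrow>\<^sub>E alphabets M A"
proof -
  have wj: "w (Suc j) \<in> (\<Pi>\<^sub>E k\<in>{..<A ^ j}. alphabets M A)"
  proof -
    have "w (Suc j) \<in> choices M A (Suc j)" using w by (rule PiE_mem) (use j in auto)
    then show ?thesis by (simp add: choices_def)
  qed
  then show "restrict (w (Suc j)) Q \<in> Q \<rightarrow>\<^sub>E alphabets M A"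
    using Q by auto
  have "(\<lambda>i. if i \<in> Q then \<sigma> i else w (Suc j) i) \<in> choices M A (Suc j)"
    using wj \<sigma> Q by (auto simp: choices_def PiE_iff extensional_def)
  then show "resample (Suc j) Q \<sigma> w \<in> level_choices M A n"
    using w j unfolding resample_def by (auto simp: PiE_iff extensional_def)
qed

lemma finite_choices: "finite (choices M A j)"
  unfolding choices_def by (intro finite_PiE finite_alphabets) simp

lemma choices_nonempty: "A \<le> M \<Longrightarrow> choices M A j \<noteq> {}"
  using alphabets_nonempty[of A M] by (auto simp: choices_def PiE_eq_empty_iff)

lemma valid_choice_of_choices: "w \<in> level_choices M A n \<Longrightarrow> valid_choice M A n w"
  unfolding valid_choice_def choices_def by (auto dest!: PiE_mem)

lemma card_filter_eq_sum: "finite S \<Longrightarrow> real (card {x \<in> S. P x}) = (\<Sum>x\<in>S. of_bool (P x))"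
  by (simp add: of_bool_def sum.inter_filter[symmetric])

text \<open>Fubini by counting: for uniform w, an independent resampling of the block leaves w
  uniform. Hence the proportion of bad w is the average of the conditional proportions already
  bounded, in which \<open>level_ok\<close> at generation j is unaffected by the resampling.\<close>

lemma card_bad_level_le:
  assumes A: "A > 0" "A \<le> M" and p: "p > 0" and I: "I \<in> level_indices M A n"
  shows "real (card {w \<in> level_choices M A n. bad_level M A n p w I})
    \<le> real (card (level_choices M A n)) * (real (A ^ n) * exp (- 2 * real p))"
proof -
  obtain i k c j where Ieq: "I = (i, k, c, j)" by (cases I) auto
  with I have ij: "M ^ (2 * n - 1) \<le> i" "i \<le> M ^ (2 * n)" "k \<le> j" "j < n" "c < A ^ k"
    by (auto simp: level_indices_def)
  have M: "M > 0" using A by simp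
  define \<theta> where "\<theta> = real i / real (M ^ (2 * n))"
  have \<theta>: "1 / real M \<le> \<theta>" "\<theta> \<le> 1"
    unfolding \<theta>_def using net_point_bounds[OF M _ ij(1,2)] ij(4) by auto
  define Q where "Q = block A k c j"
  define F where "F = level_choices M A n"
  define \<Sigma> where "\<Sigma> = Q \<rightarrow>\<^sub>E alphabets M A"
  define B where "B w \<longleftrightarrow> level_ok M A n \<theta> p k c w j \<and> \<not> level_ok M A n \<theta> p k c w (Suc j)" for w
  have Q: "Q \<subseteq> {..<A ^ j}" using block_less[OF A(1) ij(3) ij(5)] by (auto simp: Q_def)
  have finF: "finite F" unfolding F_def by (intro finite_PiE finite_choices) simp
  have fin\<Sigma>: "finite \<Sigma>" unfolding \<Sigma>_def Q_def block_def by (intro finite_PiE finite_alphabets) simp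
  have "\<Sigma> \<noteq> {}" using alphabets_nonempty[OF A(2)] by (auto simp: \<Sigma>_def PiE_eq_empty_iff)
  then have card\<Sigma>: "real (card \<Sigma>) > 0" using fin\<Sigma> by (simp add: card_gt_0_iff)
  have ext: "\<sigma> \<in> extensional Q" if "\<sigma> \<in> \<Sigma>" for \<sigma> using that by (auto simp: \<Sigma>_def PiE_def)
  have bad: "bad_level M A n p w I = B w" for w by (simp add: B_def bad_level_def Ieq \<theta>_def Let_def)
  have res: "resample (Suc j) Q \<sigma> w \<in> F" "restrict (w (Suc j)) Q \<in> \<Sigma>"
      "resample (Suc j) Q (restrict (w (Suc j)) Q) (resample (Suc j) Q \<sigma> w) = w"
      "restrict (resample (Suc j) Q \<sigma> w (Suc j)) Q = \<sigma>" if "w \<in> F" "\<sigma> \<in> \<Sigma>" for w \<sigma>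
    using resample_in_choices[OF that(1)[unfolded F_def] Q ij(4) that(2)[unfolded \<Sigma>_def]]
      resample_restrict_resample[OF ext[OF that(2)]]
    unfolding F_def \<Sigma>_def by auto
  have "real (card \<Sigma>) * real (card {w \<in> F. B w}) = (\<Sum>w\<in>F. \<Sum>\<sigma>\<in>\<Sigma>. of_bool (B w))"
    unfolding card_filter_eq_sum[OF finF] by (simp add: sum_distrib_left)
  also have "\<dots> = (\<Sum>(w, \<sigma>)\<in>F \<times> \<Sigma>. of_bool (B w))" by (rule sum.cartesian_product)
  \<comment> \<open>Exchanging the alphabets of w in the block with the fresh sample is its own
    inverse on pairs.\<close>
  also have "\<dots> = (\<Sum>(w, \<sigma>)\<in>F \<times> \<Sigma>. of_bool (B (resample (Suc j) Q \<sigma> w)))"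
    by (rule sum.reindex_bij_witness[of _ "\<lambda>(w, \<sigma>). (resample (Suc j) Q \<sigma> w, restrict (w (Suc j)) Q)"
          "\<lambda>(w, \<sigma>). (resample (Suc j) Q \<sigma> w, restrict (w (Suc j)) Q)"])
      (clarsimp simp del: restrict_apply simp: res)+
  also have "\<dots> = (\<Sum>w\<in>F. \<Sum>\<sigma>\<in>\<Sigma>. of_bool (B (resample (Suc j) Q \<sigma> w)))"
    by (rule sum.cartesian_product[symmetric])
  also have "\<dots> = (\<Sum>w\<in>F. real (card {\<sigma> \<in> \<Sigma>. B (resample (Suc j) Q \<sigma> w)}))"
    unfolding card_filter_eq_sum[OF fin\<Sigma>] ..
  also have "\<dots> \<le> (\<Sum>w\<in>F. real (card \<Sigma>) * real (A ^ n) * exp (- 2 * real p))"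
  proof (rule sum_mono)
    fix w assume "w \<in> F"
    then have "valid_choice M A n w" unfolding F_def by (rule valid_choice_of_choices)
    from card_resample_bad_le[OF this A ij(3,4,5) \<theta> p]
    show "real (card {\<sigma> \<in> \<Sigma>. B (resample (Suc j) Q \<sigma> w)}) \<le> real (card \<Sigma>) * real (A ^ n) * exp (- 2 * real p)"
      unfolding Q_def \<Sigma>_def B_def level_ok_resample[OF A(1) ij(3,4)] .
  qed
  also have "\<dots> = real (card \<Sigma>) * (real (card F) * (real (A ^ n) * exp (- 2 * real p)))" by simp
  finally have "real (card {w \<in> F. B w}) \<le> real (card F) * (real (A ^ n) * exp (- 2 * real p))"
    using card\<Sigma> by (simp only: mult_le_cancel_left_pos)
  then show ?thesis unfolding F_def bad .
qed


section \<open>From counts to the product measure\<close>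

lemma measure_PiM_uniform_count:
  assumes J: "finite J" and S: "\<And>j. j \<in> J \<Longrightarrow> finite (S j)" "\<And>j. j \<in> J \<Longrightarrow> S j \<noteq> {}" and X: "X \<subseteq> (\<Pi>\<^sub>E j\<in>J. S j)"
  shows "measure (\<Pi>\<^sub>M j\<in>J. uniform_count_measure (S j)) X = real (card X) / real (card (\<Pi>\<^sub>E j\<in>J. S j))"
    and "X \<in> sets (\<Pi>\<^sub>M j\<in>J. uniform_count_measure (S j))"
proof -
  \<comment> \<open>The product locale requires a probability space at every index; outside J a
    one-point space fills the gap.\<close>
  define N where "N j = (if j \<in> J then uniform_count_measure (S j) else count_space {undefined})" for j
  interpret N: prob_space "N j" for j
    using S by (cases "j \<in> J") (auto simp: N_def prob_space_uniform_count_measure intro!: prob_spaceI)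
  interpret P: finite_product_prob_space N J by unfold_locales (rule J)
  have eq: "(\<Pi>\<^sub>M j\<in>J. uniform_count_measure (S j)) = PiM J N"
    by (rule PiM_cong) (auto simp: N_def)
  have finX: "finite X" by (rule finite_subset[OF X finite_PiE[OF J S(1)]])
  have single: "{x} \<in> sets (PiM J N)" "measure (PiM J N) {x} = 1 / real (card (\<Pi>\<^sub>E j\<in>J. S j))" if x: "x \<in> X" for x
  proof -
    have xS: "x \<in> (\<Pi>\<^sub>E j\<in>J. S j)" using X x by auto
    then have ss: "{x} = (\<Pi>\<^sub>E j\<in>J. {x j})" by (intro PiE_singleton[symmetric]) (auto simp: PiE_def)
    have mem: "{x j} \<in> sets (N j)" if "j \<in> J" for j
      using that xS by (auto simp: N_def sets_uniform_count_measure)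
    show "{x} \<in> sets (PiM J N)" unfolding ss by (rule sets_PiM_I_finite[OF J mem])
    have "measure (PiM J N) {x} = (\<Prod>j\<in>J. measure (N j) {x j})"
      unfolding ss by (rule P.finite_measure_PiM_emb) (use mem in auto)
    also have "\<dots> = (\<Prod>j\<in>J. 1 / real (card (S j)))"
    proof (rule prod.cong[OF refl])
      fix j assume j: "j \<in> J"
      then have "x j \<in> S j" using xS by auto
      then show "measure (N j) {x j} = 1 / real (card (S j))"
        using j S by (simp add: N_def measure_uniform_count_measure)
    qed
    also have "\<dots> = 1 / real (card (\<Pi>\<^sub>E j\<in>J. S j))"
      by (simp add: card_PiE[OF J] prod_dividef)
    finally show "measure (PiM J N) {x} = 1 / real (card (\<Pi>\<^sub>E j\<in>J. S j))" .
  qed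
  have "(\<Union>x\<in>X. {x}) \<in> sets (PiM J N)" using finX single(1) by (intro sets.finite_UN) auto
  then show "X \<in> sets (\<Pi>\<^sub>M j\<in>J. uniform_count_measure (S j))" by (simp add: eq)
  have "measure (PiM J N) X = (\<Sum>x\<in>X. measure (PiM J N) {x})"
    using finX single(1) by (rule P.finite_measure_eq_sum_singleton)
  then show "measure (\<Pi>\<^sub>M j\<in>J. uniform_count_measure (S j)) X = real (card X) / real (card (\<Pi>\<^sub>E j\<in>J. S j))"
    unfolding eq using single(2) by simp
qed

lemma space_choice_space: "space (choice_space M A) = (\<Pi>\<^sub>E j\<in>{1..}. choices M A j)"
  by (simp add: choice_space_def space_PiM space_uniform_count_measure)

lemma prob_space_choice_space:
  assumes "A \<le> M"
  shows "prob_space (choice_space M A)"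
  unfolding choice_space_def
  by (intro prob_space_PiM prob_space_uniform_count_measure finite_choices choices_nonempty assms)

lemma measure_choice_space:
  assumes A: "A \<le> M" and cong: "\<And>w w'. (\<And>i. 1 \<le> i \<Longrightarrow> i \<le> n \<Longrightarrow> w i = w' i) \<Longrightarrow> P w = P w'"
  shows "{w \<in> space (choice_space M A). P w} \<in> sets (choice_space M A)"
    and "measure (choice_space M A) {w \<in> space (choice_space M A). P w}
      = real (card {w \<in> level_choices M A n. P w}) / real (card (level_choices M A n))"
proof -
  define N where "N j = uniform_count_measure (choices M A j)" for j
  interpret N: prob_space "N j" for j
    unfolding N_def by (intro prob_space_uniform_count_measure finite_choices choices_nonempty A)
  interpret product_prob_space N "{1..}" by unfold_locales
  let ?X = "{w \<in> level_choices M A n. P w}"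
  have eq: "{w \<in> space (choice_space M A). P w} = prod_emb {1..} N {1..n} ?X"
  proof -
    have "P (restrict w {1..n}) = P w" for w by (rule cong) auto
    then show ?thesis
      unfolding space_choice_space prod_emb_def N_def space_uniform_count_measure
      by (auto simp: space_PiM space_uniform_count_measure)
  qed
  have cs: "choice_space M A = PiM {1..} N" by (simp add: choice_space_def N_def[abs_def])
  have sets: "?X \<in> sets (PiM {1..n} N)"
    unfolding N_def by (rule measure_PiM_uniform_count(2)) (use finite_choices choices_nonempty[OF A] in auto)
  show "{w \<in> space (choice_space M A). P w} \<in> sets (choice_space M A)"
    unfolding eq unfolding cs by (rule measurable_prod_emb[OF _ sets]) auto
  show "measure (choice_space M A) {w \<in> space (choice_space M A). P w}
      = real (card {w \<in> level_choices M A n. P w}) / real (card (level_choices M A n))"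
  proof -
    have "emeasure (choice_space M A) {w \<in> space (choice_space M A). P w} = emeasure (PiM {1..n} N) ?X"
      unfolding eq unfolding cs by (rule emeasure_PiM_emb'[OF _ _ sets]) auto
    then have "measure (choice_space M A) {w \<in> space (choice_space M A). P w} = measure (PiM {1..n} N) ?X"
      by (simp add: measure_def)
    also have "\<dots> = real (card ?X) / real (card (level_choices M A n))"
      unfolding N_def by (rule measure_PiM_uniform_count(1)) (use finite_choices choices_nonempty[OF A] in auto)
    finally show ?thesis .
  qed
qed


text \<open>Since exp (-2p) <= M^(-8n) exp (-M^\<epsilon>), this order beats the M^(6n) events and
  the dimension A^n <= M^n, and leaves a factor M^(-n) that is summable over n.\<close>

definition moment_order :: "nat \<Rightarrow> real \<Rightarrow> nat \<Rightarrow> nat" where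
  "moment_order M \<epsilon> n = nat \<lceil>4 * real n * ln (real M) + real M powr \<epsilon>\<rceil>"

definition bad_event :: "nat \<Rightarrow> nat \<Rightarrow> real \<Rightarrow> nat \<Rightarrow> (nat \<Rightarrow> nat \<Rightarrow> nat set) set" where
  "bad_event M A \<epsilon> n = (\<Union>I\<in>level_indices M A n. {w \<in> space (choice_space M A). bad_level M A n (moment_order M \<epsilon> n) w I})"

lemma level_indices_bound:
  assumes "2 \<le> M" "A > 0" "A \<le> M" "n > 0"
  shows "finite (level_indices M A n)" "card (level_indices M A n) \<le> M ^ (6 * n)"
proof -
  let ?T = "{..M ^ (2 * n)} \<times> {..<n} \<times> {..<A ^ n} \<times> {..<n}"
  have sub: "level_indices M A n \<subseteq> ?T"
  proof
    fix I assume "I \<in> level_indices M A n"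
    then obtain i k c j where I: "I = (i, k, c, j)" "i \<le> M ^ (2 * n)" "k \<le> j" "j < n" "c < A ^ k"
      by (auto simp: level_indices_def)
    have "A ^ k \<le> A ^ n" using I assms by (intro power_increasing) auto
    then show "I \<in> ?T" using I by auto
  qed
  then show "finite (level_indices M A n)" by (rule finite_subset) simp
  have "card (level_indices M A n) \<le> card ?T" by (rule card_mono[OF _ sub]) simp
  also have "card ?T = Suc (M ^ (2 * n)) * (n * (A ^ n * n))" by simp
  also have "\<dots> \<le> M ^ (3 * n) * (M ^ n * (M ^ n * M ^ n))"
  proof (intro mult_le_mono)
    have "n < 2 ^ n" by (rule less_exp)
    also have "2 ^ n \<le> M ^ n" using assms by (intro power_mono) auto
    finally show "n \<le> M ^ n" "n \<le> M ^ n" by simp_all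
    show "A ^ n \<le> M ^ n" using assms by (intro power_mono) auto
    have "Suc (M ^ (2 * n)) \<le> 2 * M ^ (2 * n)" using assms by simp
    also have "\<dots> \<le> M ^ n * M ^ (2 * n)"
    proof (rule mult_le_mono1)
      have "M ^ 1 \<le> M ^ n" using assms by (intro power_increasing) auto
      then show "2 \<le> M ^ n" using assms by simp
    qed
    also have "\<dots> = M ^ (3 * n)" by (simp add: power_add[symmetric])
    finally show "Suc (M ^ (2 * n)) \<le> M ^ (3 * n)" .
  qed
  also have "\<dots> = M ^ (6 * n)" by (simp add: power_add[symmetric])
  finally show "card (level_indices M A n) \<le> M ^ (6 * n)" .
qed

lemma measure_bad_event_le:
  assumes M: "2 \<le> M" and A: "A > 0" "A \<le> M" and n: "n > 0"
  shows "bad_event M A \<epsilon> n \<in> sets (choice_space M A)"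
    and "measure (choice_space M A) (bad_event M A \<epsilon> n) \<le> exp (- (real M powr \<epsilon>)) * (1 / 2) ^ n"
proof -
  interpret prob_space "choice_space M A" by (rule prob_space_choice_space[OF A(2)])
  let ?p = "moment_order M \<epsilon> n"
  let ?E = "\<lambda>I. {w \<in> space (choice_space M A). bad_level M A n ?p w I}"
  note fin = level_indices_bound(1)[OF M A n]
  have sets: "?E I \<in> sets (choice_space M A)" if "I \<in> level_indices M A n" for I
    using that by (intro measure_choice_space(1)[OF A(2), of n] bad_level_cong) auto
  show "bad_event M A \<epsilon> n \<in> sets (choice_space M A)"
    unfolding bad_event_def using sets by (intro sets.finite_UN fin) auto
  have lnM: "ln (real M) > 0" using M by simp
  have p_ge: "4 * real n * ln (real M) + real M powr \<epsilon> \<le> real ?p"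
    unfolding moment_order_def by (rule real_nat_ceiling_ge)
  moreover have "0 < 4 * real n * ln (real M)" using n lnM by simp
  moreover have "0 \<le> real M powr \<epsilon>" by simp
  ultimately have "real ?p > 0" by linarith
  then have p: "?p > 0" by simp
  have single: "measure (choice_space M A) (?E I) \<le> real (A ^ n) * exp (- 2 * real ?p)" if I: "I \<in> level_indices M A n" for I
  proof -
    let ?F = "level_choices M A n"
    have "finite ?F" by (intro finite_PiE finite_choices) simp
    moreover have "?F \<noteq> {}" using choices_nonempty[OF A(2)] by (simp add: PiE_eq_empty_iff)
    ultimately have F: "real (card ?F) > 0" by (simp add: card_gt_0_iff)
    have "measure (choice_space M A) (?E I) = real (card {w \<in> ?F. bad_level M A n ?p w I}) / real (card ?F)"
      using I by (intro measure_choice_space(2)[OF A(2)] bad_level_cong) auto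
    also have "\<dots> \<le> real (card ?F) * (real (A ^ n) * exp (- 2 * real ?p)) / real (card ?F)"
      by (intro divide_right_mono card_bad_level_le A p I) simp
    finally show ?thesis using F by simp
  qed
  have "measure (choice_space M A) (bad_event M A \<epsilon> n) \<le> (\<Sum>I\<in>level_indices M A n. measure (choice_space M A) (?E I))"
    unfolding bad_event_def using sets by (intro finite_measure_subadditive_finite fin) auto
  also have "\<dots> \<le> (\<Sum>I\<in>level_indices M A n. real (A ^ n) * exp (- 2 * real ?p))"
    by (intro sum_mono single)
  also have "\<dots> = real (card (level_indices M A n)) * (real (A ^ n) * exp (- 2 * real ?p))" by simp
  also have "\<dots> \<le> real M ^ (6 * n) * (real M ^ n * (exp (- (8 * real n * ln (real M))) * exp (- (real M powr \<epsilon>))))"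
  proof (intro mult_mono)
    show "real (card (level_indices M A n)) \<le> real M ^ (6 * n)"
      using level_indices_bound(2)[OF M A n] by (metis of_nat_le_iff of_nat_power)
    show "real (A ^ n) \<le> real M ^ n" using A by (simp add: power_mono)
    have "- 2 * real ?p \<le> - (8 * real n * ln (real M)) + - (real M powr \<epsilon>)"
      using p_ge powr_ge_zero[of "real M" \<epsilon>] by linarith
    then show "exp (- 2 * real ?p) \<le> exp (- (8 * real n * ln (real M))) * exp (- (real M powr \<epsilon>))"
      by (simp only: exp_add[symmetric] exp_le_cancel_iff)
  qed auto
  also have "exp (- (8 * real n * ln (real M))) = 1 / real M ^ (8 * n)"
  proof -
    have "8 * real n * ln (real M) = ln (real M ^ (8 * n))" using M by (simp add: ln_realpow)
    moreover have "real M ^ (8 * n) > 0" using M by simp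
    ultimately show ?thesis by (simp add: exp_minus inverse_eq_divide)
  qed
  also have "real M ^ (6 * n) * (real M ^ n * (1 / real M ^ (8 * n) * exp (- (real M powr \<epsilon>)))) = exp (- (real M powr \<epsilon>)) * (1 / real M ^ n)"
  proof -
    have "real M ^ (8 * n) = real M ^ (6 * n) * real M ^ n * real M ^ n" by (simp add: power_add[symmetric])
    then show ?thesis using M by simp
  qed
  also have "\<dots> \<le> exp (- (real M powr \<epsilon>)) * (1 / 2) ^ n"
  proof (rule mult_left_mono)
    have "2 ^ n \<le> real M ^ n" using M by (intro power_mono) auto
    then show "1 / real M ^ n \<le> (1 / 2) ^ n" by (simp add: power_one_over frac_le)
  qed simp
  finally show "measure (choice_space M A) (bad_event M A \<epsilon> n) \<le> exp (- (real M powr \<epsilon>)) * (1 / 2) ^ n" .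
qed

section \<open>Assembly\<close>

text \<open>With x = M^\<epsilon>, the accumulated losses are at most 912^n x^5. Since x >= 912 and
  n >= 7, this is at most x^(2(n-1)), the square of the loss M^(\<epsilon>(n-1)) allowed in the
  norm.\<close>

lemma loss_le_power:
  assumes M: "2 \<le> M" and n: "9 \<le> n" and \<epsilon>: "0 < \<epsilon>" "\<epsilon> < 1"
    and big: "real M powr \<epsilon> \<ge> 912" "real M powr \<epsilon> \<ge> 1 / \<epsilon>"
  shows "6 * (real n + 1)\<^sup>2 * 19 ^ n * level_weight M n * real (moment_order M \<epsilon> n) \<le> (real M powr \<epsilon>) ^ (2 * (n - 1))"
proof -
  define x where "x = real M powr \<epsilon>"
  define L where "L = ln (real M)"
  have x: "x \<ge> 912" "x \<ge> 1 / \<epsilon>" using big by (simp_all add: x_def)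
  have lnx: "ln x = \<epsilon> * L" using M by (simp add: x_def L_def ln_powr)
  have "ln x \<ge> ln (exp 1)" using x exp_le by (intro ln_mono) auto
  then have "\<epsilon> * L \<ge> 1" using lnx by simp
  then have "L > 0" using \<epsilon> by (smt (verit) mult_nonneg_nonpos)
  then have "\<epsilon> * L \<le> 1 * L" using \<epsilon> by (intro mult_right_mono) auto
  then have L1: "L \<ge> 1" using \<open>\<epsilon> * L \<ge> 1\<close> by simp
  \<comment> \<open>The threshold x >= 1/\<epsilon> serves here: it trades the logarithm of M for
    x^2 with no constant depending on \<epsilon>.\<close>
  have "L = ln x * (1 / \<epsilon>)" using lnx \<epsilon> by simp
  also have "\<dots> \<le> x * x"
  proof (intro mult_mono)
    have "x > 0" using x by simp
    then show "ln x \<le> x" using ln_le_minus_one[of x] by simp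
  qed (use x \<epsilon> in auto)
  finally have Lx: "L \<le> x\<^sup>2" by (simp add: power2_eq_square)
  define y where "y = real n * L"
  have y: "y \<ge> 1" using n L1 mult_mono[of 1 "real n" 1 L] by (simp add: y_def)
  have w: "level_weight M n \<le> 48 * y" using y by (simp add: level_weight_def y_def L_def)
  have "real (moment_order M \<epsilon> n) \<le> 4 * y + x + 1"
    using y x unfolding moment_order_def y_def L_def x_def by (simp add: of_nat_nat mult.assoc)
  also have "\<dots> \<le> 4 * (y * x) + y * x + y * x"
  proof (intro add_mono mult_left_mono)
    have "y * 1 \<le> y * x" "1 * x \<le> y * x" "1 * 1 \<le> y * x" using x y by (intro mult_mono; simp)+
    then show "y \<le> y * x" "x \<le> y * x" "1 \<le> y * x" by simp_all
  qed simp
  finally have p: "real (moment_order M \<epsilon> n) \<le> 6 * (y * x)" by linarith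
  have n2: "real n + 1 \<le> 2 ^ n"
  proof -
    have "n + 1 \<le> 2 ^ n" using less_exp[of n] by (metis Suc_eq_plus1 Suc_leI)
    then have "real (n + 1) \<le> real (2 ^ n)" by (simp only: of_nat_le_iff)
    then show ?thesis by simp
  qed
  have "6 * (real n + 1)\<^sup>2 * 19 ^ n * level_weight M n * real (moment_order M \<epsilon> n)
      \<le> 6 * (2 ^ n)\<^sup>2 * 19 ^ n * (48 * y) * (6 * (y * x))"
    using n2 w p y x level_weight_ge[of M n] M by (intro mult_mono power_mono) auto
  also have "\<dots> = 1728 * (2 ^ n)\<^sup>2 * 19 ^ n * ((real n)\<^sup>2 * L\<^sup>2) * x"
    by (simp add: y_def power2_eq_square)
  also have "\<dots> \<le> 3 ^ n * (2 ^ n)\<^sup>2 * 19 ^ n * ((2 ^ n)\<^sup>2 * (x\<^sup>2)\<^sup>2) * x"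
  proof (intro mult_mono power_mono)
    have "(1728::real) \<le> 3 ^ 9" by simp
    also have "\<dots> \<le> 3 ^ n" using n by (intro power_increasing) auto
    finally show "(1728::real) \<le> 3 ^ n" .
  qed (use n2 Lx L1 x in auto)
  \<comment> \<open>912 = 3 * 4 * 19 * 4: 3^n covers the constant 1728 = 6 * 48 * 6, the two powers
    of 4 cover (n+1)^2 and n^2, and 19^n is the Chernoff loss. In x^5, four factors come from L^2
    and one from the moment order.\<close>
  also have "\<dots> = 912 ^ n * x ^ 5"
  proof -
    have "(912::real) ^ n = (3 * 4 * 19 * 4) ^ n" by simp
    also have "\<dots> = 3 ^ n * 4 ^ n * 19 ^ n * 4 ^ n" by (simp only: power_mult_distrib)
    finally have "(912::real) ^ n = 3 ^ n * (2 ^ n)\<^sup>2 * 19 ^ n * (2 ^ n)\<^sup>2"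
      by (simp add: power_mult[symmetric] mult.commute[of n 2]) (simp add: power_mult)
    then show ?thesis by (simp add: power_mult[symmetric] eval_nat_numeral)
  qed
  also have "\<dots> \<le> x ^ n * x ^ 5" using x by (intro mult_right_mono power_mono) auto
  also have "\<dots> = x ^ (n + 5)" by (simp add: power_add)
  also have "\<dots> \<le> x ^ (2 * (n - 1))" using x n by (intro power_increasing) auto
  finally show ?thesis by (simp add: x_def)
qed

text \<open>Everything is written as powers of M^(n-1) < 1/h: the loss gives 2\<epsilon> and A^(n+3)
  gives 3\<delta>/2. Together with the prefactor h this is the square of h^(1/2 - 3\<delta>/4 -
  \<epsilon>).\<close>

lemma final_bound:
  assumes \<delta>: "0 < \<delta>" and A: "real A = real M powr \<delta>" and M: "2 \<le> M" and n: "9 \<le> n" and \<epsilon>: "0 < \<epsilon>" "\<epsilon> < 1"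
    and big: "real M powr \<epsilon> \<ge> 912" "real M powr \<epsilon> \<ge> 1 / \<epsilon>" and h: "0 < h" "h < 1 / real (M ^ (n - 1))"
  shows "sqrt (9 * h / (2 * pi) * (4 * (real n + 1)\<^sup>2 * (real A * level_bound M A n (moment_order M \<epsilon> n) n)))
    \<le> h powr (1 / 2 - 3 / 4 * \<delta> - \<epsilon>)"
proof (rule real_le_lsqrt)
  let ?p = "real (moment_order M \<epsilon> n)" and ?w = "level_weight M n" and ?a = "1 / 2 - 3 / 4 * \<delta> - \<epsilon>"
  define s where "s = 3 / 2 * \<delta> + 2 * \<epsilon>"
  define Z where "Z = 6 * (real n + 1)\<^sup>2 * 19 ^ n * ?w * ?p"
  have w: "?w \<ge> 32" using M by (intro level_weight_ge) simp
  then have Z0: "Z \<ge> 0" by (simp add: Z_def)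
  have "9 * h / (2 * pi) * (4 * (real n + 1)\<^sup>2 * (real A * level_bound M A n (moment_order M \<epsilon> n) n))
      = h * (18 / pi * (real n + 1)\<^sup>2 * 19 ^ n * ?w * ?p) * real A ^ (n + 3)"
    by (simp add: level_bound_def power_add power2_eq_square eval_nat_numeral)
  also have "\<dots> \<le> h * Z * real A ^ (n + 3)"
  proof -
    have "18 / pi \<le> 6" using pi_gt3 by (simp add: field_simps)
    then show ?thesis using h w unfolding Z_def by (intro mult_right_mono mult_left_mono) auto
  qed
  also have "\<dots> \<le> h * (real M powr \<epsilon>) ^ (2 * (n - 1)) * real A ^ (n + 3)"
    unfolding Z_def using h by (intro mult_right_mono mult_left_mono loss_le_power M n \<epsilon> big) auto
  also have "\<dots> \<le> h * real M powr (2 * \<epsilon> * real (n - 1)) * real M powr (3 / 2 * \<delta> * real (n - 1))"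
  proof (intro mult_mono mult_left_mono)
    have pow: "(real M powr t) ^ k = real M powr (t * real k)" for t k
      using M by (simp add: powr_realpow[symmetric] powr_powr)
    show "(real M powr \<epsilon>) ^ (2 * (n - 1)) \<le> real M powr (2 * \<epsilon> * real (n - 1))"
      unfolding pow by (simp add: mult.assoc mult.left_commute)
    have "\<delta> * (2 * real (n + 3)) \<le> \<delta> * (3 * real (n - 1))"
      using n \<delta> by (intro mult_left_mono) auto
    then have "real M powr (\<delta> * real (n + 3)) \<le> real M powr (3 / 2 * \<delta> * real (n - 1))"
      using M by (intro powr_mono) (auto simp: algebra_simps)
    then show "real A ^ (n + 3) \<le> real M powr (3 / 2 * \<delta> * real (n - 1))"
      unfolding A pow .
  qed (use h in auto)
  also have "\<dots> = h * real M powr (s * real (n - 1))"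
    by (simp add: s_def distrib_right powr_add)
  also have "\<dots> \<le> h * h powr (- s)"
  proof (intro mult_left_mono)
    have "real M powr (s * real (n - 1)) = real (M ^ (n - 1)) powr s"
      using M by (simp add: powr_realpow[symmetric] powr_powr mult.commute)
    also have "\<dots> \<le> (1 / h) powr s"
      using h M \<delta> \<epsilon> by (intro powr_mono2) (auto simp: s_def field_simps)
    also have "\<dots> = h powr (- s)" using h by (simp add: powr_divide powr_minus_divide)
    finally show "real M powr (s * real (n - 1)) \<le> h powr (- s)" .
  qed (use h in simp)
  also have "\<dots> = h powr 1 * h powr (- s)" using h by simp
  also have "\<dots> = (h powr ?a)\<^sup>2"
  proof -
    have e: "1 + - s = ?a + ?a" by (simp add: s_def)
    show ?thesis unfolding power2_eq_square powr_add[symmetric] e ..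
  qed
  finally show "9 * h / (2 * pi) * (4 * (real n + 1)\<^sup>2 * (real A * level_bound M A n (moment_order M \<epsilon> n) n)) \<le> (h powr ?a)\<^sup>2" .
qed simp


lemma opnorm_le_outside_bad_event:
  assumes \<delta>: "0 < \<delta>" and A: "real A = real M powr \<delta>" "A > 0" "A \<le> M" and M: "2 \<le> M" and \<epsilon>: "0 < \<epsilon>" "\<epsilon> < 1"
    and big: "real M powr \<epsilon> \<ge> 912" "real M powr \<epsilon> \<ge> 1 / \<epsilon>"
    and w: "w \<in> space (choice_space M A)" and good: "\<And>n. n \<ge> 9 \<Longrightarrow> w \<notin> bad_event M A \<epsilon> n"
    and h: "0 < h" "h < 1 / real M ^ 8"
  shows "L2_opnorm (cutoff_fourier (neighborhood (cantor_set M w) h) h) \<le> ennreal (h powr (1 / 2 - 3 / 4 * \<delta> - \<epsilon>))"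
proof -
  have M0: "M > 0" using M by simp
  have valid: "valid_choice M A n w" for n
    unfolding valid_choice_def
  proof (intro ballI allI impI)
    fix j k assume jk: "j \<in> {1..n}" "k < A ^ (j - 1)"
    have "w j \<in> choices M A j" using w unfolding space_choice_space by (rule PiE_mem) (use jk in auto)
    then show "w j k \<in> alphabets M A" unfolding choices_def by (rule PiE_mem) (use jk in auto)
  qed
  have ex: "\<exists>n. 1 / real (M ^ n) \<le> h"
  proof -
    obtain n where "1 / h < real M ^ n" using real_arch_pow[of "real M" "1 / h"] M by auto
    then have "1 / real (M ^ n) \<le> h" using h M by (simp add: field_simps)
    then show ?thesis by blast
  qed
  \<comment> \<open>The least such n gives M^(-n) <= h < M^(-(n-1)), which is what places \<theta> =
    1 / (h M^n) in [1/M, 1].\<close>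
  define n where "n = (LEAST n. 1 / real (M ^ n) \<le> h)"
  have hn: "1 / real (M ^ n) \<le> h" unfolding n_def by (rule LeastI_ex[OF ex])
  have n9: "9 \<le> n"
  proof (rule ccontr)
    assume "\<not> 9 \<le> n"
    then have "real M ^ n \<le> real M ^ 8" using M by (intro power_increasing) auto
    then have "1 / real M ^ 8 \<le> 1 / real M ^ n" using M by (intro divide_left_mono) auto
    then show False using hn h by simp
  qed
  have hn1: "h < 1 / real (M ^ (n - 1))"
  proof -
    have "n - 1 < n" using n9 by simp
    then have "\<not> 1 / real (M ^ (n - 1)) \<le> h"
      unfolding n_def by (rule not_less_Least)
    then show ?thesis by simp
  qed
  define b where "b x = cantor_point M A w n x" for x
  define K where "K = 4 * (real n + 1)\<^sup>2 * (real A * level_bound M A n (moment_order M \<epsilon> n) n)"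
  have lb: "level_weight M n \<ge> 32" by (rule level_weight_ge[OF M0])
  then have K0: "K \<ge> 0" by (simp add: K_def level_bound_def)
  have p: "moment_order M \<epsilon> n > 0"
  proof -
    have "0 < 4 * real n * ln (real M)" using n9 M by simp
    moreover have "0 \<le> real M powr \<epsilon>" by simp
    ultimately have "0 < 4 * real n * ln (real M) + real M powr \<epsilon>" by linarith
    then show ?thesis by (simp add: moment_order_def)
  qed
  have no_bad: "\<forall>I\<in>level_indices M A n. \<not> bad_level M A n (moment_order M \<epsilon> n) w I"
    using good[OF n9] w by (auto simp: bad_event_def)
  have Mn: "real (M ^ n) = real M * real (M ^ (n - 1))"
    using n9 by (metis not_numeral_le_zero not_gr_zero of_nat_mult power_minus_mult mult.commute)
  have \<theta>: "1 / real M \<le> 1 / (h * real (M ^ n))" "1 / (h * real (M ^ n)) \<le> 1"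
  proof -
    have "h * real (M ^ (n - 1)) < 1" using hn1 M0 by (simp add: field_simps)
    then have "h * real (M ^ n) \<le> real M" unfolding Mn using M0 by (simp add: mult.left_commute)
    then show "1 / real M \<le> 1 / (h * real (M ^ n))" using h M0 by (intro divide_left_mono) auto
    show "1 / (h * real (M ^ n)) \<le> 1" using hn h M0 by (simp add: field_simps)
  qed
  have E: "(\<Sum>x<A ^ n. (cmod (\<Sum>y<A ^ n. cis (- (b x * b y / h)) * u y))\<^sup>2) \<le> K * (\<Sum>y<A ^ n. (cmod (u y))\<^sup>2)" for u
  proof -
    have "cis (- (b x * b y / h)) = dft_entry M A n (1 / (h * real (M ^ n))) w x y" for x y
      by (simp add: dft_entry_def b_def field_simps)
    then show ?thesis
      unfolding K_def using dft_bound[OF valid A(2,3) _ p no_bad \<theta>, of u] n9 by simp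
  qed
  have "L2_opnorm (cutoff_fourier (neighborhood (cantor_set M w) h) h) \<le> ennreal (sqrt (9 * h / (2 * pi) * K))"
  proof (rule opnorm_cutoff_fourier_le[OF h(1) K0 E])
    show "neighborhood (cantor_set M w) h \<in> sets borel" by (rule neighborhood_borel)
    show cover: "neighborhood (cantor_set M w) h \<subseteq> (\<Union>x<A ^ n. {b x - h..b x + 2 * h})"
      unfolding b_def using n9 by (intro neighborhood_cover valid A M0 hn) auto
    show "neighborhood (cantor_set M w) h \<subseteq> {- (1 + 2 * h)..1 + 2 * h}"
    proof
      fix x assume "x \<in> neighborhood (cantor_set M w) h"
      then obtain y where y: "y < A ^ n" "x \<in> {b y - h..b y + 2 * h}" using subsetD[OF cover] by blast
      have "real (cantor_pos M A w n y) \<le> real (M ^ n)"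
        using cantor_pos_less[OF valid y(1)] by (simp only: of_nat_le_iff less_imp_le)
      then have "b y \<le> 1" "0 \<le> b y" using M0 by (simp_all add: b_def)
      then show "x \<in> {- (1 + 2 * h)..1 + 2 * h}" using y(2) h by auto
    qed
  qed
  also have "\<dots> \<le> ennreal (h powr (1 / 2 - 3 / 4 * \<delta> - \<epsilon>))"
    unfolding K_def by (intro ennreal_leI final_bound \<delta> A M n9 \<epsilon> big h(1) hn1)
  finally show ?thesis .
qed

theorem theorem1p3:
  shows "\<exists>(C::real) (C\<^sub>1 :: real \<Rightarrow> real). C > 0 \<and> (\<forall>\<epsilon>>0. C\<^sub>1 \<epsilon> > 0) \<and>
    (\<forall>(\<delta>::real) (M::nat) (A::nat).
       0 < \<delta> \<longrightarrow> \<delta> < 2 / 3 \<longrightarrow> real M \<ge> 2 powr (4 / \<delta>) \<longrightarrow> real A = real M powr \<delta> \<longrightarrow>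
       (\<forall>\<epsilon>. 0 < \<epsilon> \<longrightarrow> \<epsilon> < \<delta> / 2 \<longrightarrow>
          (\<exists>G \<in> sets (choice_space M A).
             measure (choice_space M A) (space (choice_space M A) - G)
               \<le> C\<^sub>1 \<epsilon> * exp (- (real M powr \<epsilon> / C)) \<and>
             (\<forall>\<omega>\<in>G. \<forall>h. 0 < h \<longrightarrow> h < 1 / real M ^ 8 \<longrightarrow>
                L2_opnorm (cutoff_fourier (neighborhood (cantor_set M \<omega>) h) h)
                  \<le> ennreal (C * h powr (1 / 2 - 3 / 4 * \<delta> - \<epsilon>))))))"
proof -
  \<comment> \<open>The exponent is the threshold for M^\<epsilon>. Below it the claimed probability
    bound is at least 1, so the empty good set is allowed; above it C = 1 works.\<close>
  define C1 where "C1 \<epsilon> = exp (max 912 (1 / \<epsilon>))" for \<epsilon> :: real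
  have main: "\<exists>G \<in> sets (choice_space M A).
      measure (choice_space M A) (space (choice_space M A) - G) \<le> C1 \<epsilon> * exp (- (real M powr \<epsilon> / 1)) \<and>
      (\<forall>w\<in>G. \<forall>h. 0 < h \<longrightarrow> h < 1 / real M ^ 8 \<longrightarrow>
         L2_opnorm (cutoff_fourier (neighborhood (cantor_set M w) h) h)
           \<le> ennreal (1 * h powr (1 / 2 - 3 / 4 * \<delta> - \<epsilon>)))"
    if \<delta>: "0 < \<delta>" "\<delta> < 2 / 3" and M: "real M \<ge> 2 powr (4 / \<delta>)" and A: "real A = real M powr \<delta>"
      and \<epsilon>: "0 < \<epsilon>" "\<epsilon> < \<delta> / 2" for \<delta> \<epsilon> :: real and M A :: nat
  proof -
    have "2 powr 1 \<le> 2 powr (4 / \<delta>)" using \<delta> by (intro powr_mono) (auto simp: field_simps)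
    then have M2: "2 \<le> M" using M by simp
    have "real M powr \<delta> \<le> real M powr 1" using M2 \<delta> by (intro powr_mono) auto
    then have AM: "A \<le> M" using A M2 by simp
    have "real A > 0" using A M2 by simp
    then have A0: "A > 0" by simp
    interpret prob_space "choice_space M A" by (rule prob_space_choice_space[OF AM])
    let ?S = "choice_space M A"
    show ?thesis
    proof (cases "real M powr \<epsilon> \<ge> max 912 (1 / \<epsilon>)")
      case False
      have "measure ?S (space ?S - {}) \<le> exp (max 912 (1 / \<epsilon>) + - (real M powr \<epsilon>))"
      proof -
        have "0 \<le> max 912 (1 / \<epsilon>) + - (real M powr \<epsilon>)" using False by linarith
        then show ?thesis by (simp only: Diff_empty prob_space one_le_exp_iff)
      qed
      then have "measure ?S (space ?S - {}) \<le> C1 \<epsilon> * exp (- (real M powr \<epsilon> / 1))"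
        unfolding C1_def exp_add by simp
      then show ?thesis by (intro bexI[of _ "{}"]) auto
    next
      case True
      \<comment> \<open>Only n >= 9 occurs for h < M^(-8). The tail of the geometric series is
        2^(-8), below 1.\<close>
      define Bad where "Bad = (\<Union>k. bad_event M A \<epsilon> (k + 9))"
      have sets: "bad_event M A \<epsilon> (k + 9) \<in> sets ?S" for k
        by (rule measure_bad_event_le(1)[OF M2 A0 AM]) simp
      have le: "measure ?S (bad_event M A \<epsilon> (k + 9)) \<le> exp (- (real M powr \<epsilon>)) * (1 / 2) ^ (k + 9)" for k
        by (rule measure_bad_event_le(2)[OF M2 A0 AM]) simp
      have sum: "(\<lambda>k. exp (- (real M powr \<epsilon>)) * (1 / 2) ^ (k + 9)) sums (exp (- (real M powr \<epsilon>)) * ((1 / 2) ^ 9 * 2))"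
      proof (rule sums_mult)
        have "(\<lambda>k. (1 / 2) ^ 9 * (1 / 2 :: real) ^ k) sums ((1 / 2) ^ 9 * (1 / (1 - 1 / 2)))"
          by (intro sums_mult geometric_sums) simp
        then show "(\<lambda>k. (1 / 2 :: real) ^ (k + 9)) sums ((1 / 2) ^ 9 * 2)" by (simp add: power_add mult.commute)
      qed
      have summable: "summable (\<lambda>k. measure ?S (bad_event M A \<epsilon> (k + 9)))"
        by (rule summable_comparison_test_ev[OF _ sums_summable[OF sum]]) (use le in auto)
      have "measure ?S Bad \<le> (\<Sum>k. measure ?S (bad_event M A \<epsilon> (k + 9)))"
        unfolding Bad_def using sets by (intro finite_measure_subadditive_countably summable) auto
      also have "\<dots> \<le> exp (- (real M powr \<epsilon>)) * ((1 / 2) ^ 9 * 2)"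
        using suminf_le[OF le summable sums_summable[OF sum]] sums_unique[OF sum] by simp
      also have "\<dots> \<le> exp (- (real M powr \<epsilon>)) * 1"
        by (intro mult_left_mono) (simp_all add: power_one_over)
      also have "\<dots> \<le> C1 \<epsilon> * exp (- (real M powr \<epsilon> / 1))"
        unfolding C1_def by simp
      finally have bad: "measure ?S Bad \<le> C1 \<epsilon> * exp (- (real M powr \<epsilon> / 1))" .
      have Bad_sets: "Bad \<in> sets ?S" unfolding Bad_def using sets by auto
      then have "space ?S - (space ?S - Bad) = Bad" using sets.sets_into_space by blast
      moreover have "L2_opnorm (cutoff_fourier (neighborhood (cantor_set M w) h) h) \<le> ennreal (1 * h powr (1 / 2 - 3 / 4 * \<delta> - \<epsilon>))"
        if w: "w \<in> space ?S - Bad" and h: "0 < h" "h < 1 / real M ^ 8" for w h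
      proof -
        have "w \<notin> bad_event M A \<epsilon> n" if "n \<ge> 9" for n
          using w that unfolding Bad_def by (metis DiffD2 UNIV_I UN_I le_add_diff_inverse2)
        then have "L2_opnorm (cutoff_fourier (neighborhood (cantor_set M w) h) h) \<le> ennreal (h powr (1 / 2 - 3 / 4 * \<delta> - \<epsilon>))"
          using True w \<epsilon> \<delta> by (intro opnorm_le_outside_bad_event[OF \<delta>(1) A A0 AM M2 \<epsilon>(1)] h) auto
        then show ?thesis by simp
      qed
      ultimately show ?thesis
        using bad Bad_sets by (intro bexI[of _ "space ?S - Bad"]) auto
    qed
  qed
  have "\<forall>\<epsilon>>0. C1 \<epsilon> > 0" by (simp add: C1_def)
  then show ?thesis
    using main by (intro exI[of _ 1] exI[of _ C1]) (auto simp del: div_by_1 mult_1)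
qed

end
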